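(* Let $S$ be a $d$-set in $\mathbb{R}^n$ with $n-1<d<n$. Let $1\le p,q<\infty$, $\alpha>(n-d)/p$ and $f\in B^{\alpha}_{pq}(\mathbb{R}^n)$. Suppose also that $1\le u\le p$ and that $k$ is an integer with $k>\alpha$. Then $$\bigg(\sum_{i\ge0}\big(2^{i(\alpha-(n-d)/p)}\|\mathcal{E}_k(f|_S,Q(\cdot,2^{-i}))_{L^u(S)}\|_{L^p(S)}\big)^q\bigg)^{1/q}+\|f|_S\|_{L^p(S)}$$ $$\le C\bigg\{\bigg(\sum_{j\ge0}\big(2^{j\alpha}\|\mathcal{E}_k(f,Q(\cdot,2^{-j}))_{L^u(\mathbb{R}^n)}\|_{L^p(\mathbb{R}^n)}\big)^q\bigg)^{1/q}+\|f\|_{L^p(\mathbb{R}^n)}\bigg\},$$ where the constant $C>0$ depends only on $S,n,u,p,q,k$ and $\alpha$ (in particular not on $f$).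
   Context: $Q(x,r)=\{y\in\mathbb{R}^n:\|y-x\|_\infty\le r\}$ is the closed cube with center $x$ and side length $2r$. $\mathcal{H}^d$ is the $d$-dimensional Hausdorff measure. A (nonempty) closed set $S\subset\mathbb{R}^n$ is a $d$-set if there are constants $c_1,c_2>0$ such that $c_1r^d\le\mathcal{H}^d(Q(w,r)\cap S)\le c_2r^d$ for all $w\in S$, $0<r\le1$. $L^p(S)$ is taken with respect to $\mathcal{H}^d|_S$. $\mathcal{P}_m$ is the space of polynomials on $\mathbb{R}^n$ of degree at most $m$ ($\mathcal{P}_{-1}=\{0\}$). For a cube $Q$, $$\mathcal{E}_k(f,Q)_{L^u(\mathbb{R}^n)}:=\inf_{P\in\mathcal{P}_{k-1}}\bigg(\frac1{|Q|}\int_Q|f-P|^u\,dx\bigg)^{1/u},$$ and for a cube $Q$ centered in $S$ and a function $g$ on $S$, $$\mathcal{E}_k(g,Q)_{L^u(S)}:=\inf_{P\in\mathcal{P}_{k-1}}\bigg(\frac{1}{\mathcal{H}^d(Q\cap S)}\int_{Q\cap S}|g-P|^u\,d\mathcal{H}^d\bigg)^{1/u}.$$ Norms such as $\|\mathcal{E}_k(g,Q(\cdot,t))_{L^u(S)}\|_{L^p(S)}$ are taken with respect to the center of the cube. For $\alpha>0$, $1\le p,q<\infty$, the Besov space $B^\alpha_{pq}(\mathbb{R}^n)$ consists of all $f\in L^p(\mathbb{R}^n)$ with $\int_0^1\big(t^{-\alpha}\|\mathcal{E}_k(f,Q(\cdot,t))_{L^u(\mathbb{R}^n)}\|_{L^p(\mathbb{R}^n)}\big)^q\frac{dt}{t}<\infty$,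 where $k>\alpha$ is an integer and $1\le u\le p$; different admissible $k,u$ give the same space with equivalent norms. Trace: for $f\in L^1_{\mathrm{loc}}(\mathbb{R}^n)$ put $\bar f(x)=\lim_{r\to0+}\frac{1}{|Q(x,r)|}\int_{Q(x,r)}f(y)\,dy$ wherever the limit exists, and $f|_S(x):=\bar f(x)$ at those $x\in S$ where it exists. For $f\in B^\alpha_{pq}(\mathbb{R}^n)$ with $d>n-\alpha p$ it is known that $\mathcal{H}^d$-almost every point is a Lebesgue point of $\bar f$; in particular $f|_S$ is defined $\mathcal{H}^d$-a.e. on $S$. *)

theory Defs
  imports "HOL-Analysis.Analysis"
begin

definition cube :: "real ^ 'n \<Rightarrow> real \<Rightarrow> (real ^ 'n) set" where
  "cube x r = {y. infnorm (y - x) \<le> r}"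

(* Real powers of extended nonnegative reals; only exponents a > 0 occur below. *)
definition epowr :: "ennreal \<Rightarrow> real \<Rightarrow> ennreal" where
  "epowr x a = (if x = top then top else ennreal (enn2real x powr a))"


text \<open>Hausdorff measure of dimension \<open>d > 0\<close>, without a normalising constant (a constant factor
  affects none of the notions below). Covering sets must be explicitly bounded, because
  \<^const>\<open>diameter\<close> is unspecified on unbounded sets. As \<open>0 powr d = 0\<close>, the case \<open>d = 0\<close> would
  not give the counting measure.\<close>

definition hausdorff_content :: "real \<Rightarrow> real \<Rightarrow> 'a::metric_space set \<Rightarrow> ennreal" where
  "hausdorff_content d \<delta> E =
     (INF U \<in> {U :: nat \<Rightarrow> 'a set. E \<subseteq> (\<Union>i. U i) \<and> (\<forall>i. bounded (U i) \<and> diameter (U i) \<le> \<delta>)}.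
        \<Sum>i. ennreal (diameter (U i) powr d))"

definition hausdorff_outer :: "real \<Rightarrow> 'a::metric_space set \<Rightarrow> ennreal" where
  "hausdorff_outer d E = (SUP \<delta> \<in> {0<..}. hausdorff_content d \<delta> E)"

(* The measurable sets are the Caratheodory measurable ones. *)
definition hausdorff_measure :: "real \<Rightarrow> 'a::metric_space measure" where
  "hausdorff_measure d =
     measure_of UNIV (lambda_system UNIV UNIV (hausdorff_outer d)) (hausdorff_outer d)"

lemma hausdorff_content_empty:
  assumes "0 < \<delta>"
  shows "hausdorff_content d \<delta> {} = 0"
proof -
  have "hausdorff_content d \<delta> ({} :: 'a set) \<le> (\<Sum>i::nat. ennreal (diameter ({} :: 'a set) powr d))"
    unfolding hausdorff_content_def by (rule INF_lower2[of "\<lambda>_. {}"]) (use assms in auto)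
  then show ?thesis by simp
qed

lemma hausdorff_content_mono: "A \<subseteq> B \<Longrightarrow> hausdorff_content d \<delta> A \<le> hausdorff_content d \<delta> B"
  unfolding hausdorff_content_def by (rule INF_superset_mono) auto

lemma hausdorff_content_subadditive:
  fixes A :: "nat \<Rightarrow> 'a::metric_space set"
  shows "hausdorff_content d \<delta> (\<Union>i. A i) \<le> (\<Sum>i. hausdorff_content d \<delta> (A i))"
proof (rule ennreal_le_epsilon)
  fix e :: real
  assume e: "0 < e" and fin: "(\<Sum>n. hausdorff_content d \<delta> (A n)) < top"
  let ?g = "\<lambda>U. ennreal (diameter U powr d)"
  have "hausdorff_content d \<delta> (A n) < hausdorff_content d \<delta> (A n) + e * (1/2)^Suc n" for n
    using e fin by (auto simp add: less_top dest!: ennreal_suminf_lessD)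
  then have "\<exists>U. A n \<subseteq> (\<Union>i. U i) \<and> (\<forall>i. bounded (U i) \<and> diameter (U i) \<le> \<delta>) \<and>
      (\<Sum>i. ?g (U i)) < hausdorff_content d \<delta> (A n) + e * (1/2)^Suc n" for n
    unfolding hausdorff_content_def INF_less_iff by blast
  then obtain B :: "nat \<Rightarrow> nat \<Rightarrow> 'a set" where
    B: "\<And>n. A n \<subseteq> (\<Union>i. B n i)" "\<And>n i. bounded (B n i) \<and> diameter (B n i) \<le> \<delta>"
    and Ble: "\<And>n. (\<Sum>i. ?g (B n i)) < hausdorff_content d \<delta> (A n) + e * (1/2)^Suc n"
    by metis
  define C where "C = case_prod B o prod_decode"
  have cov: "(\<Union>i. A i) \<subseteq> (\<Union>i. C i)"
  proof
    fix x assume "x \<in> (\<Union>i. A i)"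
    then obtain n i where "x \<in> B n i" using B(1) by blast
    then have "x \<in> C (prod_encode (n, i))" by (simp add: C_def)
    then show "x \<in> (\<Union>i. C i)" by blast
  qed
  have "hausdorff_content d \<delta> (\<Union>i. A i) \<le> (\<Sum>i. ?g (C i))"
    unfolding hausdorff_content_def
    by (rule INF_lower) (use cov B(2) in \<open>auto simp: C_def split_def\<close>)
  also have "\<dots> = (\<Sum>n. \<Sum>i. ?g (B n i))"
    unfolding C_def comp_def
    by (rule suminf_ennreal_2dimen[where f = "\<lambda>p. ?g (case_prod B p)", simplified]) simp
  also have "\<dots> \<le> (\<Sum>n. hausdorff_content d \<delta> (A n) + e * (1/2)^Suc n)"
    by (intro suminf_le allI less_imp_le Ble) auto
  also have "\<dots> = (\<Sum>n. hausdorff_content d \<delta> (A n)) + (\<Sum>n. ennreal e * ennreal ((1/2) ^ Suc n))"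
    using e by (subst suminf_add[symmetric])
      (auto simp del: ennreal_suminf_cmult simp add: ennreal_mult[symmetric])
  also have "\<dots> = (\<Sum>n. hausdorff_content d \<delta> (A n)) + e"
    unfolding ennreal_suminf_cmult
    by (subst suminf_ennreal_eq[OF zero_le_power power_half_series]) auto
  finally show "hausdorff_content d \<delta> (\<Union>i. A i) \<le> (\<Sum>n. hausdorff_content d \<delta> (A n)) + e" .
qed

lemma outer_measure_space_hausdorff: "outer_measure_space UNIV (hausdorff_outer d)"
proof -
  have "hausdorff_outer d (\<Union>i. A i) \<le> (\<Sum>i. hausdorff_outer d (A i))" for A :: "nat \<Rightarrow> 'a set"
    unfolding hausdorff_outer_def[of d "\<Union>i. A i"]
  proof (rule SUP_least)
    fix \<delta> :: real assume \<delta>: "\<delta> \<in> {0<..}"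
    have "hausdorff_content d \<delta> (\<Union>i. A i) \<le> (\<Sum>i. hausdorff_content d \<delta> (A i))"
      by (rule hausdorff_content_subadditive)
    also have "\<dots> \<le> (\<Sum>i. hausdorff_outer d (A i))"
      unfolding hausdorff_outer_def by (intro suminf_le SUP_upper \<delta>) auto
    finally show "hausdorff_content d \<delta> (\<Union>i. A i) \<le> (\<Sum>i. hausdorff_outer d (A i))" .
  qed
  moreover have "hausdorff_outer d ({} :: 'a set) = 0"
    unfolding hausdorff_outer_def
    by (auto simp: hausdorff_content_empty bot_ennreal intro!: SUP_eq_const)
  moreover have "hausdorff_outer d A \<le> hausdorff_outer d B" if "A \<subseteq> B" for A B :: "'a set"
    unfolding hausdorff_outer_def by (rule SUP_mono) (use hausdorff_content_mono[OF that] in blast)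
  ultimately show ?thesis
    by (auto simp: outer_measure_space_def positive_def increasing_def countably_subadditive_def)
qed

lemma measure_space_hausdorff:
  "measure_space UNIV (lambda_system UNIV UNIV (hausdorff_outer d)) (hausdorff_outer d)"
  using sigma_algebra.caratheodory_lemma[OF sigma_algebra_Pow, of UNIV "hausdorff_outer d"]
  by (simp add: outer_measure_space_hausdorff)

lemma sets_hausdorff_measure:
  "sets (hausdorff_measure d) = lambda_system UNIV UNIV (hausdorff_outer d)"
  unfolding hausdorff_measure_def
  by (rule sigma_algebra.sets_measure_of_eq)
    (rule measure_space_hausdorff[unfolded measure_space_def, THEN conjunct1])

lemma emeasure_hausdorff_measure:
  "A \<in> sets (hausdorff_measure d) \<Longrightarrow> emeasure (hausdorff_measure d) A = hausdorff_outer d A"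
  unfolding sets_hausdorff_measure unfolding hausdorff_measure_def
  by (rule emeasure_measure_of_sigma)
    (use measure_space_hausdorff in \<open>auto simp: measure_space_def\<close>)

definition d_set :: "real \<Rightarrow> (real ^ 'n) set \<Rightarrow> bool" where
  "d_set d S \<longleftrightarrow> closed S \<and> S \<noteq> {} \<and>
     (\<exists>c1 > 0. \<exists>c2 > 0. \<forall>w \<in> S. \<forall>r. 0 < r \<and> r \<le> 1 \<longrightarrow>
        ennreal (c1 * r powr d) \<le> emeasure (hausdorff_measure d) (cube w r \<inter> S) \<and>
        emeasure (hausdorff_measure d) (cube w r \<inter> S) \<le> ennreal (c2 * r powr d))"

abbreviation hausdorff_on :: "real \<Rightarrow> (real ^ 'n) set \<Rightarrow> (real ^ 'n) measure" where
  "hausdorff_on d S \<equiv> restrict_space (hausdorff_measure d) S"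

(* Multi-indices are functions 'n => nat; the index set is empty for m = -1, so that
   poly_space (-1) = {0}. *)
definition poly_space :: "int \<Rightarrow> (real ^ 'n \<Rightarrow> real) set" where
  "poly_space m =
     {P. \<exists>c. P = (\<lambda>x. \<Sum>a \<in> {a :: 'n \<Rightarrow> nat. int (\<Sum>i\<in>UNIV. a i) \<le> m}. c a * (\<Prod>i\<in>UNIV. x $ i ^ a i))}"

definition Lp_norm :: "'a measure \<Rightarrow> real \<Rightarrow> ('a \<Rightarrow> ennreal) \<Rightarrow> ennreal" where
  "Lp_norm M p h = epowr (\<integral>\<^sup>+x. epowr (h x) p \<partial>M) (1 / p)"

definition best_approx ::
  "(real ^ 'n) measure \<Rightarrow> int \<Rightarrow> real \<Rightarrow> (real ^ 'n \<Rightarrow> real) \<Rightarrow> (real ^ 'n) set \<Rightarrow> ennreal" where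
  "best_approx M k u g A =
     (INF P \<in> poly_space (k - 1).
        epowr ((\<integral>\<^sup>+x\<in>A. ennreal (\<bar>g x - P x\<bar> powr u) \<partial>M) / emeasure M A) (1 / u))"

definition best_approx_Rn ::
  "int \<Rightarrow> real \<Rightarrow> (real ^ 'n \<Rightarrow> real) \<Rightarrow> real \<Rightarrow> real ^ 'n \<Rightarrow> ennreal" where
  "best_approx_Rn k u f t x = best_approx lebesgue k u f (cube x t)"

definition best_approx_on ::
  "real \<Rightarrow> (real ^ 'n) set \<Rightarrow> int \<Rightarrow> real \<Rightarrow> (real ^ 'n \<Rightarrow> real) \<Rightarrow> real \<Rightarrow> real ^ 'n \<Rightarrow> ennreal" where
  "best_approx_on d S k u g t x = best_approx (hausdorff_on d S) k u g (cube x t \<inter> S)"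

(* The space does not depend on the admissible choice of k and u; asking for some admissible
   pair is formally the weakest membership condition. *)
definition besov :: "real \<Rightarrow> real \<Rightarrow> real \<Rightarrow> (real ^ 'n \<Rightarrow> real) set" where
  "besov \<alpha> p q =
     {f. f \<in> borel_measurable lebesgue \<and> Lp_norm lebesgue p (\<lambda>x. ennreal \<bar>f x\<bar>) < \<infinity> \<and>
         (\<exists>(k::int) u. \<alpha> < of_int k \<and> 1 \<le> u \<and> u \<le> p \<and>
            (\<integral>\<^sup>+t\<in>{0<..1}. epowr (ennreal (t powr - \<alpha>) * Lp_norm lebesgue p (best_approx_Rn k u f t)) q
                * ennreal (1 / t) \<partial>lborel) < \<infinity>)}"

definition cube_mean :: "(real ^ 'n \<Rightarrow> real) \<Rightarrow> real ^ 'n \<Rightarrow> real \<Rightarrow> real" where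
  "cube_mean f x r = (LINT y:cube x r|lebesgue. f y) / measure lebesgue (cube x r)"

(* Where the limit does not exist the value is set to 0 to obtain a total function. *)
definition precise_rep :: "(real ^ 'n \<Rightarrow> real) \<Rightarrow> real ^ 'n \<Rightarrow> real" where
  "precise_rep f x =
     (if \<exists>l. (cube_mean f x \<longlongrightarrow> l) (at_right 0) then Lim (at_right 0) (cube_mean f x) else 0)"

definition trace_on :: "(real ^ 'n) set \<Rightarrow> (real ^ 'n \<Rightarrow> real) \<Rightarrow> real ^ 'n \<Rightarrow> real" where
  "trace_on S f = restrict (precise_rep f) S"

end

(*
  For each point x, the near-best polynomials of f on the dyadic cubes around x form a telescoping
  sequence whose increments are controlled by the approximation errors E_l(x). Hence wherever these
  errors are summable in l the means of f converge, and the limit differs from any polynomial P by at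
  most a constant times the mean of |f - P| over Q(x, 2^-m) plus the tail sum over l >= m of E_l(x).
  Averaging this over Q(x, 2^-i) with respect to the measure on S bounds the approximation error of
  the trace by tails of the E_l. A grid of cells of side 2^-l compares the L^p norms of E_l over S and
  over R^n at the cost of the factor 2^(l (n - d) / p), and a discrete Hardy inequality sums the tails.
*)
theory Submission
  imports Defs
begin

subsection \<open>Powers and means\<close>

text \<open>The increments can be controlled because a polynomial of degree below k is bounded on a
  cube by a constant times its mean there, with one constant for all cubes. The near-best polynomial
  depends on the centre, whereas the error of the trace on Q(x, 2^-i) calls for a single polynomial
  for all y in that cube. The bound at y is therefore proved for every P, averaged over y with P
  fixed, and only then minimised over P; the P-term becomes the error of f on the cube of twice the
  radius about x. Neither the errors E_l nor the trace are shown to be measurable. They are replaced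
  by measurable majorants before Fubini's theorem or Jensen's inequality is applied. Finiteness of
  the norms of these majorants also yields the summability of the errors almost everywhere on S,
  hence the existence of the limit there. The weight 2^(l \<alpha>) keeps the exponent \<alpha> - (n
  - d) / p after the passage to S. Its positivity pays for the geometric losses in the Hardy
  inequality.\<close>

lemma epowr_zero [simp]: "epowr 0 a = 0"
  by (simp add: epowr_def)

lemma epowr_top [simp]: "epowr top a = top"
  by (simp add: epowr_def)

lemma epowr_ennreal: "0 \<le> x \<Longrightarrow> epowr (ennreal x) a = ennreal (x powr a)"
  by (simp add: epowr_def)

lemma epowr_one_exp [simp]: "epowr x 1 = x"
  by (cases x) (simp_all add: epowr_ennreal)

lemma epowr_eq_top_iff [simp]: "epowr x a = top \<longleftrightarrow> x = top"
  by (simp add: epowr_def)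

lemma epowr_eq_0_iff [simp]: "epowr x a = 0 \<longleftrightarrow> x = 0"
  by (cases x) (auto simp: epowr_ennreal)

lemma epowr_mono:
  assumes "x \<le> y" "0 \<le> a" shows "epowr x a \<le> epowr y a"
  using assms by (cases x; cases y) (auto simp: epowr_ennreal powr_mono2 top_unique)

lemma epowr_epowr: "epowr (epowr x a) b = epowr x (a * b)"
  by (cases x) (simp_all add: epowr_ennreal powr_powr)

lemma epowr_mult: "epowr (x * y) a = epowr x a * epowr y a"
proof (cases x; cases y)
  fix r s :: real assume "0 \<le> r" "x = ennreal r" "0 \<le> s" "y = ennreal s"
  then show ?thesis by (simp add: epowr_ennreal powr_mult flip: ennreal_mult)
qed (auto simp: ennreal_mult_top ennreal_top_mult)

text \<open>The conventions at 0 and \<open>top\<close> do not depend on the exponent, so no sign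
  condition arises. In particular the splitting p = 1 + (p - 1) remains available for p = 1.\<close>

lemma epowr_add_exp: "epowr x (a + b) = epowr x a * epowr x b"
  by (cases x) (simp_all add: epowr_ennreal powr_add flip: ennreal_mult)

lemma epowr_inverse:
  assumes "0 < a" shows "epowr (epowr x a) (1 / a) = x" "epowr (epowr x (1 / a)) a = x"
  using assms by (simp_all add: epowr_epowr)

lemma epowr_le_iff:
  assumes "0 < a" shows "epowr x a \<le> y \<longleftrightarrow> x \<le> epowr y (1 / a)"
  using epowr_mono[of "epowr x a" y "1/a"] epowr_mono[of x "epowr y (1/a)" a] assms
  by (auto simp: epowr_inverse)

text \<open>Bounding the sum by twice the maximum treats exponents below and above 1 alike; both
  occur later, as p and as 1 / p.\<close>

lemma epowr_add_le:
  assumes "0 \<le> a" shows "epowr (x + y) a \<le> ennreal (2 powr a) * (epowr x a + epowr y a)"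
proof -
  have "epowr (x + y) a \<le> epowr (2 * max x y) a"
    using assms by (intro epowr_mono) (simp_all add: mult_2 add_mono)
  also have "\<dots> = ennreal (2 powr a) * epowr (max x y) a"
    using epowr_ennreal[of 2 a] by (simp add: epowr_mult)
  also have "\<dots> \<le> ennreal (2 powr a) * (epowr x a + epowr y a)"
    by (intro mult_left_mono) (auto simp: max_def)
  finally show ?thesis .
qed

lemma epowr_measurable [measurable]:
  assumes [measurable]: "h \<in> borel_measurable M"
  shows "(\<lambda>x. epowr (h x) a) \<in> borel_measurable M"
  unfolding epowr_def by measurable

text \<open>Young's inequality multiplied by p. In this form it integrates over a probability
  measure to an inequality from which the term with the factor p - 1 cancels.\<close>

lemma Young_epowr:
  assumes p: "1 < p"
  shows "ennreal p * (s * t) \<le> epowr s p + ennreal (p - 1) * epowr t (p / (p - 1))"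
proof (cases "s = top \<or> t = top")
  case True
  then show ?thesis using p by (auto simp: ennreal_mult_top)
next
  case False
  then obtain a b where ab: "s = ennreal a" "t = ennreal b" "0 \<le> a" "0 \<le> b"
    by (metis ennreal_cases)
  have "1/p + 1/(p/(p-1)) = 1" using p by (simp add: field_simps)
  then have "a * b \<le> a powr p / p + b powr (p/(p-1)) / (p/(p-1))"
    using p ab by (intro Youngs_inequality) (auto simp: field_simps)
  then have "p * (a * b) \<le> a powr p + (p - 1) * b powr (p/(p-1))"
    using p by (simp add: field_simps)
  then show ?thesis using p ab
    by (simp add: epowr_ennreal flip: ennreal_mult ennreal_plus)
qed

text \<open>Jensen's inequality, by Young's inequality with the mean as second factor.\<close>
lemma power_mean:
  fixes M :: "'a measure"
  assumes p: "1 \<le> p" and h[measurable]: "h \<in> borel_measurable M"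
    and m: "emeasure M (space M) = 1"
  shows "epowr (\<integral>\<^sup>+x. h x \<partial>M) p \<le> (\<integral>\<^sup>+x. epowr (h x) p \<partial>M)"
proof (cases "p = 1")
  case False
  then have p1: "1 < p" using p by simp
  define s where "s = (\<integral>\<^sup>+x. h x \<partial>M)"
  have fin: "epowr s p \<le> (\<integral>\<^sup>+x. epowr (h x) p \<partial>M)" if s: "s < top"
  proof -
    \<comment> \<open>With this power of the mean both \<open>s * t\<close> and the conjugate power
      of \<open>t\<close> equal \<open>epowr s p\<close>, so Young's inequality integrates to the
      claim plus p - 1 copies of \<open>epowr s p\<close> on each side. Cancelling these copies
      requires \<open>s\<close> to be finite.\<close>
    define t where "t = epowr s (p - 1)"
    have tp: "epowr t (p/(p-1)) = epowr s p" using p1 by (simp add: t_def epowr_epowr)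
    have st: "s * t = epowr s p"
      using epowr_add_exp[of s 1 "p - 1"] by (simp add: t_def)
    have "ennreal p * (s * t) = (\<integral>\<^sup>+x. ennreal p * (h x * t) \<partial>M)"
      by (simp add: nn_integral_cmult nn_integral_multc s_def)
    also have "\<dots> \<le> (\<integral>\<^sup>+x. epowr (h x) p + ennreal (p - 1) * epowr s p \<partial>M)"
      by (intro nn_integral_mono) (use Young_epowr[OF p1, of _ t] tp in simp)
    also have "\<dots> = (\<integral>\<^sup>+x. epowr (h x) p \<partial>M) + ennreal (p - 1) * epowr s p"
      by (simp add: nn_integral_add m)
    finally have "ennreal (p - 1) * epowr s p + epowr s p
        \<le> ennreal (p - 1) * epowr s p + (\<integral>\<^sup>+x. epowr (h x) p \<partial>M)"
      using p1 ennreal_plus[of "p - 1" 1] by (simp add: st distrib_right add.commute)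
    then show ?thesis using s
      by (subst (asm) ennreal_add_left_cancel_le) (auto simp: ennreal_mult_eq_top_iff)
  qed
  show ?thesis
  proof (cases "s < top")
    case True
    then show ?thesis using fin by (simp add: s_def)
  next
    case False
    \<comment> \<open>An infinite mean forces an infinite p-th moment, since h \<le> 1 + h^p and the
      total mass is 1.\<close>
    then have "top = s" using less_top by fastforce
    also have "s \<le> (\<integral>\<^sup>+x. 1 + epowr (h x) p \<partial>M)"
      unfolding s_def
    proof (intro nn_integral_mono)
      fix x
      show "h x \<le> 1 + epowr (h x) p"
      proof (cases "h x")
        case (real r)
        have "r \<le> 1 + r powr p"
        proof (cases "r \<le> 1")
          case False
          then have "r powr 1 \<le> r powr p" using p by (intro powr_mono) auto
          then show ?thesis using False by simp
        qed (simp add: add_increasing2)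
        then show ?thesis using real ennreal_plus[of 1 "r powr p"]
          by (simp add: epowr_ennreal flip: ennreal_plus ennreal_1)
      qed simp
    qed
    also have "\<dots> = 1 + (\<integral>\<^sup>+x. epowr (h x) p \<partial>M)"
      by (simp add: nn_integral_add m)
    finally have "(\<integral>\<^sup>+x. epowr (h x) p \<partial>M) = top" by (simp add: top_unique)
    then show ?thesis by simp
  qed
qed simp

lemma nn_integral_scaled_restrict:
  assumes A: "A \<in> sets M" and [measurable]: "h \<in> borel_measurable M"
  shows "(\<integral>\<^sup>+x. h x \<partial>density M (\<lambda>x. indicator A x / emeasure M A)) = (\<integral>\<^sup>+x\<in>A. h x \<partial>M) / emeasure M A"
proof -
  have "(\<integral>\<^sup>+x. h x \<partial>density M (\<lambda>x. indicator A x / emeasure M A))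
      = (\<integral>\<^sup>+x. (h x * indicator A x) / emeasure M A \<partial>M)"
    using A by (subst nn_integral_density) (auto simp: divide_ennreal_def ac_simps intro!: nn_integral_cong)
  also have "\<dots> = (\<integral>\<^sup>+x\<in>A. h x \<partial>M) / emeasure M A"
    using A by (intro nn_integral_divide) auto
  finally show ?thesis .
qed

lemma power_mean_set:
  assumes p: "1 \<le> p" and h[measurable]: "h \<in> borel_measurable M"
    and A[measurable]: "A \<in> sets M" and "emeasure M A \<noteq> 0" "emeasure M A \<noteq> top"
  shows "epowr ((\<integral>\<^sup>+x\<in>A. h x \<partial>M) / emeasure M A) p \<le> (\<integral>\<^sup>+x\<in>A. epowr (h x) p \<partial>M) / emeasure M A"
proof -
  let ?N = "density M (\<lambda>x. indicator A x / emeasure M A)"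
  have "emeasure ?N (space ?N) = (\<integral>\<^sup>+x. 1 \<partial>?N)" by simp
  also have "\<dots> = (\<integral>\<^sup>+x\<in>A. 1 \<partial>M) / emeasure M A"
    by (rule nn_integral_scaled_restrict) auto
  also have "\<dots> = 1" using assms by (simp add: top.not_eq_extremum)
  finally have "emeasure ?N (space ?N) = 1" .
  from power_mean[OF p _ this, of h] show ?thesis
    by (simp add: nn_integral_scaled_restrict)
qed

text \<open>Jensen's inequality with exponent p / u, applied to the u-th power of h.\<close>

lemma Lu_mean_le_Lp_mean:
  assumes "0 < u" "u \<le> p" and h[measurable]: "h \<in> borel_measurable M"
    and A[measurable]: "A \<in> sets M" and "emeasure M A \<noteq> 0" "emeasure M A \<noteq> top"
  shows "epowr ((\<integral>\<^sup>+x\<in>A. epowr (h x) u \<partial>M) / emeasure M A) (1 / u)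
    \<le> epowr ((\<integral>\<^sup>+x\<in>A. epowr (h x) p \<partial>M) / emeasure M A) (1 / p)"
proof -
  have "epowr ((\<integral>\<^sup>+x\<in>A. epowr (h x) u \<partial>M) / emeasure M A) (p / u)
      \<le> (\<integral>\<^sup>+x\<in>A. epowr (epowr (h x) u) (p / u) \<partial>M) / emeasure M A"
    using assms by (intro power_mean_set) auto
  then have "epowr (epowr ((\<integral>\<^sup>+x\<in>A. epowr (h x) u \<partial>M) / emeasure M A) (p / u)) (1 / p)
     \<le> epowr ((\<integral>\<^sup>+x\<in>A. epowr (h x) p \<partial>M) / emeasure M A) (1 / p)"
    using assms by (intro epowr_mono) (auto simp: epowr_epowr)
  then show ?thesis using assms by (simp add: epowr_epowr)
qed

section \<open>Powers of infinite sums\<close>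

lemma ennreal_le_suminf: "f j \<le> (\<Sum>i. f i :: ennreal)"
  using sum_le_suminf[of f "{j}"] by simp

text \<open>Every term is at most the sum s, hence x_j^p \<le> x_j s^(p - 1); summing over j gives
  s^p.\<close>

lemma suminf_epowr_le:
  assumes p: "1 \<le> p" shows "(\<Sum>j. epowr (x j) p) \<le> epowr (\<Sum>j. x j) p"
proof -
  let ?s = "\<Sum>j. x j"
  have "epowr (x j) p \<le> x j * epowr ?s (p - 1)" for j
  proof -
    have "epowr (x j) p = x j * epowr (x j) (p - 1)"
      using epowr_add_exp[of "x j" 1 "p - 1"] by simp
    also have "\<dots> \<le> x j * epowr ?s (p - 1)"
      using p by (intro mult_left_mono epowr_mono ennreal_le_suminf) auto
    finally show ?thesis .
  qed
  then have "(\<Sum>j. epowr (x j) p) \<le> (\<Sum>j. x j * epowr ?s (p - 1))"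
    by (intro suminf_le) auto
  also have "\<dots> = epowr ?s p"
    using epowr_add_exp[of ?s 1 "p - 1"] by simp
  finally show ?thesis .
qed

text \<open>Subadditivity of the p-th root: the preceding inequality applied to the roots.\<close>

lemma epowr_suminf_le:
  assumes p: "1 \<le> p" shows "epowr (\<Sum>j. x j) (1 / p) \<le> (\<Sum>j. epowr (x j) (1 / p))"
proof -
  have "(\<Sum>j. x j) = (\<Sum>j. epowr (epowr (x j) (1 / p)) p)"
    using p by (simp add: epowr_inverse)
  also have "\<dots> \<le> epowr (\<Sum>j. epowr (x j) (1 / p)) p"
    by (rule suminf_epowr_le[OF p])
  finally show ?thesis using p epowr_le_iff[of p] epowr_mono[of _ _ "1/p"]
    by (metis (no_types, lifting) divide_nonneg_nonneg epowr_inverse(1) less_eq_real_def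
        order_less_le_trans zero_le_one zero_less_one)
qed

lemma suminf_powr_geometric:
  assumes "0 < a" shows "(\<Sum>j. ennreal (2 powr - (a * real j))) = ennreal (1 / (1 - 2 powr - a))"
proof -
  have lt: "2 powr - a < (1::real)" using assms powr_less_mono[of "-a" 0 2] by simp
  have eq: "2 powr - (a * real j) = (2 powr - a) ^ j" for j
    using powr_realpow[of "2 powr - a" j] by (simp add: powr_powr)
  have "(\<lambda>j. (2 powr - a) ^ j) sums (1 / (1 - 2 powr - a))"
    using lt by (intro geometric_sums) auto
  then show ?thesis unfolding eq using lt by (intro suminf_ennreal_eq) auto
qed

text \<open>Hoelder's inequality against the geometric weights \<open>2 powr - (\<delta> * j / p)\<close>.\<close>
lemma epowr_suminf_weighted:
  assumes p: "1 \<le> p" and \<delta>: "0 < \<delta>"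
  shows "\<exists>C. 0 < C \<and> (\<forall>x :: nat \<Rightarrow> ennreal. epowr (\<Sum>j. x j) p
      \<le> ennreal C * (\<Sum>j. ennreal (2 powr (\<delta> * real j)) * epowr (x j) p))"
proof -
  \<comment> \<open>Jensen's inequality will produce the factor 2^(\<gamma> (p - 1) j), which this
    choice keeps below 2^(\<delta> j). The geometric sum W turns the weights into a probability
    distribution on the indices.\<close>
  define \<gamma> where "\<gamma> = \<delta> / p"
  have \<gamma>: "0 < \<gamma>" "\<gamma> * (p - 1) \<le> \<delta>"
    using p \<delta> by (auto simp: \<gamma>_def field_simps)
  define W where "W = 1 / (1 - 2 powr - \<gamma>)"
  have "2 powr - \<gamma> < (1::real)" using \<gamma> powr_less_mono[of "-\<gamma>" 0 2] by simp
  then have W: "0 < W" by (simp add: W_def)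
  define w where "w j = 2 powr - (\<gamma> * real j) / W" for j :: nat
  have w: "0 < w j" for j using W by (simp add: w_def)
  have sw: "(\<Sum>j. ennreal (w j)) = 1"
  proof -
    have "(\<Sum>j. ennreal (w j)) = (\<Sum>j. ennreal (2 powr - (\<gamma> * real j)) * ennreal (1 / W))"
      using W by (simp add: w_def flip: ennreal_mult)
    also have "\<dots> = (\<Sum>j. ennreal (2 powr - (\<gamma> * real j))) * ennreal (1 / W)"
      by (rule ennreal_suminf_multc)
    also have "\<dots> = ennreal W * ennreal (1 / W)"
      using suminf_powr_geometric[OF \<gamma>(1)] by (simp add: W_def)
    also have "\<dots> = 1" using W by (simp flip: ennreal_mult)
    finally show ?thesis .
  qed
  let ?N = "density (count_space UNIV) (\<lambda>j. ennreal (w j))"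
  have int: "(\<integral>\<^sup>+j. h j \<partial>?N) = (\<Sum>j. ennreal (w j) * h j)" for h :: "nat \<Rightarrow> ennreal"
    by (simp add: nn_integral_density nn_integral_count_space_nat)
  have m: "emeasure ?N (space ?N) = 1"
    using int[of "\<lambda>_. 1"] sw by simp
  have "epowr (\<Sum>j. x j) p \<le> ennreal (W powr (p - 1)) * (\<Sum>j. ennreal (2 powr (\<gamma> * (p - 1) * real j)) * epowr (x j) p)"
    for x :: "nat \<Rightarrow> ennreal"
  proof -
    \<comment> \<open>Writing x_j as w_j (x_j / w_j) makes the sum a mean with respect to the
      weights; the p-th power then carries w_j^(1 - p).\<close>
    have c: "ennreal (w j) * (x j * ennreal (1 / w j)) = x j" for j
      using w[of j] by (subst mult.left_commute) (simp add: less_imp_neq[symmetric] flip: ennreal_mult)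
    have e: "ennreal (w j) * epowr (x j * ennreal (1 / w j)) p
        = ennreal (W powr (p - 1)) * (ennreal (2 powr (\<gamma> * (p - 1) * real j)) * epowr (x j) p)" for j
    proof -
      have "w j * (1 / w j) powr p = (1 / w j) powr (p - 1)"
        using w[of j] by (simp add: powr_diff powr_divide)
      also have "\<dots> = (W * 2 powr (\<gamma> * real j)) powr (p - 1)"
        by (rule arg_cong2[where f = "(powr)"]) (simp_all add: w_def powr_minus divide_simps)
      also have "\<dots> = W powr (p - 1) * 2 powr (\<gamma> * (p - 1) * real j)"
        using W by (simp add: powr_mult powr_powr ac_simps)
      finally have "w j * (1 / w j) powr p = W powr (p - 1) * 2 powr (\<gamma> * (p - 1) * real j)" .
      then have "ennreal (w j) * ennreal ((1 / w j) powr p)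
          = ennreal (W powr (p - 1)) * ennreal (2 powr (\<gamma> * (p - 1) * real j))"
        using w[of j] by (metis ennreal_mult less_imp_le powr_ge_zero)
      moreover have "epowr (x j * ennreal (1 / w j)) p = ennreal ((1 / w j) powr p) * epowr (x j) p"
        using w[of j] by (simp only: epowr_mult epowr_ennreal less_imp_le zero_less_divide_1_iff mult.commute)
      ultimately show ?thesis by (simp only: mult.assoc[symmetric])
    qed
    show ?thesis
      using power_mean[OF p _ m, of "\<lambda>j. x j * ennreal (1 / w j)"] unfolding int c e by simp
  qed
  moreover have "(\<Sum>j. ennreal (2 powr (\<gamma> * (p - 1) * real j)) * epowr (x j) p)
      \<le> (\<Sum>j. ennreal (2 powr (\<delta> * real j)) * epowr (x j) p)" for x :: "nat \<Rightarrow> ennreal"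
    using \<gamma>(2) by (intro suminf_le mult_right_mono ennreal_leI powr_mono) auto
  ultimately have "epowr (\<Sum>j. x j) p
      \<le> ennreal (W powr (p - 1)) * (\<Sum>j. ennreal (2 powr (\<delta> * real j)) * epowr (x j) p)"
    for x :: "nat \<Rightarrow> ennreal"
    by (meson mult_left_mono order_trans zero_le)
  then show ?thesis using W by (intro exI[of _ "W powr (p - 1)"]) simp
qed

subsection \<open>Cubes and polynomials\<close>

lemma mem_cube_iff: "y \<in> cube x r \<longleftrightarrow> (\<forall>i. \<bar>y $ i - x $ i\<bar> \<le> r)"
proof
  assume "y \<in> cube x r"
  then show "\<forall>i. \<bar>y $ i - x $ i\<bar> \<le> r"
    using order_trans[OF component_le_infnorm_cart[of "y - x"], of r] by (simp add: cube_def)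
next
  assume "\<forall>i. \<bar>y $ i - x $ i\<bar> \<le> r"
  then show "y \<in> cube x r"
    unfolding cube_def infnorm_cart by (auto intro!: cSup_least)
qed

lemma cube_eq_cbox: "cube x r = cbox (\<chi> i. x $ i - r) (\<chi> i. x $ i + r)"
  by (auto simp: set_eq_iff mem_cube_iff mem_box_cart abs_le_iff algebra_simps)

lemma cube_measurable [measurable, simp]: "cube x r \<in> sets borel" "cube x r \<in> sets lebesgue"
  by (simp_all add: cube_eq_cbox)

lemma centre_in_cube [simp]: "0 \<le> r \<Longrightarrow> x \<in> cube x r"
  by (simp add: mem_cube_iff)

lemma cube_commute: "y \<in> cube x r \<longleftrightarrow> x \<in> cube y r"
  by (simp add: mem_cube_iff abs_minus_commute)

lemma cube_mono: "r \<le> s \<Longrightarrow> cube x r \<subseteq> cube x s"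
  by (auto simp: cube_def)

lemma cube_subset_cube:
  assumes "z \<in> cube x s" "r + s \<le> t" shows "cube z r \<subseteq> cube x t"
proof
  fix y assume y: "y \<in> cube z r"
  show "y \<in> cube x t" unfolding mem_cube_iff
  proof
    fix i
    have "\<bar>y $ i - z $ i\<bar> \<le> r" "\<bar>z $ i - x $ i\<bar> \<le> s" using y assms(1) by (auto simp: mem_cube_iff)
    then show "\<bar>y $ i - x $ i\<bar> \<le> t" using assms(2) by linarith
  qed
qed

lemma emeasure_cube:
  fixes x :: "real ^ 'n" assumes "0 \<le> r"
  shows "emeasure lborel (cube x r) = ennreal ((2 * r) ^ CARD('n))"
    and "emeasure lebesgue (cube x r) = ennreal ((2 * r) ^ CARD('n))"
proof -
  have "cbox (\<chi> i. x $ i - r) (\<chi> i. x $ i + r) \<noteq> {}"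
    using centre_in_cube[OF assms, of x] by (auto simp: cube_eq_cbox)
  then have "measure lborel (cube x r) = (\<Prod>i\<in>(UNIV :: 'n set). 2 * r)"
    unfolding cube_eq_cbox by (subst content_cbox_cart) (auto intro!: prod.cong)
  moreover have "emeasure lborel (cube x r) = measure lborel (cube x r)"
    unfolding cube_eq_cbox using emeasure_lborel_cbox_finite
    by (intro emeasure_eq_ennreal_measure) (simp add: less_top)
  ultimately show *: "emeasure lborel (cube x r) = ennreal ((2 * r) ^ CARD('n))" by simp
  then show "emeasure lebesgue (cube x r) = ennreal ((2 * r) ^ CARD('n))" by simp
qed

section \<open>Averages over cubes\<close>

definition cube_avg :: "real ^ 'n \<Rightarrow> real \<Rightarrow> (real ^ 'n \<Rightarrow> ennreal) \<Rightarrow> ennreal" where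
  "cube_avg x r h = (\<integral>\<^sup>+y\<in>cube x r. h y \<partial>lebesgue) / emeasure lebesgue (cube x r)"

lemma emeasure_cube_nontrivial:
  "0 < r \<Longrightarrow> emeasure lebesgue (cube x r) \<noteq> 0" "0 < r \<Longrightarrow> emeasure lebesgue (cube x r) \<noteq> top"
  by (simp_all only: emeasure_cube less_imp_le) (simp_all add: power_mult_distrib)

lemma cube_avg_mono:
  assumes "\<And>y. y \<in> cube x r \<Longrightarrow> g y \<le> h y" shows "cube_avg x r g \<le> cube_avg x r h"
  unfolding cube_avg_def
  by (intro divide_right_mono_ennreal nn_integral_mono) (use assms in \<open>auto simp: indicator_def\<close>)

lemma cube_avg_const [simp]: "0 < r \<Longrightarrow> cube_avg x r (\<lambda>_. c) = c"
  unfolding cube_avg_def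
  using emeasure_cube_nontrivial[of r x]
  by (subst nn_integral_cmult_indicator) (auto intro: ennreal_mult_divide_eq)

lemma cube_avg_add:
  assumes [measurable]: "g \<in> borel_measurable lebesgue" "h \<in> borel_measurable lebesgue"
  shows "cube_avg x r (\<lambda>y. g y + h y) = cube_avg x r g + cube_avg x r h"
  unfolding cube_avg_def
  by (simp add: distrib_right nn_integral_add add_divide_distrib_ennreal)

lemma cube_avg_sum:
  assumes [measurable]: "\<And>i. g i \<in> borel_measurable lebesgue"
  shows "cube_avg x r (\<lambda>y. \<Sum>i\<in>I. g i y) = (\<Sum>i\<in>I. cube_avg x r (g i))"
proof (cases "finite I")
  case True
  then show ?thesis by induct (auto simp: cube_avg_add, simp add: cube_avg_def)
qed (simp add: cube_avg_def)

lemma cube_avg_cmult: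
  assumes [measurable]: "h \<in> borel_measurable lebesgue"
  shows "cube_avg x r (\<lambda>y. c * h y) = c * cube_avg x r h"
  unfolding cube_avg_def
  by (simp add: mult.assoc nn_integral_cmult ennreal_times_divide)

lemma cube_avg_subset:
  fixes x z :: "real ^ 'n"
  assumes "0 < r" "0 < s" "cube x r \<subseteq> cube z s"
  shows "cube_avg x r h \<le> ennreal ((s / r) ^ CARD('n)) * cube_avg z s h"
proof -
  let ?I = "\<integral>\<^sup>+y\<in>cube z s. h y \<partial>lebesgue"
  have "cube_avg x r h \<le> ?I / ennreal ((2 * r) ^ CARD('n))"
    unfolding cube_avg_def using assms
    by (subst emeasure_cube) (auto intro!: divide_right_mono_ennreal nn_integral_mono simp: indicator_def)
  also have "\<dots> = ennreal ((s / r) ^ CARD('n)) * (?I / ennreal ((2 * s) ^ CARD('n)))"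
  proof -
    have "1 / (2 * r) ^ CARD('n) = (s / r) ^ CARD('n) * (1 / (2 * s) ^ CARD('n))"
      using assms by (simp add: power_divide power_mult_distrib)
    then have "inverse (ennreal ((2 * r) ^ CARD('n)))
        = ennreal ((s / r) ^ CARD('n)) * inverse (ennreal ((2 * s) ^ CARD('n)))"
      using assms by (simp add: inverse_ennreal inverse_eq_divide flip: ennreal_mult)
    then show ?thesis by (simp add: divide_ennreal_def ac_simps)
  qed
  finally show ?thesis using assms by (simp add: cube_avg_def emeasure_cube)
qed

section \<open>Values of polynomials bounded by their means\<close>

lemma extrapolation_weights:
  fixes t :: "nat \<Rightarrow> real"
  assumes "inj_on t {1..K}" "\<And>i. i \<in> {1..K} \<Longrightarrow> t i \<noteq> 0"
  shows "\<exists>w. \<forall>q. degree q < K \<longrightarrow> poly q 0 = (\<Sum>i\<in>{1..K}. w i * poly q (t i))"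
  using assms
proof (induction K)
  case (Suc K)
  from Suc.prems have "inj_on t {1..K}" "\<And>i. i \<in> {1..K} \<Longrightarrow> t i \<noteq> 0"
    by (auto simp: inj_on_def)
  from Suc.IH[OF this] obtain w
    where w: "\<And>q. degree q < K \<Longrightarrow> poly q 0 = (\<Sum>i\<in>{1..K}. w i * poly q (t i))" by blast
  define c where "c = t (Suc K)"
  have ne: "t i \<noteq> c" if "i \<in> {1..K}" for i
    using inj_onD[OF Suc.prems(1), of i "Suc K"] that by (auto simp: c_def)
  \<comment> \<open>Splitting off the new node c gives q(s) = q(c) + (s - c) q1(s) with q1 of
    smaller degree. Insert the old weights for q1(0), together with q1(t_i) = (q(t_i) - q(c)) / (t_i
    - c), into q(0) = q(c) - c q1(0). All multiples of q(c) are collected at the index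
    \<open>Suc K\<close>.\<close>
  define w' where "w' i = (if i = Suc K then 1 + (\<Sum>j\<in>{1..K}. c * w j / (t j - c))
      else - c * w i / (t i - c))" for i
  have "poly q 0 = (\<Sum>i\<in>{1..Suc K}. w' i * poly q (t i))" if q: "degree q < Suc K" for q
  proof -
    have "poly (q - [:poly q c:]) c = 0" by simp
    then obtain q1 where q1: "q - [:poly q c:] = [:- c, 1:] * q1"
      by (metis dvdE poly_eq_0_iff_dvd)
    have qe: "poly q s = poly q c + (s - c) * poly q1 s" for s
    proof -
      have "poly q s - poly q c = poly (q - [:poly q c:]) s" by simp
      also have "\<dots> = (s - c) * poly q1 s" unfolding q1 by (simp add: algebra_simps)
      finally show ?thesis by simp
    qed
    have aux: "- c * (v * y) = (- c * v / A) * (x + A * y) + c * v / A * x" if "A \<noteq> 0"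
      for A v x y :: real using that by (simp add: distrib_left)
    have "poly q1 0 = (\<Sum>i\<in>{1..K}. w i * poly q1 (t i))"
    proof (cases "q1 = 0")
      case False
      have "degree ([:- c, 1:] * q1) = degree [:- c, 1:] + degree q1"
        using False by (intro degree_mult_eq) auto
      moreover have "degree (q - [:poly q c:]) \<le> degree q"
        by (rule order_trans[OF degree_diff_le_max]) simp
      ultimately have "degree q1 < K" using q q1 by simp
      then show ?thesis by (rule w)
    qed simp
    then have "poly q 0 = poly q c + (\<Sum>i\<in>{1..K}. - c * (w i * poly q1 (t i)))"
      by (subst qe) (simp add: sum_distrib_left sum_negf)
    also have "(\<Sum>i\<in>{1..K}. - c * (w i * poly q1 (t i)))
        = (\<Sum>i\<in>{1..K}. (- c * w i / (t i - c)) * poly q (t i) + c * w i / (t i - c) * poly q c)"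
    proof (rule sum.cong)
      fix i assume "i \<in> {1..K}"
      from ne[OF this] have "t i - c \<noteq> 0" by simp
      then show "- c * (w i * poly q1 (t i))
          = (- c * w i / (t i - c)) * poly q (t i) + c * w i / (t i - c) * poly q c"
        unfolding qe[of "t i"] by (rule aux)
    qed simp
    also have "\<dots> = (\<Sum>i\<in>{1..K}. w' i * poly q (t i)) + (\<Sum>i\<in>{1..K}. c * w i / (t i - c)) * poly q c"
      unfolding sum.distrib sum_distrib_right
      by (intro arg_cong2[where f = "(+)"] sum.cong) (auto simp: w'_def)
    finally show ?thesis by (simp add: w'_def c_def distrib_right)
  qed
  then show ?case by blast
qed simp

text \<open>Along the line through z and y a polynomial becomes univariate in the parameter, and its
  value at parameter 0 is extrapolated from the nodes i / K. The nodes lie in (0, 1]: the sample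
  points stay on the segment, and each is the image of y under a nondegenerate contraction towards
  z. The weights depend on K alone.\<close>

lemma poly_space_extrapolation:
  assumes "0 < K"
  shows "\<exists>w. \<forall>P \<in> (poly_space (int K - 1) :: (real ^ 'n \<Rightarrow> real) set). \<forall>z y.
    P z = (\<Sum>i\<in>{1..K}. w i * P (z + (real i / real K) *\<^sub>R (y - z)))"
proof -
  have inj: "inj_on (\<lambda>i. real i / real K) {1..K}" using assms by (auto simp: inj_on_def)
  obtain w where w: "\<And>q. degree q < K \<Longrightarrow> poly q 0 = (\<Sum>i\<in>{1..K}. w i * poly q (real i / real K))"
    using extrapolation_weights[OF inj] assms by auto
  have mono: "(\<Prod>l\<in>UNIV. z $ l ^ a l)
      = (\<Sum>i\<in>{1..K}. w i * (\<Prod>l\<in>UNIV. (z + (real i / real K) *\<^sub>R (y - z)) $ l ^ a l))"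
    if a: "int (\<Sum>l\<in>UNIV. a l) \<le> int K - 1" for z y :: "real ^ 'n" and a :: "'n \<Rightarrow> nat"
  proof -
    \<comment> \<open>The monomial restricted to the line, as a polynomial in the parameter; its
      degree is at most the total degree of the monomial.\<close>
    define q where "q = (\<Prod>l\<in>UNIV. [:z $ l, (y - z) $ l:] ^ a l)"
    have "degree q \<le> (\<Sum>l\<in>UNIV. degree ([:z $ l, (y - z) $ l:] ^ a l))"
      unfolding q_def using degree_prod_sum_le[of UNIV "\<lambda>l. [:z $ l, (y - z) $ l:] ^ a l"]
      by (simp add: comp_def)
    also have "\<dots> \<le> (\<Sum>l\<in>UNIV. a l)"
    proof (rule sum_mono)
      fix l
      have "degree ([:z $ l, (y - z) $ l:] ^ a l) \<le> degree [:z $ l, (y - z) $ l:] * a l"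
        by (rule degree_power_le)
      also have "\<dots> \<le> a l" by simp
      finally show "degree ([:z $ l, (y - z) $ l:] ^ a l) \<le> a l" .
    qed
    finally have "degree q < K" using a assms by linarith
    from w[OF this] show ?thesis
      by (simp add: q_def poly_prod mult.commute)
  qed
  have "P z = (\<Sum>i\<in>{1..K}. w i * P (z + (real i / real K) *\<^sub>R (y - z)))"
    if "P \<in> poly_space (int K - 1)" for P :: "real ^ 'n \<Rightarrow> real" and z y
  proof -
    from that obtain c where P: "\<And>x. P x = (\<Sum>a \<in> {a :: 'n \<Rightarrow> nat. int (\<Sum>i\<in>UNIV. a i) \<le> int K - 1}.
        c a * (\<Prod>i\<in>UNIV. x $ i ^ a i))"
      unfolding poly_space_def by auto
    show ?thesis
      unfolding P sum_distrib_left
      by (subst sum.swap, rule sum.cong, simp, subst mono[where y = y])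
        (auto simp: sum_distrib_left ac_simps)
  qed
  then show ?thesis by blast
qed

lemma poly_space_continuous: "P \<in> poly_space m \<Longrightarrow> continuous_on UNIV P"
  unfolding poly_space_def by (clarsimp, intro continuous_intros)

lemma poly_space_measurable:
  assumes "P \<in> poly_space m" shows "P \<in> borel_measurable lebesgue" "P \<in> borel_measurable borel"
proof -
  show "P \<in> borel_measurable borel"
    using poly_space_continuous[OF assms] by (rule borel_measurable_continuous_onI)
  then show "P \<in> borel_measurable lebesgue" by (simp add: measurable_completion)
qed

lemma poly_space_diff:
  assumes "P \<in> poly_space m" "Q \<in> poly_space m" shows "(\<lambda>x. P x - Q x) \<in> poly_space m"
proof -
  let ?A = "{a :: 'a \<Rightarrow> nat. int (\<Sum>i\<in>UNIV. a i) \<le> m}"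
  from assms obtain c c' where "P = (\<lambda>x. \<Sum>a\<in>?A. c a * (\<Prod>i\<in>UNIV. x $ i ^ a i))"
    "Q = (\<lambda>x. \<Sum>a\<in>?A. c' a * (\<Prod>i\<in>UNIV. x $ i ^ a i))"
    unfolding poly_space_def by blast
  then have "(\<lambda>x. P x - Q x) = (\<lambda>x. \<Sum>a\<in>?A. (c a - c' a) * (\<Prod>i\<in>UNIV. x $ i ^ a i))"
    by (simp add: left_diff_distrib sum_subtractf)
  then show ?thesis unfolding poly_space_def by (intro CollectI exI[of _ "\<lambda>a. c a - c' a"])
qed

lemma zero_in_poly_space: "(\<lambda>_. 0) \<in> poly_space m"
  unfolding poly_space_def by (auto intro!: exI[of _ "\<lambda>_. 0"])

text \<open>By convexity the contraction towards z maps the cube into itself, and the substitution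
  costs the inverse of its Jacobian c^n.\<close>

lemma cube_avg_contraction:
  fixes x z :: "real ^ 'n"
  assumes c: "0 < c" "c \<le> 1" and z: "z \<in> cube x r" and h[measurable]: "h \<in> borel_measurable borel"
  shows "cube_avg x r (\<lambda>y. h (z + c *\<^sub>R (y - z))) \<le> ennreal ((1 / c) ^ CARD('n)) * cube_avg x r h"
proof -
  let ?T = "\<lambda>y. (z - c *\<^sub>R z) + c *\<^sub>R y"
  let ?g = "\<lambda>y. h y * indicator (cube x r) y"
  have T: "z + c *\<^sub>R (y - z) = ?T y" for y by (simp add: algebra_simps)
  have in_cube: "?T y \<in> cube x r" if y: "y \<in> cube x r" for y
  proof -
    have "convex (cube x r)" by (simp add: cube_eq_cbox convex_box)
    then have "(1 - c) *\<^sub>R z + c *\<^sub>R y \<in> cube x r" using c z y by (intro convexD) auto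
    then show ?thesis by (simp add: algebra_simps)
  qed
  have "(\<integral>\<^sup>+y\<in>cube x r. h (?T y) \<partial>lebesgue) \<le> (\<integral>\<^sup>+y. ?g (?T y) \<partial>lborel)"
    unfolding nn_integral_completion by (intro nn_integral_mono) (auto simp: indicator_def dest: in_cube)
  also have "\<dots> = ennreal ((1 / c) ^ CARD('n)) * (ennreal (c ^ CARD('n)) * (\<integral>\<^sup>+y. ?g (?T y) \<partial>lborel))"
    using c by (simp add: power_divide flip: mult.assoc ennreal_mult)
  also have "ennreal (c ^ CARD('n)) * (\<integral>\<^sup>+y. ?g (?T y) \<partial>lborel) = (\<integral>\<^sup>+y. ?g y \<partial>lborel)"
  proof -
    have "(\<integral>\<^sup>+y. ?g y \<partial>lborel)
      = (\<integral>\<^sup>+y. ?g y \<partial>density (distr lborel borel ?T) (\<lambda>_. ennreal (c ^ CARD('n))))"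
      using c by (subst lborel_affine[of c "z - c *\<^sub>R z"]) auto
    also have "\<dots> = (\<integral>\<^sup>+y. ennreal (c ^ CARD('n)) * ?g (?T y) \<partial>lborel)"
      by (simp add: nn_integral_density nn_integral_distr)
    also have "\<dots> = ennreal (c ^ CARD('n)) * (\<integral>\<^sup>+y. ?g (?T y) \<partial>lborel)"
      by (intro nn_integral_cmult) auto
    finally show ?thesis by simp
  qed
  finally have "(\<integral>\<^sup>+y\<in>cube x r. h (?T y) \<partial>lebesgue)
      \<le> ennreal ((1 / c) ^ CARD('n)) * (\<integral>\<^sup>+y\<in>cube x r. h y \<partial>lebesgue)"
    by (simp add: nn_integral_completion)
  then show ?thesis
    unfolding cube_avg_def T ennreal_times_divide by (rule divide_right_mono_ennreal)
qed

text \<open>Averaging the extrapolation identity over y in the cube bounds the value at z by means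
  of |P| over contracted copies of the cube. Since the weights come from the degree bound only, one
  constant serves all polynomials, cubes and points z.\<close>

lemma poly_space_sup_le_avg:
  assumes "0 < k"
  shows "\<exists>K>0. \<forall>P \<in> (poly_space (k - 1) :: (real ^ 'n \<Rightarrow> real) set). \<forall>x r z. 0 < r \<longrightarrow> z \<in> cube x r \<longrightarrow>
    ennreal \<bar>P z\<bar> \<le> ennreal K * cube_avg x r (\<lambda>y. ennreal \<bar>P y\<bar>)"
proof -
  define m where "m = nat k"
  have m: "0 < m" "int m = k" using assms by (auto simp: m_def)
  obtain w where w: "\<And>P z y. P \<in> (poly_space (k - 1) :: (real ^ 'n \<Rightarrow> real) set) \<Longrightarrow>
      P z = (\<Sum>i\<in>{1..m}. w i * P (z + (real i / real m) *\<^sub>R (y - z)))"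
    using poly_space_extrapolation[OF m(1), where 'n = 'n] m(2) by metis
  define K where "K = (\<Sum>i\<in>{1..m}. \<bar>w i\<bar> * (1 / (real i / real m)) ^ CARD('n))"
  have "ennreal \<bar>P z\<bar> \<le> ennreal (K + 1) * cube_avg x r (\<lambda>y. ennreal \<bar>P y\<bar>)"
    if P: "P \<in> poly_space (k - 1)" and r: "0 < r" and z: "z \<in> cube x r"
    for P :: "real ^ 'n \<Rightarrow> real" and x r z
  proof -
    note [measurable] = poly_space_measurable[OF P]
    have meas: "(\<lambda>y. P (z + c *\<^sub>R (y - z))) \<in> borel_measurable lebesgue" for c
    proof -
      have "(\<lambda>y. P (z + c *\<^sub>R (y - z))) \<in> borel_measurable borel" by measurable
      then show ?thesis by (simp add: measurable_completion)
    qed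
    note [measurable] = meas
    have "ennreal \<bar>P z\<bar> = cube_avg x r (\<lambda>y. ennreal \<bar>P z\<bar>)" using r by simp
    also have "\<dots> \<le> cube_avg x r (\<lambda>y. \<Sum>i\<in>{1..m}. ennreal \<bar>w i\<bar> * ennreal \<bar>P (z + (real i / real m) *\<^sub>R (y - z))\<bar>)"
    proof (rule cube_avg_mono)
      fix y
      have "\<bar>P z\<bar> = \<bar>\<Sum>i\<in>{1..m}. w i * P (z + (real i / real m) *\<^sub>R (y - z))\<bar>"
        using w[OF P, of z y] by simp
      also have "\<dots> \<le> (\<Sum>i\<in>{1..m}. \<bar>w i\<bar> * \<bar>P (z + (real i / real m) *\<^sub>R (y - z))\<bar>)"
        by (rule order_trans[OF sum_abs]) (simp add: abs_mult)
      finally show "ennreal \<bar>P z\<bar> \<le> (\<Sum>i\<in>{1..m}. ennreal \<bar>w i\<bar> * ennreal \<bar>P (z + (real i / real m) *\<^sub>R (y - z))\<bar>)"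
        by (simp add: ennreal_leI flip: ennreal_mult)
    qed
    also have "\<dots> = (\<Sum>i\<in>{1..m}. ennreal \<bar>w i\<bar> * cube_avg x r (\<lambda>y. ennreal \<bar>P (z + (real i / real m) *\<^sub>R (y - z))\<bar>))"
      by (subst cube_avg_sum) (auto simp: cube_avg_cmult)
    also have "\<dots> \<le> (\<Sum>i\<in>{1..m}. ennreal \<bar>w i\<bar> * (ennreal ((1 / (real i / real m)) ^ CARD('n))
        * cube_avg x r (\<lambda>y. ennreal \<bar>P y\<bar>)))"
      using m z by (intro sum_mono mult_left_mono cube_avg_contraction[where h = "\<lambda>y. ennreal \<bar>P y\<bar>"]) auto
    also have "\<dots> = ennreal K * cube_avg x r (\<lambda>y. ennreal \<bar>P y\<bar>)"
      by (simp add: K_def sum_distrib_right flip: mult.assoc ennreal_mult sum_ennreal)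
    also have "\<dots> \<le> ennreal (K + 1) * cube_avg x r (\<lambda>y. ennreal \<bar>P y\<bar>)"
      by (intro mult_right_mono ennreal_leI) auto
    finally show ?thesis .
  qed
  moreover have "0 < K + 1" by (auto simp: K_def intro!: add_nonneg_pos sum_nonneg)
  ultimately show ?thesis by blast
qed

subsection \<open>Near-best polynomials at small scales\<close>

lemma two_powr_minus_Suc: "2 powr - real (Suc l) = 2 powr - real l / 2"
proof -
  have "- real (Suc l) = - real l - 1" by simp
  then show ?thesis by (simp only: powr_diff powr_one_gt_zero_iff) simp
qed

lemma two_powr_minus_nat: "2 powr - real l = (1 / 2) ^ l"
  by (induction l) (simp_all only: two_powr_minus_Suc power_Suc, simp_all)

lemma dyadic_scale:
  fixes r :: real
  assumes "0 < r" "r \<le> 2 powr - real m"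
  obtains j where "2 powr - real (Suc (m + j)) < r" "r \<le> 2 powr - real (m + j)"
proof -
  let ?Q = "\<lambda>j. 2 powr - real (m + j) < r"
  have "\<exists>j. (1 / 2 :: real) ^ j < r" using assms(1) by (intro real_arch_pow_inv) auto
  then obtain j where j: "(1 / 2 :: real) ^ j < r" by blast
  have "(1 / 2 :: real) ^ (m + j) \<le> (1 / 2) ^ j" by (intro power_decreasing) auto
  then have "?Q j" using j by (simp only: two_powr_minus_nat)
  then have L: "?Q (LEAST j. ?Q j)" by (rule LeastI)
  have "(LEAST j. ?Q j) \<noteq> 0"
  proof
    assume "(LEAST j. ?Q j) = 0"
    then show False using L assms(2) by simp
  qed
  then obtain i where i: "(LEAST j. ?Q j) = Suc i" by (meson not0_implies_Suc)
  then have "\<not> ?Q i" by (metis lessI not_less_Least)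
  moreover have "?Q (Suc i)" using L i by metis
  ultimately show thesis by (intro that[of i]) auto
qed

lemma cube_avg_le_sup:
  assumes "0 < r" "\<And>y. y \<in> cube x r \<Longrightarrow> h y \<le> c" shows "cube_avg x r h \<le> c"
  using cube_avg_mono[of x r h "\<lambda>_. c"] assms by simp

lemma cube_avg_triangle:
  assumes [measurable]: "f \<in> borel_measurable lebesgue" "g \<in> borel_measurable lebesgue"
    "h \<in> borel_measurable lebesgue"
  shows "cube_avg x r (\<lambda>y. ennreal \<bar>f y - h y\<bar>)
    \<le> cube_avg x r (\<lambda>y. ennreal \<bar>f y - g y\<bar>) + cube_avg x r (\<lambda>y. ennreal \<bar>g y - h y\<bar>)"
proof -
  have "cube_avg x r (\<lambda>y. ennreal \<bar>f y - h y\<bar>)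
      \<le> cube_avg x r (\<lambda>y. ennreal \<bar>f y - g y\<bar> + ennreal \<bar>g y - h y\<bar>)"
    by (intro cube_avg_mono) (simp add: ennreal_leI flip: ennreal_plus)
  then show ?thesis by (simp add: cube_avg_add)
qed

lemma best_approx_le:
  assumes "P \<in> poly_space (k - 1)"
  shows "best_approx M k u f A
    \<le> epowr ((\<integral>\<^sup>+x\<in>A. epowr (ennreal \<bar>f x - P x\<bar>) u \<partial>M) / emeasure M A) (1 / u)"
  unfolding best_approx_def using assms by (intro INF_lower2) (auto simp: epowr_ennreal)

text \<open>A bound strictly above the infimum replaces a minimiser. Only the L^1 mean is retained,
  as the telescoping argument uses nothing more.\<close>

lemma cube_avg_near_best:
  assumes u: "1 \<le> u" and r: "0 < r" and f[measurable]: "f \<in> borel_measurable lebesgue"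
    and lt: "best_approx_Rn k u f r x < c"
  shows "\<exists>P \<in> poly_space (k - 1). cube_avg x r (\<lambda>y. ennreal \<bar>f y - P y\<bar>) \<le> c"
proof -
  obtain P where P: "P \<in> poly_space (k - 1)"
    and le: "epowr ((\<integral>\<^sup>+y\<in>cube x r. ennreal (\<bar>f y - P y\<bar> powr u) \<partial>lebesgue) / emeasure lebesgue (cube x r)) (1 / u) < c"
    using lt unfolding best_approx_Rn_def best_approx_def INF_less_iff by blast
  note [measurable] = poly_space_measurable(1)[OF P]
  have "cube_avg x r (\<lambda>y. ennreal \<bar>f y - P y\<bar>)
      \<le> epowr ((\<integral>\<^sup>+y\<in>cube x r. epowr (ennreal \<bar>f y - P y\<bar>) u \<partial>lebesgue) / emeasure lebesgue (cube x r)) (1 / u)"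
    using Lu_mean_le_Lp_mean[of 1 u "\<lambda>y. ennreal \<bar>f y - P y\<bar>" lebesgue "cube x r"] u r
      emeasure_cube_nontrivial[OF r, of x] unfolding cube_avg_def by simp
  also have "\<dots> \<le> c" using le by (simp add: epowr_ennreal less_imp_le)
  finally show ?thesis using P by blast
qed

lemma ennreal_le_add_scaled_epsilon:
  fixes x b :: ennreal
  assumes "0 < K" and le: "\<And>e. 0 < e \<Longrightarrow> x \<le> ennreal K * (b + ennreal e)"
  shows "x \<le> ennreal K * b"
proof (rule ennreal_le_epsilon)
  fix e :: real assume e: "0 < e"
  have "x \<le> ennreal K * (b + ennreal (e / K))" using assms e by simp
  also have "\<dots> = ennreal K * b + ennreal e"
    using assms(1) e by (simp add: distrib_left flip: ennreal_mult)
  finally show "x \<le> ennreal K * b + ennreal e" .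
qed

lemma suminf_half_ennreal: "0 \<le> \<eta> \<Longrightarrow> (\<Sum>j. ennreal (\<eta> * (1 / 2) ^ Suc j)) = ennreal \<eta>"
  using sums_mult[OF power_half_series, of \<eta>] by (intro suminf_ennreal_eq) auto

text \<open>The telescoping argument: between consecutive dyadic scales the near-best polynomials
  differ, uniformly on the smaller cube, by at most the two approximation errors.\<close>
lemma cube_avg_small_scale:
  assumes k: "0 < k" and u: "1 \<le> u"
  shows "\<exists>K>0. \<forall>f :: real ^ 'n \<Rightarrow> real. f \<in> borel_measurable lebesgue \<longrightarrow>
    (\<forall>P \<in> poly_space (k - 1). \<forall>x m r. 0 < r \<longrightarrow> r \<le> 2 powr - real m \<longrightarrow>
      cube_avg x r (\<lambda>y. ennreal \<bar>f y - P y\<bar>)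
      \<le> ennreal K * (cube_avg x (2 powr - real m) (\<lambda>y. ennreal \<bar>f y - P y\<bar>)
          + (\<Sum>j. best_approx_Rn k u f (2 powr - real (m + j)) x)))"
proof -
  obtain K0 where K0: "0 < K0" and
    sup: "\<And>P x r z. P \<in> (poly_space (k - 1) :: (real ^ 'n \<Rightarrow> real) set) \<Longrightarrow> 0 < r \<Longrightarrow> z \<in> cube x r \<Longrightarrow>
      ennreal \<bar>P z\<bar> \<le> ennreal K0 * cube_avg x r (\<lambda>y. ennreal \<bar>P y\<bar>)"
    using poly_space_sup_le_avg[OF k, where 'n = 'n] by blast
  define c :: real where "c = 2 ^ CARD('n)"
  have c: "1 \<le> c" by (simp add: c_def)
  \<comment> \<open>The summand c compares f - Q_j on the given cube with the next larger dyadic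
    one; K0 (1 + c) bounds the telescoped difference Q_j - P.\<close>
  define K where "K = c + K0 * (1 + c)"
  have K: "0 < K" using c K0 by (auto simp: K_def intro!: add_pos_pos)
  have half: "cube_avg x r h \<le> ennreal c * cube_avg x s h" if "0 < r" "r \<le> s" "s \<le> 2 * r"
    for x :: "real ^ 'n" and r s h
  proof -
    have "cube_avg x r h \<le> ennreal ((s / r) ^ CARD('n)) * cube_avg x s h"
      using that by (intro cube_avg_subset cube_mono) auto
    also have "\<dots> \<le> ennreal c * cube_avg x s h"
      unfolding c_def using that by (intro mult_right_mono ennreal_leI power_mono) (auto simp: field_simps)
    finally show ?thesis .
  qed
  have "cube_avg x r (\<lambda>y. ennreal \<bar>f y - P y\<bar>)
      \<le> ennreal K * (cube_avg x (2 powr - real m) (\<lambda>y. ennreal \<bar>f y - P y\<bar>)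
          + (\<Sum>j. best_approx_Rn k u f (2 powr - real (m + j)) x))"
    if f[measurable]: "f \<in> borel_measurable lebesgue" and P: "P \<in> poly_space (k - 1)"
      and r: "0 < r" "r \<le> 2 powr - real m"
    for f P :: "real ^ 'n \<Rightarrow> real" and x m r
  proof (cases "(\<Sum>j. best_approx_Rn k u f (2 powr - real (m + j)) x) = top")
    case True
    then show ?thesis using K by (simp add: ennreal_mult_top)
  next
    case False
    let ?E = "\<lambda>j. best_approx_Rn k u f (2 powr - real (m + j)) x"
    let ?avg = "\<lambda>r g h. cube_avg x r (\<lambda>y. ennreal \<bar>g y - h y\<bar>)"
    have Efin: "?E j < top" for j
      using ennreal_le_suminf[of ?E j] False by (simp add: less_top order_le_less_trans)
    show ?thesis
    proof (rule ennreal_le_add_scaled_epsilon[OF K])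
      fix \<eta> :: real assume \<eta>: "0 < \<eta>"
      \<comment> \<open>The slack at scale m + j is a geometric fraction of \<eta>, so that all
        slacks together amount to \<eta>. Finiteness of the errors makes the inequality required for
        a near-best polynomial strict.\<close>
      have "\<exists>Q. Q \<in> poly_space (k - 1) \<and> ?avg (2 powr - real (m + j)) f Q \<le> ?E j + ennreal (\<eta> * (1 / 2) ^ Suc j)" for j
        using cube_avg_near_best[OF u _ f, of "2 powr - real (m + j)" k x "?E j + ennreal (\<eta> * (1 / 2) ^ Suc j)"]
          Efin[of j] \<eta> by (auto simp: ennreal_zero_less_mult_iff less_top)
      then have "\<forall>j. \<exists>Q. Q \<in> poly_space (k - 1) \<and> ?avg (2 powr - real (m + j)) f Q \<le> ?E j + ennreal (\<eta> * (1 / 2) ^ Suc j)"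
        by (rule allI)
      from choice[OF this] obtain Q0 where Q0: "\<And>j. Q0 j \<in> poly_space (k - 1)"
        "\<And>j. ?avg (2 powr - real (m + j)) f (Q0 j) \<le> ?E j + ennreal (\<eta> * (1 / 2) ^ Suc j)"
        by blast
      \<comment> \<open>Starting the chain at the prescribed P makes the telescoping sum equal to
        Q_j - P; the mean of |f - P| enters as \<open>a 0\<close>.\<close>
      define Q where "Q j = (if j = 0 then P else Q0 j)" for j
      have Q: "Q j \<in> poly_space (k - 1)" for j using P Q0 by (simp add: Q_def)
      note [measurable] = poly_space_measurable(1)[OF Q]
      define a where "a j = ?avg (2 powr - real (m + j)) f (Q j)" for j
      define A where "A = (\<Sum>j. a j)"
      have step: "ennreal \<bar>Q (Suc j) z - Q j z\<bar> \<le> ennreal K0 * (a (Suc j) + ennreal c * a j)"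
        if z: "z \<in> cube x (2 powr - real (m + Suc j))" for j z
      proof -
        let ?r = "2 powr - real (m + Suc j)"
        have "ennreal \<bar>Q (Suc j) z - Q j z\<bar> \<le> ennreal K0 * ?avg ?r (Q (Suc j)) (Q j)"
          by (rule sup[OF poly_space_diff[OF Q Q] _ z]) simp
        also have "\<dots> \<le> ennreal K0 * (?avg ?r (Q (Suc j)) f + ?avg ?r f (Q j))"
          by (intro mult_left_mono cube_avg_triangle) auto
        also have "?avg ?r (Q (Suc j)) f = a (Suc j)"
          unfolding a_def by (simp only: abs_minus_commute)
        also have "ennreal K0 * (a (Suc j) + ?avg ?r f (Q j)) \<le> ennreal K0 * (a (Suc j) + ennreal c * a j)"
          unfolding a_def add_Suc_right two_powr_minus_Suc by (intro mult_left_mono add_left_mono half) auto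
        finally show ?thesis .
      qed
      have tele: "ennreal \<bar>Q j z - P z\<bar> \<le> (\<Sum>i<j. ennreal K0 * (a (Suc i) + ennreal c * a i))"
        if "z \<in> cube x (2 powr - real (m + j))" for j z
        using that
      proof (induction j)
        case 0
        then show ?case by (simp add: Q_def)
      next
        case (Suc j)
        have "cube x (2 powr - real (m + Suc j)) \<subseteq> cube x (2 powr - real (m + j))"
          by (intro cube_mono) simp
        then have "ennreal \<bar>Q j z - P z\<bar> \<le> (\<Sum>i<j. ennreal K0 * (a (Suc i) + ennreal c * a i))"
          using Suc by blast
        then have "ennreal \<bar>Q j z - P z\<bar> + ennreal \<bar>Q (Suc j) z - Q j z\<bar>
            \<le> (\<Sum>i<Suc j. ennreal K0 * (a (Suc i) + ennreal c * a i))"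
          unfolding sum.lessThan_Suc using step[OF Suc.prems] by (rule add_mono)
        moreover have "ennreal \<bar>Q (Suc j) z - P z\<bar> \<le> ennreal \<bar>Q j z - P z\<bar> + ennreal \<bar>Q (Suc j) z - Q j z\<bar>"
          by (simp add: ennreal_leI flip: ennreal_plus)
        ultimately show ?case by (rule order_trans[rotated])
      qed
      have sup_j: "ennreal \<bar>Q j z - P z\<bar> \<le> ennreal (K0 * (1 + c)) * A"
        if "z \<in> cube x (2 powr - real (m + j))" for j z
      proof -
        have s1: "(\<Sum>i<j. a (Suc i)) \<le> A"
        proof -
          have "(\<Sum>i<j. a (Suc i)) = sum a {Suc 0..<Suc j}"
            by (subst sum.shift_bounds_Suc_ivl) (simp add: atLeast0LessThan)
          also have "\<dots> \<le> A" unfolding A_def by (intro sum_le_suminf) auto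
          finally show ?thesis .
        qed
        have s2: "(\<Sum>i<j. a i) \<le> A" unfolding A_def by (intro sum_le_suminf) auto
        note tele[OF that]
        also have "(\<Sum>i<j. ennreal K0 * (a (Suc i) + ennreal c * a i))
            = ennreal K0 * ((\<Sum>i<j. a (Suc i)) + ennreal c * (\<Sum>i<j. a i))"
          by (simp add: sum_distrib_left sum.distrib distrib_left)
        also have "\<dots> \<le> ennreal K0 * (A + ennreal c * A)"
          using s1 s2 by (intro mult_left_mono add_mono) auto
        also have "\<dots> = ennreal (K0 * (1 + c)) * A"
          using K0 c by (simp add: ennreal_mult distrib_left distrib_right ac_simps)
        finally show ?thesis .
      qed
      \<comment> \<open>The radius is at least half the dyadic one, so the passage to the dyadic
        cube costs only the factor c, uniformly in j.\<close>
      obtain j where j: "2 powr - real (Suc (m + j)) < r" "r \<le> 2 powr - real (m + j)"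
        using dyadic_scale[OF r] by blast
      have "?avg r f P \<le> ?avg r f (Q j) + ?avg r (Q j) P"
        using poly_space_measurable(1)[OF P] by (intro cube_avg_triangle) auto
      also have "\<dots> \<le> ennreal c * A + ennreal (K0 * (1 + c)) * A"
      proof (rule add_mono)
        have "?avg r f (Q j) \<le> ennreal c * a j"
          unfolding a_def using j(1)[unfolded two_powr_minus_Suc] j(2) r by (intro half) auto
        also have "\<dots> \<le> ennreal c * A"
          unfolding A_def by (intro mult_left_mono ennreal_le_suminf) auto
        finally show "?avg r f (Q j) \<le> ennreal c * A" .
        show "?avg r (Q j) P \<le> ennreal (K0 * (1 + c)) * A"
          using r(1) sup_j cube_mono[OF j(2), of x] by (intro cube_avg_le_sup) blast+
      qed
      also have "\<dots> = ennreal K * A"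
        using c K0 by (simp add: K_def distrib_right)
      finally have le: "?avg r f P \<le> ennreal K * A" .
      \<comment> \<open>The entry at 0 belongs to P, the later ones to near-best polynomials. The
        error at j = 0 is added only to complete the tail sum.\<close>
      have "A = a 0 + (\<Sum>j. a (Suc j))"
        unfolding A_def by (subst suminf_offset[of _ 1]) auto
      also have "\<dots> \<le> a 0 + (\<Sum>j. ?E (Suc j) + ennreal (\<eta> * (1 / 2) ^ Suc (Suc j)))"
        unfolding a_def Q_def using Q0(2)
        by (intro add_left_mono suminf_le) (auto simp del: power_Suc of_nat_add of_nat_Suc add_Suc_right)
      also have "\<dots> \<le> a 0 + (\<Sum>j. ?E j + ennreal (\<eta> * (1 / 2) ^ Suc j))"
        by (intro add_left_mono, subst (2) suminf_offset[of _ 1]) auto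
      also have "(\<Sum>j. ?E j + ennreal (\<eta> * (1 / 2) ^ Suc j)) = (\<Sum>j. ?E j) + (\<Sum>j. ennreal (\<eta> * (1 / 2) ^ Suc j))"
        by (rule suminf_add[symmetric]) auto
      also have "(\<Sum>j. ennreal (\<eta> * (1 / 2) ^ Suc j)) = ennreal \<eta>"
        using \<eta> by (intro suminf_half_ennreal) simp
      also have "a 0 = ?avg (2 powr - real m) f P" by (simp add: a_def Q_def)
      finally have "A \<le> ?avg (2 powr - real m) f P + (\<Sum>j. ?E j) + ennreal \<eta>"
        by (simp only: add.assoc)
      then show "?avg r f P \<le> ennreal K * (?avg (2 powr - real m) f P + (\<Sum>j. ?E j) + ennreal \<eta>)"
        using le by (meson mult_left_mono order_trans zero_le)
    qed
  qed
  then show ?thesis using K by blast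
qed

subsection \<open>Pointwise values of the trace\<close>

lemma cube_mean_diff_le:
  fixes f :: "real ^ 'n \<Rightarrow> real"
  assumes f[measurable]: "f \<in> borel_measurable lebesgue" and r: "0 < r"
    and fin: "cube_avg x r (\<lambda>y. ennreal \<bar>f y\<bar>) < top"
  shows "ennreal \<bar>cube_mean f x r - c\<bar> \<le> cube_avg x r (\<lambda>y. ennreal \<bar>f y - c\<bar>)"
proof -
  let ?Q = "cube x r"
  define m where "m = (2 * r) ^ CARD('n)"
  have m: "0 < m" using r by (simp add: m_def)
  have em: "emeasure lebesgue ?Q = ennreal m" unfolding m_def using r by (intro emeasure_cube) simp
  have ms: "measure lebesgue ?Q = m" using m by (simp add: measure_def em)
  have f_int: "set_integrable lebesgue ?Q f"
    unfolding set_integrable_def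
  proof (rule integrableI_bounded)
    have "(\<integral>\<^sup>+y. ennreal (norm (indicat_real ?Q y *\<^sub>R f y)) \<partial>lebesgue)
        = (\<integral>\<^sup>+y\<in>?Q. ennreal \<bar>f y\<bar> \<partial>lebesgue)"
      by (intro nn_integral_cong) (auto simp: indicator_def)
    also have "\<dots> < top"
      using fin unfolding cube_avg_def em
      by (metis ennreal_neq_top ennreal_top_divide less_top)
    finally show "(\<integral>\<^sup>+y. ennreal (norm (indicat_real ?Q y *\<^sub>R f y)) \<partial>lebesgue) < \<infinity>" by simp
  qed measurable
  have c_int: "set_integrable lebesgue ?Q (\<lambda>_. c)"
    unfolding set_integrable_def by (intro integrable_scaleR_left) (simp add: em)
  have "(LINT y:?Q|lebesgue. c) = m * c"
    unfolding set_lebesgue_integral_def by (simp add: ms)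
  then have "(LINT y:?Q|lebesgue. f y - c) = (LINT y:?Q|lebesgue. f y) - m * c"
    using set_integral_diff(2)[OF f_int c_int] by metis
  then have eq: "cube_mean f x r - c = (LINT y:?Q|lebesgue. f y - c) / m"
    using m unfolding cube_mean_def ms by (simp add: field_simps)
  have "ennreal \<bar>LINT y:?Q|lebesgue. f y - c\<bar> \<le> (\<integral>\<^sup>+y. ennreal (norm (indicat_real ?Q y *\<^sub>R (f y - c))) \<partial>lebesgue)"
    using integral_norm_bound_ennreal[of lebesgue "\<lambda>y. indicat_real ?Q y *\<^sub>R (f y - c)"]
      set_integral_diff(1)[OF f_int c_int]
    unfolding set_lebesgue_integral_def set_integrable_def by simp
  also have "\<dots> = (\<integral>\<^sup>+y\<in>?Q. ennreal \<bar>f y - c\<bar> \<partial>lebesgue)"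
    by (intro nn_integral_cong) (auto simp: indicator_def)
  finally have le: "ennreal \<bar>LINT y:?Q|lebesgue. f y - c\<bar> \<le> (\<integral>\<^sup>+y\<in>?Q. ennreal \<bar>f y - c\<bar> \<partial>lebesgue)" .
  have "ennreal \<bar>cube_mean f x r - c\<bar> = ennreal \<bar>LINT y:?Q|lebesgue. f y - c\<bar> / ennreal m"
    unfolding eq using m by (subst divide_ennreal) (auto simp: abs_divide)
  also have "\<dots> \<le> cube_avg x r (\<lambda>y. ennreal \<bar>f y - c\<bar>)"
    unfolding cube_avg_def em using le by (rule divide_right_mono_ennreal)
  finally show ?thesis .
qed

lemma continuous_small_on_cubes:
  fixes P :: "real ^ 'n \<Rightarrow> real"
  assumes "continuous_on UNIV P" "0 < \<delta>"
  shows "\<forall>\<^sub>F r in at_right 0. \<forall>z \<in> cube x r. \<bar>P z - P x\<bar> \<le> \<delta>"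
proof -
  have "isCont P x" using assms(1) by (simp add: continuous_on_eq_continuous_at)
  then obtain e where e: "0 < e" "\<And>z. dist z x < e \<Longrightarrow> dist (P z) (P x) < \<delta>"
    using assms(2) unfolding continuous_at_eps_delta by blast
  let ?s = "sqrt (real DIM(real ^ 'n))"
  have s: "0 < ?s" by simp
  have "\<bar>P z - P x\<bar> \<le> \<delta>" if r: "0 < r" "r < e / ?s" and z: "z \<in> cube x r" for r z
  proof -
    have "dist z x \<le> ?s * infnorm (z - x)" unfolding dist_norm by (rule norm_le_infnorm)
    also have "\<dots> \<le> ?s * r" using z s by (intro mult_left_mono) (auto simp: cube_def)
    also have "\<dots> < e" using r s by (simp add: field_simps)
    finally show ?thesis using e(2)[of z] by (simp add: dist_real_def)
  qed
  then show ?thesis using e(1) s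
    unfolding eventually_at_right_field by (intro exI[of _ "e / ?s"]) auto
qed

text \<open>A Cauchy criterion at 0+: constants belonging to the tolerances 1 / (n + 1) form a
  Cauchy sequence, and F converges to its limit. In the application the constants are the values
  P(x) of near-best polynomials.\<close>

lemma tendsto_if_eventually_near_constants:
  fixes F :: "real \<Rightarrow> real"
  assumes near: "\<And>\<epsilon>. 0 < \<epsilon> \<Longrightarrow> \<exists>c. \<forall>\<^sub>F r in at_right 0. \<bar>F r - c\<bar> \<le> \<epsilon>"
  shows "\<exists>L. (F \<longlongrightarrow> L) (at_right 0)"
proof -
  have "\<forall>n. \<exists>c. \<forall>\<^sub>F r in at_right 0. \<bar>F r - c\<bar> \<le> inverse (real (Suc n))"
    using near by simp
  from choice[OF this] obtain c where c: "\<And>n. \<forall>\<^sub>F r in at_right 0. \<bar>F r - c n\<bar> \<le> inverse (real (Suc n))"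
    by blast
  have dist: "\<bar>c m - c n\<bar> \<le> inverse (real (Suc m)) + inverse (real (Suc n))" for m n
  proof -
    have "\<forall>\<^sub>F r in at_right (0::real). \<bar>c m - c n\<bar> \<le> inverse (real (Suc m)) + inverse (real (Suc n))"
      using c[of m] c[of n] by eventually_elim linarith
    then show ?thesis by simp
  qed
  have "Cauchy c"
  proof (rule metric_CauchyI)
    fix e :: real assume "0 < e"
    then obtain N where N: "inverse (real (Suc N)) < e / 2"
      using reals_Archimedean[of "e / 2"] by auto
    have inv: "inverse (real (Suc n)) < e / 2" if "N \<le> n" for n
    proof -
      have "inverse (real (Suc n)) \<le> inverse (real (Suc N))"
        using that by (intro le_imp_inverse_le) auto
      then show ?thesis using N by linarith
    qed
    show "\<exists>M. \<forall>m\<ge>M. \<forall>n\<ge>M. dist (c m) (c n) < e"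
    proof (intro exI[of _ N] allI impI)
      fix m n assume "N \<le> m" "N \<le> n"
      with inv[of m] inv[of n] dist[of m n] show "dist (c m) (c n) < e"
        unfolding dist_real_def by linarith
    qed
  qed
  then obtain L where L: "c \<longlonglongrightarrow> L" using Cauchy_convergent convergent_def by blast
  have "(F \<longlongrightarrow> L) (at_right 0)"
  proof (rule tendstoI)
    fix e :: real assume e: "0 < e"
    have "\<forall>\<^sub>F n in sequentially. inverse (real (Suc n)) < e / 2"
      using order_tendstoD(2)[OF LIMSEQ_inverse_real_of_nat, of "e / 2"] e by simp
    moreover have "\<forall>\<^sub>F n in sequentially. dist (c n) L < e / 2"
      using tendstoD[OF L, of "e / 2"] e by simp
    ultimately have "\<forall>\<^sub>F n in sequentially. inverse (real (Suc n)) < e / 2 \<and> dist (c n) L < e / 2"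
      by (rule eventually_conj)
    then obtain n where n: "inverse (real (Suc n)) < e / 2" "dist (c n) L < e / 2"
      by (metis (mono_tags, lifting) eventually_happens trivial_limit_sequentially)
    show "\<forall>\<^sub>F r in at_right 0. dist (F r) L < e"
      using c[of n] 
    proof eventually_elim
      case (elim r)
      then show ?case using n unfolding dist_real_def by linarith
    qed
  qed
  then show ?thesis by blast
qed

lemma suminf_tail_small_ennreal:
  fixes E :: "nat \<Rightarrow> ennreal"
  assumes fin: "(\<Sum>j. E j) < top" and "0 < \<epsilon>"
  shows "\<exists>m. (\<Sum>j. E (m + j)) \<le> ennreal \<epsilon>"
proof -
  have "E j < top" for j using ennreal_le_suminf[of E j] fin by (rule order_le_less_trans)
  then have E: "E j = ennreal (enn2real (E j))" for j by simp
  have sm: "summable (\<lambda>j. enn2real (E j))"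
    by (rule summable_suminf_not_top) (use fin E in auto)
  obtain N where N: "norm (\<Sum>i. enn2real (E (i + N))) < \<epsilon>"
    using suminf_exist_split[OF assms(2) sm] by blast
  have "(\<Sum>j. E (N + j)) = (\<Sum>j. ennreal (enn2real (E (j + N))))"
    using E by (simp add: add.commute)
  also have "\<dots> = ennreal (\<Sum>j. enn2real (E (j + N)))"
    using sm by (intro suminf_ennreal2 summable_ignore_initial_segment) auto
  finally show ?thesis using N by (intro exI[of _ N]) (auto simp: ennreal_leI)
qed

lemma precise_rep_eq_limit: "(cube_mean f x \<longlongrightarrow> L) (at_right 0) \<Longrightarrow> precise_rep f x = L"
  unfolding precise_rep_def using tendsto_Lim[of "at_right (0::real)" "cube_mean f x" L] by auto

text \<open>As P is continuous, |f - P(x)| and |f - P| have nearly equal means over small cubes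
  about x, and the small-scale bound controls the latter. The resulting estimate \<open>ev\<close>
  serves twice: with near-best polynomials at fine scales it shows that the means converge, and with
  the given P and m it passes to the limit.\<close>

lemma precise_rep_poly_bound:
  assumes k: "0 < k" and u: "1 \<le> u"
  shows "\<exists>K>0. \<forall>f :: real ^ 'n \<Rightarrow> real. f \<in> borel_measurable lebesgue \<longrightarrow>
    (\<forall>x r. 0 < r \<longrightarrow> cube_avg x r (\<lambda>y. ennreal \<bar>f y\<bar>) < top) \<longrightarrow>
    (\<forall>x. (\<Sum>j. best_approx_Rn k u f (2 powr - real j) x) < top \<longrightarrow>
      (\<forall>P \<in> poly_space (k - 1). \<forall>m. ennreal \<bar>precise_rep f x - P x\<bar>
        \<le> ennreal K * (cube_avg x (2 powr - real m) (\<lambda>y. ennreal \<bar>f y - P y\<bar>)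
            + (\<Sum>j. best_approx_Rn k u f (2 powr - real (m + j)) x))))"
proof -
  obtain K where K: "0 < K" and small: "\<And>(f :: real ^ 'n \<Rightarrow> real) P x m r. f \<in> borel_measurable lebesgue \<Longrightarrow>
      P \<in> poly_space (k - 1) \<Longrightarrow> 0 < r \<Longrightarrow> r \<le> 2 powr - real m \<Longrightarrow>
      cube_avg x r (\<lambda>y. ennreal \<bar>f y - P y\<bar>)
      \<le> ennreal K * (cube_avg x (2 powr - real m) (\<lambda>y. ennreal \<bar>f y - P y\<bar>)
          + (\<Sum>j. best_approx_Rn k u f (2 powr - real (m + j)) x))"
    using cube_avg_small_scale[OF k u, where 'n = 'n] by blast
  have "ennreal \<bar>precise_rep f x - P x\<bar>
        \<le> ennreal K * (cube_avg x (2 powr - real m) (\<lambda>y. ennreal \<bar>f y - P y\<bar>)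
            + (\<Sum>j. best_approx_Rn k u f (2 powr - real (m + j)) x))"
    if f[measurable]: "f \<in> borel_measurable lebesgue"
      and loc: "\<And>x r. 0 < r \<Longrightarrow> cube_avg x r (\<lambda>y. ennreal \<bar>f y\<bar>) < top"
      and fin: "(\<Sum>j. best_approx_Rn k u f (2 powr - real j) x) < top"
      and P: "P \<in> poly_space (k - 1)"
    for f P :: "real ^ 'n \<Rightarrow> real" and x m
  proof -
    define B where "B P m = cube_avg x (2 powr - real m) (\<lambda>y. ennreal \<bar>f y - P y\<bar>)
            + (\<Sum>j. best_approx_Rn k u f (2 powr - real (m + j)) x)" for P m
    have ev: "\<forall>\<^sub>F r in at_right 0. \<bar>cube_mean f x r - P x\<bar> \<le> K * b + \<delta>"
      if P: "P \<in> poly_space (k - 1)" and \<delta>: "0 < \<delta>" and b: "0 \<le> b" "B P m \<le> ennreal b" for P m \<delta> b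
    proof -
      note [measurable] = poly_space_measurable(1)[OF P]
      have r: "\<forall>\<^sub>F r in at_right 0. 0 < r \<and> r < (2 powr - real m :: real)"
        unfolding eventually_at_right_field by (intro exI[of _ "2 powr - real m"]) auto
      show ?thesis
        using r continuous_small_on_cubes[OF poly_space_continuous[OF P] \<delta>, of x]
      proof eventually_elim
        case (elim r)
        have "ennreal \<bar>cube_mean f x r - P x\<bar> \<le> cube_avg x r (\<lambda>y. ennreal \<bar>f y - P x\<bar>)"
          using elim loc by (intro cube_mean_diff_le) auto
        also have "\<dots> \<le> cube_avg x r (\<lambda>y. ennreal \<bar>f y - P y\<bar>) + cube_avg x r (\<lambda>y. ennreal \<bar>P y - P x\<bar>)"
          by (intro cube_avg_triangle) auto
        also have "\<dots> \<le> ennreal K * B P m + ennreal \<delta>"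
          unfolding B_def using elim P
          by (intro add_mono small cube_avg_le_sup) (auto intro: ennreal_leI)
        also have "\<dots> \<le> ennreal K * ennreal b + ennreal \<delta>"
          using b by (intro add_mono mult_left_mono) auto
        also have "\<dots> = ennreal (K * b + \<delta>)"
          using K b \<delta> by (simp add: ennreal_mult)
        finally show ?case using K b \<delta> by (subst (asm) ennreal_le_iff) auto
      qed
    qed
    have "\<exists>L. (cube_mean f x \<longlongrightarrow> L) (at_right 0)"
    proof (rule tendsto_if_eventually_near_constants)
      fix \<epsilon> :: real assume \<epsilon>: "0 < \<epsilon>"
      \<comment> \<open>The tail contributes \<eta> and the near-best polynomial 2 \<eta>, where the
        extra \<eta> makes the bound on the error strict. Thus K * 3 \<eta> = \<epsilon> / 2, and
        the other half is left for the oscillation of P.\<close>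
      define \<eta> where "\<eta> = \<epsilon> / (6 * K)"
      have \<eta>: "0 < \<eta>" using \<epsilon> K by (simp add: \<eta>_def)
      obtain m where m: "(\<Sum>j. best_approx_Rn k u f (2 powr - real (m + j)) x) \<le> ennreal \<eta>"
        using suminf_tail_small_ennreal[OF fin \<eta>] by blast
      have "best_approx_Rn k u f (2 powr - real m) x \<le> ennreal \<eta>"
        using ennreal_le_suminf[of "\<lambda>j. best_approx_Rn k u f (2 powr - real (m + j)) x" 0] m
        by (auto intro: order_trans)
      also have "\<dots> < ennreal (2 * \<eta>)" using \<eta> by (simp add: ennreal_less_iff)
      finally obtain P where P: "P \<in> poly_space (k - 1)"
        "cube_avg x (2 powr - real m) (\<lambda>y. ennreal \<bar>f y - P y\<bar>) \<le> ennreal (2 * \<eta>)"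
        using cube_avg_near_best[OF u _ f, of "2 powr - real m" k x "ennreal (2 * \<eta>)"] by auto
      have "B P m \<le> ennreal (2 * \<eta>) + ennreal \<eta>"
        unfolding B_def using P m by (intro add_mono)
      also have "\<dots> = ennreal (3 * \<eta>)" using \<eta> by (simp flip: ennreal_plus)
      finally have "\<forall>\<^sub>F r in at_right 0. \<bar>cube_mean f x r - P x\<bar> \<le> K * (3 * \<eta>) + \<epsilon> / 2"
        using \<eta> \<epsilon> P by (intro ev) auto
      moreover have "K * (3 * \<eta>) + \<epsilon> / 2 = \<epsilon>" using K by (simp add: \<eta>_def)
      ultimately show "\<exists>c. \<forall>\<^sub>F r in at_right 0. \<bar>cube_mean f x r - c\<bar> \<le> \<epsilon>" by auto
    qed
    then obtain L where L: "(cube_mean f x \<longlongrightarrow> L) (at_right 0)" by blast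
    show ?thesis
    proof (cases "B P m")
      case (real b)
      have "\<bar>L - P x\<bar> \<le> K * b + \<delta>" if "0 < \<delta>" for \<delta>
      proof (rule tendsto_upperbound)
        show "((\<lambda>r. \<bar>cube_mean f x r - P x\<bar>) \<longlongrightarrow> \<bar>L - P x\<bar>) (at_right 0)"
          by (intro tendsto_intros L)
        show "\<forall>\<^sub>F r in at_right 0. \<bar>cube_mean f x r - P x\<bar> \<le> K * b + \<delta>"
          using real by (intro ev[OF P that, of b m]) auto
      qed simp
      then have "\<bar>L - P x\<bar> \<le> K * b" by (rule field_le_epsilon)
      then have "ennreal \<bar>L - P x\<bar> \<le> ennreal (K * b)" by (rule ennreal_leI)
      also have "\<dots> = ennreal K * B P m" using real K ennreal_mult[of K b] by simp
      finally have "ennreal \<bar>L - P x\<bar> \<le> ennreal K * B P m" .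
      then show ?thesis by (simp add: precise_rep_eq_limit[OF L] B_def)
    next
      case top
      then have "ennreal K * B P m = top" using K by (simp add: ennreal_mult_top)
      then show ?thesis by (simp only: B_def top_greatest)
    qed
  qed
  then show ?thesis using K by blast
qed

subsection \<open>Ahlfors regular measures\<close>

lemma space_hausdorff_measure [simp]: "space (hausdorff_measure d) = UNIV"
  by (simp add: hausdorff_measure_def space_measure_of_conv)

lemma cube_inside_open:
  fixes x :: "real ^ 'n"
  assumes "open U" "x \<in> U"
  obtains r where "0 < r" "cube x r \<subseteq> U"
proof -
  obtain e where e: "0 < e" "ball x e \<subseteq> U" using assms by (meson open_contains_ball)
  let ?s = "sqrt (real DIM(real ^ 'n))"
  have s: "0 < ?s" by simp
  have "cube x (e / (2 * ?s)) \<subseteq> ball x e"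
  proof
    fix z assume z: "z \<in> cube x (e / (2 * ?s))"
    have "dist z x \<le> ?s * infnorm (z - x)" unfolding dist_norm by (rule norm_le_infnorm)
    also have "\<dots> \<le> ?s * (e / (2 * ?s))" using z s by (intro mult_left_mono) (auto simp: cube_def)
    also have "\<dots> < e" using e(1) s by simp
    finally show "z \<in> ball x e" by (simp add: dist_commute)
  qed
  then show thesis using that[of "e / (2 * ?s)"] e s by auto
qed

text \<open>An open subset of \<open>S\<close> is a countable union of cubes centred in \<open>S\<close>; the traces of these cubes
  are measurable, since a \<open>d\<close>-set assigns them positive \<^const>\<open>emeasure\<close>. So no general
  theory of Borel sets and Hausdorff measure is needed.\<close>
lemma open_Int_eq_countable_cubes:
  fixes U S :: "(real ^ 'n) set"
  assumes U: "open U" and T: "countable T" "T \<subseteq> S" "S \<subseteq> closure T"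
  shows "U \<inter> S = (\<Union>(w, n) \<in> {(w, n). w \<in> T \<and> cube w (1 / Suc n) \<subseteq> U}. cube w (1 / Suc n) \<inter> S)"
proof (intro equalityI subsetI)
  fix x assume x: "x \<in> U \<inter> S"
  then obtain r where r: "0 < r" "cube x r \<subseteq> U" using cube_inside_open[OF U] by blast
  obtain n where n: "1 / real (Suc n) < r / 2"
    using reals_Archimedean[of "r / 2"] r by (auto simp: inverse_eq_divide)
  have "x \<in> closure T" using x T by blast
  then obtain w where w: "w \<in> T" "dist w x < 1 / Suc n"
    using closure_approachable[of x T] by (metis of_nat_0_less_iff zero_less_Suc zero_less_divide_1_iff)
  have "infnorm (w - x) \<le> 1 / Suc n"
    using infnorm_le_norm[of "w - x"] w(2) unfolding dist_norm by linarith
  then have wx: "w \<in> cube x (1 / Suc n)" by (simp add: cube_def)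
  then have "cube w (1 / Suc n) \<subseteq> cube x r" using n by (intro cube_subset_cube) auto
  then have "cube w (1 / Suc n) \<subseteq> U" using r by blast
  moreover have "x \<in> cube w (1 / Suc n)" using wx by (subst cube_commute)
  ultimately show "x \<in> (\<Union>(w, n) \<in> {(w, n). w \<in> T \<and> cube w (1 / Suc n) \<subseteq> U}. cube w (1 / Suc n) \<inter> S)"
    using w x by auto
qed auto

lemma d_set_restrict_measurable:
  fixes S :: "(real ^ 'n) set"
  assumes S: "d_set d S"
  shows "(\<lambda>x. x) \<in> hausdorff_on d S \<rightarrow>\<^sub>M borel" and "S \<in> sets (hausdorff_measure d)"
proof -
  obtain c1 where c1: "0 < c1" and low: "\<And>w r. w \<in> S \<Longrightarrow> 0 < r \<Longrightarrow> r \<le> 1 \<Longrightarrow>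
      ennreal (c1 * r powr d) \<le> emeasure (hausdorff_measure d) (cube w r \<inter> S)"
    using S unfolding d_set_def by blast
  \<comment> \<open>The value of \<open>emeasure\<close> is 0 outside the sigma-algebra, so the
    positive lower bound itself certifies measurability. It is available for radii up to 1, which
    covers the radii 1 / (n + 1) of the countable cover.\<close>
  have cube: "cube w r \<inter> S \<in> sets (hausdorff_measure d)" if "w \<in> S" "0 < r" "r \<le> 1" for w r
  proof (rule ccontr)
    assume "\<not> ?thesis"
    then have "ennreal (c1 * r powr d) \<le> 0" using low[OF that] emeasure_notin_sets by metis
    then show False using c1 that by (simp add: ennreal_eq_0_iff mult_le_0_iff)
  qed
  obtain T where T: "countable T" "T \<subseteq> S" "S \<subseteq> closure T" using separable by blast
  have meas: "U \<inter> S \<in> sets (hausdorff_measure d)" if U: "open U" for U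
    unfolding open_Int_eq_countable_cubes[OF U T]
  proof (rule sets.countable_UN'')
    have "{(w, n). w \<in> T \<and> cube w (1 / Suc n) \<subseteq> U} \<subseteq> T \<times> UNIV" by auto
    then show "countable {(w, n). w \<in> T \<and> cube w (1 / Suc n) \<subseteq> U}"
      by (rule countable_subset) (intro countable_SIGMA T countableI_type)
    fix y assume "y \<in> {(w, n). w \<in> T \<and> cube w (1 / Suc n) \<subseteq> U}"
    then show "(case y of (w, n) \<Rightarrow> cube w (1 / Suc n) \<inter> S) \<in> sets (hausdorff_measure d)"
      using T cube by (auto simp: divide_le_eq_1)
  qed
  from meas[of UNIV] show S': "S \<in> sets (hausdorff_measure d)" by simp
  show "(\<lambda>x. x) \<in> hausdorff_on d S \<rightarrow>\<^sub>M borel"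
  proof (rule borel_measurableI)
    fix U :: "(real ^ 'n) set" assume "open U"
    from meas[OF this] show "(\<lambda>x. x) -` U \<inter> space (hausdorff_on d S) \<in> sets (hausdorff_on d S)"
      using S' by (simp add: space_restrict_space sets_restrict_space_iff)
  qed
qed

lemma sigma_finite_lebesgue: "sigma_finite_measure (lebesgue :: 'a::euclidean_space measure)"
proof
  obtain A :: "'a set set" where "countable A" "A \<subseteq> sets lborel" "\<Union>A = space lborel"
    "\<forall>a\<in>A. emeasure lborel a \<noteq> \<infinity>"
    using lborel.sigma_finite_countable by blast
  then show "\<exists>A::'a set set. countable A \<and> A \<subseteq> sets lebesgue \<and> \<Union>A = space lebesgue \<and> (\<forall>a\<in>A. emeasure lebesgue a \<noteq> \<infinity>)"
    by (intro exI[of _ A]) (auto simp: emeasure_completion)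
qed

text \<open>The properties through which the Hausdorff measure enters the estimate. The set itself
  appears as \<open>space M\<close>, and \<open>borel_id\<close> says that Borel sets have
  measurable traces on it.\<close>

locale ahlfors_measure =
  fixes M :: "(real ^ 'n) measure" and d c1 c2 :: real
  assumes borel_id [measurable]: "(\<lambda>x. x) \<in> M \<rightarrow>\<^sub>M borel"
    and c1: "0 < c1" and c2: "0 < c2" and d: "0 \<le> d"
    and lower: "w \<in> space M \<Longrightarrow> 0 < r \<Longrightarrow> r \<le> 1 \<Longrightarrow> ennreal (c1 * r powr d) \<le> emeasure M (cube w r \<inter> space M)"
    and upper: "w \<in> space M \<Longrightarrow> 0 < r \<Longrightarrow> r \<le> 1 \<Longrightarrow> emeasure M (cube w r \<inter> space M) \<le> ennreal (c2 * r powr d)"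
begin

lemma borel_sets [measurable]: "A \<in> sets borel \<Longrightarrow> A \<inter> space M \<in> sets M"
  using measurable_sets[OF borel_id, of A] by simp

lemma borel_measurable_M: "h \<in> borel \<rightarrow>\<^sub>M N \<Longrightarrow> h \<in> M \<rightarrow>\<^sub>M N"
  using measurable_compose[OF borel_id] by auto

text \<open>The total mass may be infinite, but the unit-radius cubes about a countable dense set of
  centres cover the space, each with finite mass. This makes Fubini's theorem applicable.\<close>

sublocale sigma_finite_measure M
proof
  obtain T where T: "countable T" "T \<subseteq> space M" "space M \<subseteq> closure T" using separable by blast
  have "space M = \<Union>((\<lambda>w. cube w 1 \<inter> space M) ` T)"
  proof (intro equalityI subsetI)
    fix x assume x: "x \<in> space M"
    then have "x \<in> closure T" using T by blast
    then obtain w where w: "w \<in> T" "dist w x < 1"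
      using closure_approachable[of x T] by (metis zero_less_one)
    have "infnorm (w - x) \<le> 1"
      using infnorm_le_norm[of "w - x"] w(2) unfolding dist_norm by linarith
    then have "x \<in> cube w 1" by (subst cube_commute) (simp add: cube_def)
    then show "x \<in> \<Union>((\<lambda>w. cube w 1 \<inter> space M) ` T)" using w x by blast
  qed blast
  moreover have "emeasure M (cube w 1 \<inter> space M) \<noteq> top" if "w \<in> T" for w
    using upper[of w 1] T that by (metis ennreal_neq_top le_numeral_extra(4) subsetD top.extremum_uniqueI zero_less_one)
  ultimately show "\<exists>A. countable A \<and> A \<subseteq> sets M \<and> \<Union>A = space M \<and> (\<forall>a\<in>A. emeasure M a \<noteq> \<infinity>)"
    using T(1) by (intro exI[of _ "(\<lambda>w. cube w 1 \<inter> space M) ` T"]) auto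
qed

text \<open>Membership in a cube is symmetric in point and centre, so exchanging the integrals
  leaves the M-mass of a cube about y. The second measure is Lebesgue measure when f is carried over
  to M, and M itself when the local means of a tail are integrated.\<close>

lemma nn_integral_cube_Fubini:
  fixes N :: "(real ^ 'n) measure"
  assumes N: "sigma_finite_measure N" and idN[measurable]: "(\<lambda>x. x) \<in> N \<rightarrow>\<^sub>M borel"
    and h[measurable]: "h \<in> borel_measurable N"
    and C: "\<And>y. y \<in> space N \<Longrightarrow> emeasure M (cube y r \<inter> space M) \<le> C"
  shows "(\<lambda>x. \<integral>\<^sup>+y\<in>cube x r. h y \<partial>N) \<in> borel_measurable M"
    and "(\<integral>\<^sup>+x. (\<integral>\<^sup>+y\<in>cube x r. h y \<partial>N) \<partial>M) \<le> C * (\<integral>\<^sup>+y. h y \<partial>N)"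
proof -
  interpret N: sigma_finite_measure N by (rule N)
  interpret pair_sigma_finite M N ..
  have f1: "fst \<in> borel_measurable (M \<Otimes>\<^sub>M N)" and f2: "snd \<in> borel_measurable (M \<Otimes>\<^sub>M N)"
    using measurable_compose[OF measurable_fst borel_id, of N]
      measurable_compose[OF measurable_snd idN, of M] by auto
  have inf: "infnorm \<in> borel_measurable (borel :: (real ^ 'n) measure)"
    unfolding continuous_on_eq_continuous_within
    by (intro borel_measurable_continuous_onI continuous_at_imp_continuous_on ballI
        continuous_infnorm[OF continuous_ident])
  \<comment> \<open>Joint measurability of the relation between point and centre follows from that
    of the distance, a Borel function of the two projections.\<close>
  have "(\<lambda>p. infnorm (snd p - fst p)) \<in> borel_measurable (M \<Otimes>\<^sub>M N)"
    by (rule measurable_compose[OF borel_measurable_diff[OF f2 f1] inf])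
  then have "{p \<in> space (M \<Otimes>\<^sub>M N). infnorm (snd p - fst p) \<le> r} \<in> sets (M \<Otimes>\<^sub>M N)"
    by (intro borel_measurable_le) auto
  then have "(\<lambda>p. indicator {p \<in> space (M \<Otimes>\<^sub>M N). infnorm (snd p - fst p) \<le> r} p :: ennreal) \<in> borel_measurable (M \<Otimes>\<^sub>M N)"
    by (rule borel_measurable_indicator)
  then have "(\<lambda>p. indicator (cube (fst p) r) (snd p) :: ennreal) \<in> borel_measurable (M \<Otimes>\<^sub>M N)"
    by (rule measurable_cong[THEN iffD1, rotated]) (auto simp: indicator_def cube_def)
  then have m: "(\<lambda>p. h (snd p) * indicator (cube (fst p) r) (snd p)) \<in> borel_measurable (M \<Otimes>\<^sub>M N)"
    by measurable
  have m': "(\<lambda>(x, y). h y * indicator (cube x r) y) \<in> borel_measurable (M \<Otimes>\<^sub>M N)"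
    using m by (simp add: case_prod_unfold)
  from m' show "(\<lambda>x. \<integral>\<^sup>+y\<in>cube x r. h y \<partial>N) \<in> borel_measurable M"
    by (rule N.borel_measurable_nn_integral)
  have "(\<integral>\<^sup>+x. (\<integral>\<^sup>+y\<in>cube x r. h y \<partial>N) \<partial>M) = (\<integral>\<^sup>+y. (\<integral>\<^sup>+x. h y * indicator (cube x r) y \<partial>M) \<partial>N)"
    using Fubini'[OF m'] by simp
  also have "\<dots> \<le> (\<integral>\<^sup>+y. C * h y \<partial>N)"
  proof (intro nn_integral_mono)
    fix y assume y: "y \<in> space N"
    have "(\<integral>\<^sup>+x. h y * indicator (cube x r) y \<partial>M) = (\<integral>\<^sup>+x. h y * indicator (cube y r \<inter> space M) x \<partial>M)"
      by (intro nn_integral_cong) (auto simp: indicator_def cube_commute[of y])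
    also have "\<dots> = h y * emeasure M (cube y r \<inter> space M)"
      by (intro nn_integral_cmult_indicator borel_sets) simp
    finally show "(\<integral>\<^sup>+x. h y * indicator (cube x r) y \<partial>M) \<le> C * h y"
      using mult_left_mono[OF C[OF y], of "h y"] by (simp add: mult.commute)
  qed
  also have "\<dots> = C * (\<integral>\<^sup>+y. h y \<partial>N)" by (rule nn_integral_cmult) simp
  finally show "(\<integral>\<^sup>+x. (\<integral>\<^sup>+y\<in>cube x r. h y \<partial>N) \<partial>M) \<le> C * (\<integral>\<^sup>+y. h y \<partial>N)" .
qed

text \<open>Best approximation errors need not be shown measurable: they are dominated by step functions
  on a grid of cells of side \<open>h\<close>, for which the two integrals are compared cell by cell.\<close>
lemma grid_transfer:
  fixes E E' :: "real ^ 'n \<Rightarrow> ennreal"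
  assumes h: "0 < h" "h \<le> 1" and p: "0 < p"
    and E: "\<And>x z. x \<in> cube z h \<Longrightarrow> E' x \<le> E z"
  shows "\<exists>e. e \<in> borel_measurable M \<and> (\<forall>x. E' x \<le> e x) \<and>
    (\<integral>\<^sup>+x. epowr (e x) p \<partial>M) \<le> ennreal (c2 * h powr (d - CARD('n))) * (\<integral>\<^sup>+x. epowr (E x) p \<partial>lebesgue)"
proof -
  \<comment> \<open>The half-open cells with integer index vectors partition the whole space, and
    there are countably many of them; integrals therefore split into sums over indices.\<close>
  define idx where "idx x = (\<chi> i. \<lfloor>x $ i / h\<rfloor>)" for x :: "real ^ 'n"
  have idx_iff: "idx x = a \<longleftrightarrow> (\<forall>i. h * a $ i \<le> x $ i \<and> x $ i < h * (a $ i + 1))" for x a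
    using h by (auto simp: idx_def vec_eq_iff floor_eq_iff field_simps)
  have idx_meas: "idx \<in> borel \<rightarrow>\<^sub>M count_space UNIV"
  proof (subst measurable_count_space_eq2_countable, intro conjI ballI)
    fix a
    have "idx -` {a} \<inter> space borel
        = (\<Inter>i. {x \<in> space borel. h * a $ i \<le> x $ i} \<inter> {x \<in> space borel. x $ i < h * (a $ i + 1)})"
      by (simp add: set_eq_iff idx_iff)
    also have "\<dots> \<in> sets borel"
      by (intro sets.finite_INT sets.Int borel_measurable_le borel_measurable_less) auto
    finally show "idx -` {a} \<inter> space borel \<in> sets borel" .
  qed simp
  define cell where "cell a = idx -` {a}" for a
  have cell_meas: "cell a \<in> sets borel" for a
    using measurable_sets[OF idx_meas, of "{a}"] by (simp add: cell_def)
  have close: "x \<in> cube z h" if "idx x = idx z" for x z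
  proof -
    have "h * (idx z) $ i \<le> x $ i \<and> x $ i < h * ((idx z) $ i + 1)" "h * (idx z) $ i \<le> z $ i \<and> z $ i < h * ((idx z) $ i + 1)" for i
      using idx_iff[of x "idx z"] idx_iff[of z "idx z"] that by auto
    then show ?thesis unfolding mem_cube_iff by (auto simp: abs_le_iff algebra_simps) (smt (verit))+
  qed
  have cell_M: "emeasure M (cell a \<inter> space M) \<le> ennreal (c2 * h powr d)" for a
  proof (cases "cell a \<inter> space M = {}")
    case False
    then obtain w where w: "w \<in> cell a" "w \<in> space M" by blast
    have "cell a \<subseteq> cube w h" using close w by (auto simp: cell_def)
    then have "emeasure M (cell a \<inter> space M) \<le> emeasure M (cube w h \<inter> space M)"
      by (intro emeasure_mono borel_sets) auto
    then show ?thesis using upper[OF w(2) h] by (rule order_trans)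
  qed simp
  have cell_leb: "ennreal (h ^ CARD('n)) \<le> emeasure lebesgue (cell a)" for a
  proof -
    let ?l = "\<chi> i. h * a $ i" and ?u = "\<chi> i. h * (a $ i + 1)"
    have "(\<Prod>b\<in>Basis. (?u - ?l) \<bullet> b) = (\<Prod>i\<in>(UNIV :: 'n set). h)"
      by (rule prod.reindex_bij_witness[of _ "\<lambda>i. axis i 1" "\<lambda>b. axis_index b"])
        (auto simp: axis_index_axis inner_axis axis_inverse Basis_vec_def algebra_simps)
    moreover have "emeasure lborel (box ?l ?u) = (\<Prod>b\<in>Basis. (?u - ?l) \<bullet> b)"
      using h by (intro emeasure_lborel_box) (auto simp: Basis_vec_def inner_axis)
    moreover have "box ?l ?u \<subseteq> cell a"
      by (auto simp: mem_box_cart cell_def idx_iff less_imp_le)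
    then have "emeasure lborel (box ?l ?u) \<le> emeasure lborel (cell a)"
      using cell_meas by (intro emeasure_mono) auto
    ultimately show ?thesis using cell_meas by simp
  qed
  \<comment> \<open>The infimum over a cell lies below E by definition and above E' by hypothesis,
    because any two points of a cell differ by at most h in each coordinate. Being constant on
    cells, the function in between is measurable although E and E' need not be.\<close>
  define \<phi> where "\<phi> a = (INF z \<in> cell a. E z)" for a
  define e where "e x = \<phi> (idx x)" for x
  have "\<phi> \<in> borel_measurable (count_space UNIV)" by simp
  then have e_borel: "e \<in> borel_measurable borel"
    unfolding e_def by (rule measurable_compose[OF idx_meas])
  have E'_le: "E' x \<le> e x" for x
    unfolding e_def \<phi>_def by (rule INF_greatest) (use E close in \<open>auto simp: cell_def\<close>)
  have e_le: "e x \<le> E x" for x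
    unfolding e_def \<phi>_def by (rule INF_lower) (simp add: cell_def)
  have split: "(\<integral>\<^sup>+x. epowr (e x) p \<partial>N) = (\<integral>\<^sup>+a. epowr (\<phi> a) p * emeasure N (cell a \<inter> space N) \<partial>count_space UNIV)"
    if N: "\<And>a. cell a \<inter> space N \<in> sets N" for N
  proof -
    have "(\<integral>\<^sup>+x. epowr (e x) p \<partial>N)
        = (\<integral>\<^sup>+x. \<integral>\<^sup>+a. epowr (\<phi> a) p * indicator (cell a \<inter> space N) x \<partial>count_space UNIV \<partial>N)"
    proof (intro nn_integral_cong)
      fix x assume "x \<in> space N"
      then have "(\<integral>\<^sup>+a. epowr (\<phi> a) p * indicator (cell a \<inter> space N) x \<partial>count_space UNIV)
          = (\<integral>\<^sup>+a. epowr (\<phi> a) p * indicator {idx x} a \<partial>count_space UNIV)"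
        by (intro nn_integral_cong) (auto simp: cell_def indicator_def)
      then show "epowr (e x) p = (\<integral>\<^sup>+a. epowr (\<phi> a) p * indicator (cell a \<inter> space N) x \<partial>count_space UNIV)"
        by (simp add: e_def)
    qed
    also have "\<dots> = (\<integral>\<^sup>+a. \<integral>\<^sup>+x. epowr (\<phi> a) p * indicator (cell a \<inter> space N) x \<partial>N \<partial>count_space UNIV)"
      using N by (intro nn_integral_count_space_nn_integral) auto
    also have "\<dots> = (\<integral>\<^sup>+a. epowr (\<phi> a) p * emeasure N (cell a \<inter> space N) \<partial>count_space UNIV)"
      using N by (simp add: nn_integral_cmult_indicator)
    finally show ?thesis .
  qed
  have "(\<integral>\<^sup>+x. epowr (e x) p \<partial>M) = (\<integral>\<^sup>+a. epowr (\<phi> a) p * emeasure M (cell a \<inter> space M) \<partial>count_space UNIV)"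
    by (intro split borel_sets cell_meas)
  \<comment> \<open>Each cell has M-mass at most c2 h^d and volume at least h^n; the quotient is the
    factor c2 h^(d - n).\<close>
  also have "\<dots> \<le> (\<integral>\<^sup>+a. ennreal (c2 * h powr (d - CARD('n))) * (epowr (\<phi> a) p * emeasure lebesgue (cell a)) \<partial>count_space UNIV)"
  proof (intro nn_integral_mono)
    fix a
    have "emeasure M (cell a \<inter> space M) \<le> ennreal (c2 * h powr d)" by (rule cell_M)
    also have "c2 * h powr d = c2 * h powr (d - CARD('n)) * h ^ CARD('n)"
      using h by (simp add: powr_diff powr_realpow)
    also have "ennreal \<dots> = ennreal (c2 * h powr (d - CARD('n))) * ennreal (h ^ CARD('n))"
      using h c2 by (intro ennreal_mult) auto
    also have "\<dots> \<le> ennreal (c2 * h powr (d - CARD('n))) * emeasure lebesgue (cell a)"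
      using cell_leb[of a] by (intro mult_left_mono) auto
    finally have "epowr (\<phi> a) p * emeasure M (cell a \<inter> space M)
        \<le> epowr (\<phi> a) p * (ennreal (c2 * h powr (d - CARD('n))) * emeasure lebesgue (cell a))"
      by (rule mult_left_mono) simp
    then show "epowr (\<phi> a) p * emeasure M (cell a \<inter> space M)
        \<le> ennreal (c2 * h powr (d - CARD('n))) * (epowr (\<phi> a) p * emeasure lebesgue (cell a))"
      by (simp only: mult.left_commute)
  qed
  also have "\<dots> = ennreal (c2 * h powr (d - CARD('n))) * (\<integral>\<^sup>+a. epowr (\<phi> a) p * emeasure lebesgue (cell a) \<partial>count_space UNIV)"
    by (intro nn_integral_cmult) simp
  also have "(\<integral>\<^sup>+a. epowr (\<phi> a) p * emeasure lebesgue (cell a) \<partial>count_space UNIV) = (\<integral>\<^sup>+x. epowr (e x) p \<partial>lebesgue)"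
    using split[of lebesgue] cell_meas by simp
  \<comment> \<open>Monotonicity of \<open>nn_integral\<close> holds for arbitrary integrands, so E
    may be nonmeasurable here.\<close>
  also have "\<dots> \<le> (\<integral>\<^sup>+x. epowr (E x) p \<partial>lebesgue)"
    using p e_le by (intro nn_integral_mono epowr_mono) auto
  finally have "(\<integral>\<^sup>+x. epowr (e x) p \<partial>M) \<le> ennreal (c2 * h powr (d - CARD('n))) * (\<integral>\<^sup>+x. epowr (E x) p \<partial>lebesgue)"
    by (simp add: mult_left_mono)
  then show ?thesis using E'_le borel_measurable_M[OF e_borel] by blast
qed

end

lemma d_set_ahlfors_measure:
  assumes S: "d_set d S" and d: "0 \<le> d"
  shows "\<exists>c1 c2. ahlfors_measure (hausdorff_on d S) d c1 c2"
proof -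
  obtain c1 c2 where "0 < c1" "0 < c2" and "\<And>w r. w \<in> S \<Longrightarrow> 0 < r \<Longrightarrow> r \<le> 1 \<Longrightarrow>
      ennreal (c1 * r powr d) \<le> emeasure (hausdorff_measure d) (cube w r \<inter> S) \<and>
      emeasure (hausdorff_measure d) (cube w r \<inter> S) \<le> ennreal (c2 * r powr d)"
    using S unfolding d_set_def by blast
  then have "ahlfors_measure (hausdorff_on d S) d c1 c2"
    using d d_set_restrict_measurable[OF S]
    by unfold_locales (auto simp: space_restrict_space emeasure_restrict_space)
  then show ?thesis by blast
qed

subsection \<open>Approximation errors and tails\<close>

text \<open>Lets an estimate that holds for each competitor P pass to the infimum, without selecting
  a near-best one.\<close>

lemma ennreal_le_affine_INF:
  fixes x b :: ennreal
  assumes I: "I \<noteq> {}" and a: "0 < a" and le: "\<And>i. i \<in> I \<Longrightarrow> x \<le> ennreal a * F i + b"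
  shows "x \<le> ennreal a * (INF i\<in>I. F i) + b"
proof (cases "(INF i\<in>I. F i) = top")
  case True
  then show ?thesis using a by (simp add: ennreal_mult_top)
next
  case False
  show ?thesis
  proof (rule ennreal_le_epsilon)
    fix e :: real assume e: "0 < e"
    have "(INF i\<in>I. F i) < (INF i\<in>I. F i) + ennreal (e / a)"
      using False e a by (simp add: less_top)
    then obtain i where i: "i \<in> I" "F i < (INF i\<in>I. F i) + ennreal (e / a)"
      using INF_less_iff by metis
    have "x \<le> ennreal a * F i + b" by (rule le[OF i(1)])
    also have "\<dots> \<le> ennreal a * ((INF i\<in>I. F i) + ennreal (e / a)) + b"
      using i(2) by (intro add_right_mono mult_left_mono) auto
    also have "\<dots> = ennreal a * (INF i\<in>I. F i) + ennreal a * ennreal (e / a) + b"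
      by (simp only: distrib_left)
    also have "ennreal a * ennreal (e / a) = ennreal e"
      using a e ennreal_mult[of a "e / a"] by simp
    finally show "x \<le> ennreal a * (INF i\<in>I. F i) + b + ennreal e"
      by (simp only: add.assoc add.commute[of "ennreal e"])
  qed
qed

section \<open>Comparison of approximation errors on different cubes\<close>

lemma best_approx_Rn_alt:
  "best_approx_Rn k u f r x
    = (INF P \<in> poly_space (k - 1). epowr (cube_avg x r (\<lambda>y. epowr (ennreal \<bar>f y - P y\<bar>) u)) (1 / u))"
  unfolding best_approx_Rn_def best_approx_def cube_avg_def by (simp add: epowr_ennreal)

lemma poly_space_nonempty: "poly_space m \<noteq> {}"
  using zero_in_poly_space by blast

text \<open>The volume ratio appears with the exponent 1 / u. Being at least 1, it may be replaced
  by its first power, which makes the constant independent of u.\<close>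

lemma Lu_avg_subset:
  fixes x z :: "real ^ 'n"
  assumes u: "1 \<le> u" and r: "0 < r" "r \<le> s" and sub: "cube x r \<subseteq> cube z s"
  shows "epowr (cube_avg x r h) (1 / u) \<le> ennreal ((s / r) ^ CARD('n)) * epowr (cube_avg z s h) (1 / u)"
proof -
  let ?c = "(s / r) ^ CARD('n)"
  have c: "1 \<le> ?c" using r by (intro one_le_power) simp
  have "epowr (cube_avg x r h) (1 / u) \<le> epowr (ennreal ?c * cube_avg z s h) (1 / u)"
    using u r sub by (intro epowr_mono cube_avg_subset) auto
  also have "\<dots> = ennreal (?c powr (1 / u)) * epowr (cube_avg z s h) (1 / u)"
    using c epowr_ennreal[of ?c "1 / u"] by (simp only: epowr_mult)
  also have "\<dots> \<le> ennreal ?c * epowr (cube_avg z s h) (1 / u)"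
  proof -
    have "?c powr (1 / u) \<le> ?c powr 1" using c u by (intro powr_mono) auto
    then show ?thesis using c by (intro mult_right_mono ennreal_leI) auto
  qed
  finally show ?thesis .
qed

lemma best_approx_Rn_subset:
  fixes x z :: "real ^ 'n"
  assumes "1 \<le> u" "0 < r" "r \<le> s" "cube x r \<subseteq> cube z s"
  shows "best_approx_Rn k u f r x \<le> ennreal ((s / r) ^ CARD('n)) * best_approx_Rn k u f s z"
proof -
  let ?c = "(s / r) ^ CARD('n)"
  let ?F = "\<lambda>P. epowr (cube_avg z s (\<lambda>y. epowr (ennreal \<bar>f y - P y\<bar>) u)) (1 / u)"
  have "best_approx_Rn k u f r x \<le> ennreal ?c * ?F P + 0" if "P \<in> poly_space (k - 1)" for P
    unfolding best_approx_Rn_alt add_0_right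
    by (rule INF_lower2[OF that]) (rule Lu_avg_subset[OF assms])
  from ennreal_le_affine_INF[OF poly_space_nonempty _ this] show ?thesis
    using assms unfolding best_approx_Rn_alt by simp
qed

lemma cube_avg_le_Lp_avg:
  assumes "1 \<le> u" "0 < r" and [measurable]: "h \<in> borel_measurable lebesgue"
  shows "cube_avg x r h \<le> epowr (cube_avg x r (\<lambda>y. epowr (h y) u)) (1 / u)"
  using Lu_mean_le_Lp_mean[of 1 u h lebesgue "cube x r"] assms emeasure_cube_nontrivial[of r x]
  unfolding cube_avg_def by simp

text \<open>The zero polynomial as competitor; this bound takes over where no coarser error is at
  hand.\<close>

lemma best_approx_Rn_le_Lp_avg:
  assumes "1 \<le> u" "u \<le> p" "0 < r" and [measurable]: "f \<in> borel_measurable lebesgue"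
  shows "best_approx_Rn k u f r x \<le> epowr (cube_avg x r (\<lambda>y. epowr (ennreal \<bar>f y\<bar>) p)) (1 / p)"
proof -
  have "best_approx_Rn k u f r x \<le> epowr (cube_avg x r (\<lambda>y. epowr (ennreal \<bar>f y\<bar>) u)) (1 / u)"
    unfolding best_approx_Rn_alt by (rule INF_lower2[OF zero_in_poly_space]) simp
  also have "\<dots> \<le> epowr (cube_avg x r (\<lambda>y. epowr (ennreal \<bar>f y\<bar>) p)) (1 / p)"
    unfolding cube_avg_def using assms emeasure_cube_nontrivial[of r x]
    by (intro Lu_mean_le_Lp_mean) auto
  finally show ?thesis .
qed

lemma suminf_swap_ennreal:
  fixes f :: "nat \<Rightarrow> nat \<Rightarrow> ennreal"
  shows "(\<Sum>i. \<Sum>j. f i j) = (\<Sum>j. \<Sum>i. f i j)"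
  using nn_integral_suminf[of "\<lambda>j i. f i j" "count_space UNIV"]
  by (simp add: nn_integral_count_space_nat)

lemma suminf_shift_le_ennreal:
  fixes f :: "nat \<Rightarrow> ennreal" shows "(\<Sum>i. f (i + j)) \<le> (\<Sum>i. f i)"
  by (subst (2) suminf_offset[of _ j]) auto

lemma Lp_norm_powr: "0 < p \<Longrightarrow> epowr (Lp_norm M p h) p = (\<integral>\<^sup>+x. epowr (h x) p \<partial>M)"
  unfolding Lp_norm_def by (rule epowr_inverse(2))

lemma Lp_norm_le:
  assumes "0 < p" "(\<integral>\<^sup>+x. epowr (g x) p \<partial>M) \<le> ennreal K * (\<integral>\<^sup>+x. epowr (h x) p \<partial>N)" "0 \<le> K"
  shows "Lp_norm M p g \<le> ennreal (K powr (1 / p)) * Lp_norm N p h"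
  using epowr_mono[OF assms(2), of "1 / p"] assms unfolding Lp_norm_def
  by (simp add: epowr_mult epowr_ennreal)

text \<open>Weighted Hoelder inequalities with a small exponential loss replace both Minkowski's inequality
  in \<open>L\<^sup>p\<close> and the Hardy inequality in \<open>\<ell>\<^sup>q\<close>.\<close>
lemma Hardy_tails:
  assumes p: "1 \<le> p" and q: "1 \<le> q" and \<beta>: "0 < \<beta>"
  shows "\<exists>C>0. \<forall>e. (\<forall>l. e l \<in> borel_measurable M) \<longrightarrow>
    (\<Sum>i. epowr (ennreal (2 powr (real i * \<beta>)) * Lp_norm M p (\<lambda>x. \<Sum>j. e (i + j) x)) q)
    \<le> ennreal C * (\<Sum>l. epowr (ennreal (2 powr (real l * \<beta>)) * Lp_norm M p (e l)) q)"
proof -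
  \<comment> \<open>Both Hoelder steps lose a factor: 2^(\<beta> j / 4) in the norm and 2^(\<beta> q
    j / 4) after the q-th power. Moving the weight from index i to i + j gains 2^(- \<beta> q j), so
    2^(- \<beta> q j / 2) remains and is summable.\<close>
  have \<delta>1: "0 < \<beta> * p / 4" and \<delta>2: "0 < \<beta> * q / 4" using p q \<beta> by simp_all
  obtain C1 where C1: "0 < C1" "\<And>x :: nat \<Rightarrow> ennreal. epowr (\<Sum>j. x j) p
      \<le> ennreal C1 * (\<Sum>j. ennreal (2 powr (\<beta> * p / 4 * real j)) * epowr (x j) p)"
    using epowr_suminf_weighted[OF p \<delta>1] by blast
  obtain C2 where C2: "0 < C2" "\<And>x :: nat \<Rightarrow> ennreal. epowr (\<Sum>j. x j) q
      \<le> ennreal C2 * (\<Sum>j. ennreal (2 powr (\<beta> * q / 4 * real j)) * epowr (x j) q)"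
    using epowr_suminf_weighted[OF q \<delta>2] by blast
  define D where "D = C1 powr (1 / p)"
  define W where "W = 1 / (1 - 2 powr - (\<beta> * q / 2))"
  have "2 powr - (\<beta> * q / 2) < (1::real)" using \<beta> q powr_less_mono[of "- (\<beta> * q / 2)" 0 2] by simp
  then have W: "0 < W" by (simp add: W_def)
  have D: "0 < D" using C1 by (simp add: D_def)
  have "(\<Sum>i. epowr (ennreal (2 powr (real i * \<beta>)) * Lp_norm M p (\<lambda>x. \<Sum>j. e (i + j) x)) q)
    \<le> ennreal (D powr q * C2 * W) * (\<Sum>l. epowr (ennreal (2 powr (real l * \<beta>)) * Lp_norm M p (e l)) q)"
    if [measurable]: "\<And>l. e l \<in> borel_measurable M" for e
  proof -
    define b where "b l = Lp_norm M p (e l)" for l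
    define s where "s l = epowr (ennreal (2 powr (real l * \<beta>)) * b l) q" for l
    have tail: "Lp_norm M p (\<lambda>x. \<Sum>j. e (i + j) x) \<le> ennreal D * (\<Sum>j. ennreal (2 powr (\<beta> / 4 * real j)) * b (i + j))" for i
    proof -
      have "(\<integral>\<^sup>+x. epowr (\<Sum>j. e (i + j) x) p \<partial>M)
          \<le> (\<integral>\<^sup>+x. ennreal C1 * (\<Sum>j. ennreal (2 powr (\<beta> * p / 4 * real j)) * epowr (e (i + j) x) p) \<partial>M)"
        by (intro nn_integral_mono C1)
      also have "\<dots> = ennreal C1 * (\<Sum>j. ennreal (2 powr (\<beta> * p / 4 * real j)) * epowr (b (i + j)) p)"
        unfolding b_def using p
        by (subst nn_integral_cmult, measurable, subst nn_integral_suminf, measurable)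
          (simp add: nn_integral_cmult Lp_norm_powr)
      also have "\<dots> = ennreal C1 * (\<Sum>j. epowr (ennreal (2 powr (\<beta> / 4 * real j)) * b (i + j)) p)"
        by (simp add: epowr_mult epowr_ennreal powr_powr ac_simps)
      finally have "Lp_norm M p (\<lambda>x. \<Sum>j. e (i + j) x)
          \<le> epowr (ennreal C1 * (\<Sum>j. epowr (ennreal (2 powr (\<beta> / 4 * real j)) * b (i + j)) p)) (1 / p)"
        unfolding Lp_norm_def using p by (intro epowr_mono) auto
      also have "\<dots> = ennreal D * epowr (\<Sum>j. epowr (ennreal (2 powr (\<beta> / 4 * real j)) * b (i + j)) p) (1 / p)"
        using C1 by (simp only: epowr_mult epowr_ennreal less_imp_le D_def)
      also have "\<dots> \<le> ennreal D * (\<Sum>j. epowr (epowr (ennreal (2 powr (\<beta> / 4 * real j)) * b (i + j)) p) (1 / p))"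
        by (intro mult_left_mono epowr_suminf_le p) simp
      also have "\<dots> = ennreal D * (\<Sum>j. ennreal (2 powr (\<beta> / 4 * real j)) * b (i + j))"
        using p by (simp only: epowr_inverse)
      finally show ?thesis .
    qed
    have each: "epowr (ennreal (2 powr (real i * \<beta>)) * Lp_norm M p (\<lambda>x. \<Sum>j. e (i + j) x)) q
        \<le> ennreal (D powr q * C2) * (\<Sum>j. ennreal (2 powr - (\<beta> * q / 2 * real j)) * s (i + j))" for i
    proof -
      have "epowr (ennreal (2 powr (real i * \<beta>)) * Lp_norm M p (\<lambda>x. \<Sum>j. e (i + j) x)) q
          \<le> epowr (ennreal (2 powr (real i * \<beta>)) * (ennreal D * (\<Sum>j. ennreal (2 powr (\<beta> / 4 * real j)) * b (i + j)))) q"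
        using q by (intro epowr_mono mult_left_mono tail) auto
      also have "\<dots> = ennreal (D powr q) * epowr (\<Sum>j. ennreal (2 powr (real i * \<beta>)) * (ennreal (2 powr (\<beta> / 4 * real j)) * b (i + j))) q"
        using D by (simp only: ennreal_suminf_cmult mult.left_commute[of _ "ennreal D"] epowr_mult[of "ennreal D"] epowr_ennreal less_imp_le)
      also have "\<dots> \<le> ennreal (D powr q) * (ennreal C2 * (\<Sum>j. ennreal (2 powr (\<beta> * q / 4 * real j))
          * epowr (ennreal (2 powr (real i * \<beta>)) * (ennreal (2 powr (\<beta> / 4 * real j)) * b (i + j))) q))"
        by (intro mult_left_mono C2) simp
      also have "(\<lambda>j. ennreal (2 powr (\<beta> * q / 4 * real j))
          * epowr (ennreal (2 powr (real i * \<beta>)) * (ennreal (2 powr (\<beta> / 4 * real j)) * b (i + j))) q)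
          = (\<lambda>j. ennreal (2 powr - (\<beta> * q / 2 * real j)) * s (i + j))"
      proof
        fix j
        let ?A = "2 powr (\<beta> * q / 4 * real j)" and ?B = "2 powr (real i * \<beta> * q)" and ?C = "2 powr (\<beta> / 4 * real j * q)"
        let ?G = "2 powr - (\<beta> * q / 2 * real j)" and ?H = "2 powr (real (i + j) * \<beta> * q)"
        have real: "?A * (?B * ?C) = ?G * (?H :: real)"
          by (simp add: powr_add[symmetric] algebra_simps)
        have "ennreal ?A * epowr (ennreal (2 powr (real i * \<beta>)) * (ennreal (2 powr (\<beta> / 4 * real j)) * b (i + j))) q
            = ennreal ?A * (ennreal ?B * ennreal ?C) * epowr (b (i + j)) q"
          by (simp only: epowr_mult epowr_ennreal powr_powr powr_ge_zero mult.assoc)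
        also have "ennreal ?A * (ennreal ?B * ennreal ?C) = ennreal (?A * (?B * ?C))"
          by (simp only: ennreal_mult powr_ge_zero mult_nonneg_nonneg)
        also have "\<dots> = ennreal ?G * ennreal ?H"
          unfolding real by (rule ennreal_mult) auto
        also have "\<dots> * epowr (b (i + j)) q = ennreal ?G * s (i + j)"
          unfolding s_def by (simp only: epowr_mult epowr_ennreal powr_powr powr_ge_zero mult.assoc)
        finally show "ennreal ?A * epowr (ennreal (2 powr (real i * \<beta>)) * (ennreal (2 powr (\<beta> / 4 * real j)) * b (i + j))) q
            = ennreal ?G * s (i + j)" .
      qed
      also have "ennreal (D powr q) * (ennreal C2 * (\<Sum>j. ennreal (2 powr - (\<beta> * q / 2 * real j)) * s (i + j)))
          = ennreal (D powr q * C2) * (\<Sum>j. ennreal (2 powr - (\<beta> * q / 2 * real j)) * s (i + j))"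
        using C2(1) by (simp only: mult.assoc[symmetric] ennreal_mult powr_ge_zero less_imp_le)
      finally show ?thesis .
    qed
    have "(\<Sum>i. epowr (ennreal (2 powr (real i * \<beta>)) * Lp_norm M p (\<lambda>x. \<Sum>j. e (i + j) x)) q)
        \<le> (\<Sum>i. ennreal (D powr q * C2) * (\<Sum>j. ennreal (2 powr - (\<beta> * q / 2 * real j)) * s (i + j)))"
      by (intro suminf_le each) auto
    also have "\<dots> = ennreal (D powr q * C2) * (\<Sum>i. \<Sum>j. ennreal (2 powr - (\<beta> * q / 2 * real j)) * s (i + j))"
      by (rule ennreal_suminf_cmult)
    \<comment> \<open>After the exchange the inner sum over i is a shifted tail, bounded by the full
      sum for every j; the outer sum is geometric.\<close>
    also have "(\<Sum>i. \<Sum>j. ennreal (2 powr - (\<beta> * q / 2 * real j)) * s (i + j))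
        = (\<Sum>j. ennreal (2 powr - (\<beta> * q / 2 * real j)) * (\<Sum>i. s (i + j)))"
      by (subst suminf_swap_ennreal) (simp only: ennreal_suminf_cmult)
    also have "ennreal (D powr q * C2) * \<dots> \<le> ennreal (D powr q * C2) * (\<Sum>j. ennreal (2 powr - (\<beta> * q / 2 * real j)) * (\<Sum>i. s i))"
      by (intro mult_left_mono suminf_le suminf_shift_le_ennreal) auto
    also have "(\<Sum>j. ennreal (2 powr - (\<beta> * q / 2 * real j)) * (\<Sum>i. s i)) = ennreal W * (\<Sum>i. s i)"
    proof -
      have "0 < \<beta> * q / 2" using \<beta> q by simp
      then show ?thesis by (simp only: ennreal_suminf_multc suminf_powr_geometric W_def)
    qed
    also have "ennreal (D powr q * C2) * (ennreal W * (\<Sum>i. s i)) = ennreal (D powr q * C2 * W) * (\<Sum>i. s i)"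
      using C2(1) W D by (simp only: mult.assoc[symmetric] ennreal_mult powr_ge_zero less_imp_le mult_nonneg_nonneg)
    finally show ?thesis by (simp only: s_def b_def)
  qed
  moreover have "0 < D powr q * C2 * W" using D C2 W by simp
  ultimately show ?thesis by blast
qed

text \<open>Splitting the p-th power of c + R costs 2 after taking roots, and splitting the p-th
  root costs 2^(1 / p) \<le> 2; hence the factor 4.\<close>

lemma best_approx_le_Lp_avg:
  assumes p: "1 \<le> u" "u \<le> p" and K: "0 \<le> K" and A[measurable]: "A \<in> sets M"
    and nz: "emeasure M A \<noteq> 0" "emeasure M A \<noteq> top"
    and R[measurable]: "R \<in> borel_measurable M" and P: "P \<in> poly_space (k - 1)"
    and le: "AE y in M. y \<in> A \<longrightarrow> ennreal \<bar>g y - P y\<bar> \<le> ennreal K * (c + R y)"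
  shows "best_approx M k u g A
    \<le> ennreal (4 * K) * (c + epowr ((\<integral>\<^sup>+y\<in>A. epowr (R y) p \<partial>M) / emeasure M A) (1 / p))"
proof -
  let ?m = "emeasure M A"
  let ?V = "(\<integral>\<^sup>+y\<in>A. epowr (R y) p \<partial>M) / ?m"
  have p1: "1 \<le> p" using p by simp
  have "best_approx M k u g A \<le> epowr ((\<integral>\<^sup>+y\<in>A. epowr (ennreal \<bar>g y - P y\<bar>) u \<partial>M) / ?m) (1 / u)"
    by (rule best_approx_le[OF P])
  \<comment> \<open>The measurable majorant replaces |g - P| before Jensen's inequality is applied,
    because g is not known to be measurable.\<close>
  also have "\<dots> \<le> epowr ((\<integral>\<^sup>+y\<in>A. epowr (ennreal K * (c + R y)) u \<partial>M) / ?m) (1 / u)"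
  proof (intro epowr_mono divide_right_mono_ennreal nn_integral_mono_AE)
    show "AE y in M. epowr (ennreal \<bar>g y - P y\<bar>) u * indicator A y \<le> epowr (ennreal K * (c + R y)) u * indicator A y"
      using le by eventually_elim (use p in \<open>auto simp: indicator_def intro: epowr_mono\<close>)
  qed (use p in auto)
  also have "\<dots> \<le> epowr ((\<integral>\<^sup>+y\<in>A. epowr (ennreal K * (c + R y)) p \<partial>M) / ?m) (1 / p)"
    using p nz by (intro Lu_mean_le_Lp_mean) auto
  also have "\<dots> \<le> epowr ((\<integral>\<^sup>+y\<in>A. ennreal ((2 * K) powr p) * (epowr c p + epowr (R y) p) \<partial>M) / ?m) (1 / p)"
  proof (intro epowr_mono divide_right_mono_ennreal nn_integral_mono mult_right_mono)
    fix y
    have "epowr (ennreal K * (c + R y)) p \<le> ennreal (K powr p) * (ennreal (2 powr p) * (epowr c p + epowr (R y) p))"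
      using p K by (simp only: epowr_mult epowr_ennreal) (intro mult_left_mono epowr_add_le, auto)
    also have "\<dots> = ennreal ((2 * K) powr p) * (epowr c p + epowr (R y) p)"
      using K by (simp only: mult.assoc[symmetric] ennreal_mult[symmetric] powr_ge_zero powr_mult mult.commute[of "K powr p"])
    finally show "epowr (ennreal K * (c + R y)) p \<le> ennreal ((2 * K) powr p) * (epowr c p + epowr (R y) p)" .
  qed (use p in auto)
  also have "(\<integral>\<^sup>+y\<in>A. ennreal ((2 * K) powr p) * (epowr c p + epowr (R y) p) \<partial>M) / ?m
      = ennreal ((2 * K) powr p) * (epowr c p + ?V)"
  proof -
    have "(\<integral>\<^sup>+y\<in>A. ennreal ((2 * K) powr p) * (epowr c p + epowr (R y) p) \<partial>M)
        = ennreal ((2 * K) powr p) * (\<integral>\<^sup>+y. epowr c p * indicator A y + epowr (R y) p * indicator A y \<partial>M)"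
      by (subst nn_integral_cmult[symmetric]) (auto intro!: nn_integral_cong simp: indicator_def)
    also have "\<dots> = ennreal ((2 * K) powr p) * (epowr c p * ?m + (\<integral>\<^sup>+y\<in>A. epowr (R y) p \<partial>M))"
      by (subst nn_integral_add) (auto simp: nn_integral_cmult_indicator)
    finally have "(\<integral>\<^sup>+y\<in>A. ennreal ((2 * K) powr p) * (epowr c p + epowr (R y) p) \<partial>M) / ?m
        = ennreal ((2 * K) powr p) * ((epowr c p * ?m) / ?m + ?V)"
      by (simp only: ennreal_times_divide add_divide_distrib_ennreal[symmetric])
    also have "epowr c p * ?m / ?m = epowr c p" using nz by (intro ennreal_mult_divide_eq) auto
    finally show ?thesis .
  qed
  also have "epowr (ennreal ((2 * K) powr p) * (epowr c p + ?V)) (1 / p)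
      = ennreal (2 * K) * epowr (epowr c p + ?V) (1 / p)"
    using K p1 by (simp only: epowr_mult epowr_ennreal powr_ge_zero powr_powr) simp
  also have "\<dots> \<le> ennreal (2 * K) * (ennreal (2 powr (1 / p)) * (epowr (epowr c p) (1 / p) + epowr ?V (1 / p)))"
    using p1 by (intro mult_left_mono epowr_add_le) auto
  also have "\<dots> \<le> ennreal (2 * K) * (ennreal 2 * (c + epowr ?V (1 / p)))"
  proof -
    have "2 powr (1 / p) \<le> 2 powr (1::real)" using p1 by (intro powr_mono) auto
    moreover have "epowr (epowr c p) (1 / p) = c" using p1 by (intro epowr_inverse) simp
    ultimately show ?thesis by (intro mult_left_mono mult_mono ennreal_leI) auto
  qed
  also have "\<dots> = ennreal (4 * K) * (c + epowr ?V (1 / p))"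
  proof -
    have "ennreal (4 * K) = ennreal (2 * K) * ennreal 2"
      using K by (subst ennreal_mult[symmetric]) auto
    then show ?thesis by (simp only: mult.assoc)
  qed
  finally show ?thesis .
qed

subsection \<open>Bounds with respect to the measure on the set\<close>

lemma two_powr_minus_le_one: "2 powr - real l \<le> 1"
  using powr_mono[of "- real l" 0 2] by simp

lemma inverse_antimono_ennreal:
  fixes a b :: ennreal
  assumes "a \<le> b" shows "inverse b \<le> inverse a"
proof (cases "a = 0 \<or> b = top")
  case False
  then obtain r s where rs: "a = ennreal r" "b = ennreal s" "0 \<le> r" "0 \<le> s"
    using assms by (metis ennreal_cases top_unique)
  then have "0 < r" "r \<le> s" using False assms by (auto simp: less_le)
  then show ?thesis using rs by (simp add: inverse_ennreal ennreal_leI le_imp_inverse_le)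
qed auto

lemma Lp_norm_cmult:
  assumes [measurable]: "h \<in> borel_measurable M" and "0 < p"
  shows "Lp_norm M p (\<lambda>x. c * h x) = c * Lp_norm M p h"
  unfolding Lp_norm_def using assms(2)
  by (simp only: epowr_mult nn_integral_cmult epowr_measurable assms(1) epowr_inverse)

lemma Lp_norm_mono_AE:
  assumes "AE x in M. g x \<le> h x" "0 \<le> p" shows "Lp_norm M p g \<le> Lp_norm M p h"
  unfolding Lp_norm_def
proof (intro epowr_mono nn_integral_mono_AE)
  show "AE x in M. epowr (g x) p \<le> epowr (h x) p"
    using assms(1) by eventually_elim (intro epowr_mono assms(2))
qed (use assms(2) in simp)

lemma suminf_tail_antimono_ennreal:
  fixes a :: "nat \<Rightarrow> ennreal"
  assumes "i \<le> i'" shows "(\<Sum>j. a (i' + j)) \<le> (\<Sum>j. a (i + j))"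
proof -
  have "(\<Sum>j. a (i' + j)) = (\<Sum>j. (\<lambda>j. a (i + j)) (j + (i' - i)))"
    using assms by (intro suminf_cong) (simp add: algebra_simps)
  also have "\<dots> \<le> (\<Sum>j. a (i + j))" by (rule suminf_shift_le_ennreal)
  finally show ?thesis .
qed

context ahlfors_measure
begin

text \<open>A cube that meets the space lies in the cube of twice the radius about a common point.
  The doubled radius must not exceed 1, whence the bound 1 / 2.\<close>

lemma upper_any_centre:
  assumes "0 < r" "r \<le> 1 / 2"
  shows "emeasure M (cube y r \<inter> space M) \<le> ennreal (c2 * (2 * r) powr d)"
proof (cases "cube y r \<inter> space M = {}")
  case False
  then obtain w where w: "w \<in> cube y r" "w \<in> space M" by blast
  have "cube y r \<subseteq> cube w (2 * r)"
    using w(1) by (intro cube_subset_cube) (auto simp: cube_commute)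
  then have "emeasure M (cube y r \<inter> space M) \<le> emeasure M (cube w (2 * r) \<inter> space M)"
    by (intro emeasure_mono borel_sets) auto
  also have "\<dots> \<le> ennreal (c2 * (2 * r) powr d)" using w assms by (intro upper) auto
  finally show ?thesis .
qed simp

text \<open>The radius 1 / 2 is the largest one permitted for arbitrary centres, and it gives cubes
  of volume 1, whose means are plain integrals. Fubini's theorem then transfers the norm.\<close>

lemma Lp_avg_transfer:
  assumes p: "0 < p" and f[measurable]: "f \<in> borel_measurable lebesgue"
  defines "F \<equiv> \<lambda>x. epowr (cube_avg x (1 / 2) (\<lambda>y. epowr (ennreal \<bar>f y\<bar>) p)) (1 / p)"
  shows "F \<in> borel_measurable M"
    and "Lp_norm M p F \<le> ennreal (c2 powr (1 / p)) * Lp_norm lebesgue p (\<lambda>y. ennreal \<bar>f y\<bar>)"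
proof -
  let ?I = "\<lambda>x. \<integral>\<^sup>+y\<in>cube x (1 / 2). epowr (ennreal \<bar>f y\<bar>) p \<partial>lebesgue"
  have avg: "cube_avg x (1 / 2) (\<lambda>y. epowr (ennreal \<bar>f y\<bar>) p) = ?I x" for x :: "real ^ 'n"
    unfolding cube_avg_def by (simp only: emeasure_cube(2)) (simp add: divide_ennreal_def)
  have id: "(\<lambda>x :: real ^ 'n. x) \<in> lebesgue \<rightarrow>\<^sub>M borel" by (simp add: measurable_completion)
  have C: "emeasure M (cube y (1 / 2) \<inter> space M) \<le> ennreal c2" for y
    using upper_any_centre[of "1 / 2" y] by simp
  have m: "(\<lambda>y. epowr (ennreal \<bar>f y\<bar>) p) \<in> borel_measurable lebesgue" by measurable
  note fub = nn_integral_cube_Fubini[OF sigma_finite_lebesgue id m C]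
  show "F \<in> borel_measurable M"
    unfolding F_def avg by (intro epowr_measurable fub(1))
  show "Lp_norm M p F \<le> ennreal (c2 powr (1 / p)) * Lp_norm lebesgue p (\<lambda>y. ennreal \<bar>f y\<bar>)"
    using fub(2) p c2 by (intro Lp_norm_le) (simp_all only: F_def avg epowr_inverse less_imp_le)
qed

text \<open>For x in Q(z, 2^-(j+1)) the cube of radius 2^-(j+1) about x lies in Q(z, 2^-j). Hence
  the error at x is at most 2^n times the next coarser error at z, which is the comparison that the
  grid requires.\<close>

lemma best_approx_grid_transfer:
  assumes u: "1 \<le> u" and p: "0 < p"
  shows "\<exists>e. e \<in> borel_measurable M \<and>
    (\<forall>x. best_approx_Rn k u f (2 powr - real (Suc j)) x \<le> e x) \<and>
    Lp_norm M p e \<le> ennreal (2 ^ CARD('n) * c2 powr (1 / p) * 2 powr (real (Suc j) * ((real CARD('n) - d) / p)))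
      * Lp_norm lebesgue p (best_approx_Rn k u f (2 powr - real j))"
proof -
  let ?E = "\<lambda>l. best_approx_Rn k u f (2 powr - real l)"
  let ?h = "2 powr - real (Suc j)"
  let ?c = "2 ^ CARD('n) :: real"
  have cc: "ennreal ?c * ennreal (1 / ?c) = 1"
    by (subst ennreal_mult[symmetric]) auto
  \<comment> \<open>The factor 2^n is moved to the finer error, as the grid comparison is stated
    with constant 1; the majorant is multiplied by it afterwards.\<close>
  have "ennreal (1 / ?c) * ?E (Suc j) x \<le> ?E j z" if x: "x \<in> cube z ?h" for x z :: "real ^ 'n"
  proof -
    have "?E (Suc j) x \<le> ennreal ((2 powr - real j / ?h) ^ CARD('n)) * ?E j z"
      using x two_powr_minus_Suc[of j] by (intro best_approx_Rn_subset u cube_subset_cube) auto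
    also have "2 powr - real j / ?h = 2" unfolding two_powr_minus_Suc by simp
    finally have "ennreal (1 / ?c) * ?E (Suc j) x \<le> ennreal (1 / ?c) * (ennreal ?c * ?E j z)"
      by (rule mult_left_mono) simp
    also have "\<dots> = ?E j z" using cc by (simp only: mult.assoc[symmetric] mult.commute[of "ennreal (1 / ?c)"]) simp
    finally show ?thesis .
  qed
  moreover have "0 < ?h" "?h \<le> 1" by (simp, rule two_powr_minus_le_one)
  ultimately obtain e where e[measurable]: "e \<in> borel_measurable M"
    and le: "\<And>x. ennreal (1 / ?c) * ?E (Suc j) x \<le> e x"
    and int: "(\<integral>\<^sup>+x. epowr (e x) p \<partial>M) \<le> ennreal (c2 * ?h powr (d - CARD('n))) * (\<integral>\<^sup>+x. epowr (?E j x) p \<partial>lebesgue)"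
    using grid_transfer[of ?h p "\<lambda>x. ennreal (1 / ?c) * ?E (Suc j) x" "?E j"] p by blast
  have "Lp_norm M p e \<le> ennreal ((c2 * ?h powr (d - CARD('n))) powr (1 / p)) * Lp_norm lebesgue p (?E j)"
    using int p c2 by (intro Lp_norm_le) auto
  also have "(c2 * ?h powr (d - CARD('n))) powr (1 / p) = c2 powr (1 / p) * 2 powr (real (Suc j) * ((real CARD('n) - d) / p))"
  proof -
    have "(c2 * ?h powr (d - CARD('n))) powr (1 / p) = c2 powr (1 / p) * 2 powr (- real (Suc j) * (d - CARD('n)) * (1 / p))"
      using c2 by (simp only: powr_mult powr_powr powr_ge_zero less_imp_le)
    also have "- real (Suc j) * (d - CARD('n)) * (1 / p) = real (Suc j) * ((real CARD('n) - d) / p)"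
      using p by (simp add: field_simps)
    finally show ?thesis .
  qed
  finally have "ennreal ?c * Lp_norm M p e \<le> ennreal ?c * (ennreal (c2 powr (1 / p) * 2 powr (real (Suc j) * ((real CARD('n) - d) / p)))
      * Lp_norm lebesgue p (?E j))"
    by (rule mult_left_mono) simp
  also have "\<dots> = ennreal (?c * c2 powr (1 / p) * 2 powr (real (Suc j) * ((real CARD('n) - d) / p))) * Lp_norm lebesgue p (?E j)"
    by (simp only: mult.assoc ennreal_mult zero_le_power zero_le_numeral powr_ge_zero mult_nonneg_nonneg)
  finally have "Lp_norm M p (\<lambda>x. ennreal ?c * e x)
      \<le> ennreal (?c * c2 powr (1 / p) * 2 powr (real (Suc j) * ((real CARD('n) - d) / p))) * Lp_norm lebesgue p (?E j)"
    using Lp_norm_cmult[OF e p] by (simp only:)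
  moreover have "?E (Suc j) x \<le> ennreal ?c * e x" for x
  proof -
    have "?E (Suc j) x = ennreal ?c * (ennreal (1 / ?c) * ?E (Suc j) x)"
      using cc by (simp only: mult.assoc[symmetric] mult_1_left)
    also have "\<dots> \<le> ennreal ?c * e x" by (intro mult_left_mono le) simp
    finally show ?thesis .
  qed
  moreover have "(\<lambda>x. ennreal ?c * e x) \<in> borel_measurable M" by measurable
  ultimately show ?thesis by blast
qed

text \<open>A majorant at one scale uses the approximation error at a coarser scale, but the estimate offers
  no radius larger than 1. So the coarsest majorants are built from \<open>f\<close> itself.\<close>
lemma best_approx_majorants:
  assumes u: "1 \<le> u" "u \<le> p" and d: "d \<le> real CARD('n)" and f[measurable]: "f \<in> borel_measurable lebesgue"
  shows "\<exists>e. (\<forall>l. e l \<in> borel_measurable M) \<and>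
    (\<forall>l x. 1 \<le> l \<longrightarrow> best_approx_Rn k u f (2 powr - real l) x \<le> e (Suc l) x) \<and>
    (\<forall>x. cube_avg x (1 / 2) (\<lambda>y. ennreal \<bar>f y\<bar>) \<le> e 1 x) \<and>
    (\<forall>l. Lp_norm M p (e l) \<le> ennreal (2 ^ CARD('n) * c2 powr (1 / p) * 2 powr (real l * ((real CARD('n) - d) / p)))
      * (if l < 3 then Lp_norm lebesgue p (\<lambda>y. ennreal \<bar>f y\<bar>)
         else Lp_norm lebesgue p (best_approx_Rn k u f (2 powr - real (l - 2)))))"
proof -
  let ?E = "\<lambda>l. best_approx_Rn k u f (2 powr - real l)"
  let ?\<kappa> = "(real CARD('n) - d) / p"
  define K where "K = 2 ^ CARD('n) * c2 powr (1 / p)"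
  have p: "0 < p" using u by simp
  have \<kappa>: "0 \<le> ?\<kappa>" using d p by simp
  have K: "0 \<le> K" by (simp add: K_def)
  define F where "F = (\<lambda>x. epowr (cube_avg x (1 / 2) (\<lambda>y. epowr (ennreal \<bar>f y\<bar>) p)) (1 / p))"
  note F = Lp_avg_transfer[OF p f, folded F_def]
  have "\<forall>j. \<exists>e. e \<in> borel_measurable M \<and> (\<forall>x. ?E (Suc j) x \<le> e x) \<and>
    Lp_norm M p e \<le> ennreal (K * 2 powr (real (Suc j) * ?\<kappa>)) * Lp_norm lebesgue p (?E j)"
    unfolding K_def using best_approx_grid_transfer[OF u(1) p] by blast
  from choice[OF this] obtain G where G: "\<And>j. G j \<in> borel_measurable M" "\<And>j x. ?E (Suc j) x \<le> G j x"
    "\<And>j. Lp_norm M p (G j) \<le> ennreal (K * 2 powr (real (Suc j) * ?\<kappa>)) * Lp_norm lebesgue p (?E j)"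
    by blast
  \<comment> \<open>The index is shifted by one: \<open>e l\<close> dominates the error at scale l -
    1, so that a tail of the e's starting at i also covers the error on the cube of twice the
    radius. From l = 3 on it is the grid majorant, whose norm involves scale l - 2.\<close>
  define e where "e l = (if l < 3 then F else G (l - 2))" for l
  have "e l \<in> borel_measurable M" for l using F(1) G(1) by (simp add: e_def)
  moreover have "?E l x \<le> e (Suc l) x" if "1 \<le> l" for l x
  proof (cases "l = 1")
    case True
    have "?E 1 x \<le> F x" unfolding F_def using u
      by (subst two_powr_minus_nat, simp only: power_one_right, intro best_approx_Rn_le_Lp_avg) auto
    then show ?thesis using True by (simp add: e_def)
  next
    case False
    then have "2 \<le> l" using that by simp
    then obtain m where "l = Suc (Suc m)" by (auto dest: le_Suc_ex)
    then show ?thesis using G(2)[of "Suc m" x] by (simp add: e_def del: of_nat_Suc)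
  qed
  moreover have "cube_avg x (1 / 2) (\<lambda>y. ennreal \<bar>f y\<bar>) \<le> e 1 x" for x
    using cube_avg_le_Lp_avg[of p "1 / 2" "\<lambda>y. ennreal \<bar>f y\<bar>" x] u by (simp add: e_def F_def)
  moreover have "Lp_norm M p (e l) \<le> ennreal (K * 2 powr (real l * ?\<kappa>))
      * (if l < 3 then Lp_norm lebesgue p (\<lambda>y. ennreal \<bar>f y\<bar>) else Lp_norm lebesgue p (?E (l - 2)))" for l
  proof (cases "l < 3")
    case True
    \<comment> \<open>Since d \<le> n the exponent \<open>?\<kappa>\<close> is nonnegative, so the
      common constant also covers the majorants built from f.\<close>
    have "c2 powr (1 / p) * 1 \<le> c2 powr (1 / p) * (2 ^ CARD('n) * 2 powr (real l * ?\<kappa>))"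
    proof (intro mult_left_mono)
      have "1 * 1 \<le> 2 ^ CARD('n) * 2 powr (real l * ?\<kappa>)"
        using mult_nonneg_nonneg[OF of_nat_0_le_iff \<kappa>, of l]
        by (intro mult_mono ge_one_powr_ge_zero one_le_power) simp_all
      then show "1 \<le> 2 ^ CARD('n) * 2 powr (real l * ?\<kappa>)" by simp
    qed simp
    then have "c2 powr (1 / p) \<le> K * 2 powr (real l * ?\<kappa>)" by (simp add: K_def ac_simps)
    then have "ennreal (c2 powr (1 / p)) * Lp_norm lebesgue p (\<lambda>y. ennreal \<bar>f y\<bar>)
        \<le> ennreal (K * 2 powr (real l * ?\<kappa>)) * Lp_norm lebesgue p (\<lambda>y. ennreal \<bar>f y\<bar>)"
      by (intro mult_right_mono ennreal_leI) auto
    with F(2) show ?thesis using True by (simp add: e_def)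
  next
    case False
    have "K * 2 powr (real (Suc (l - 2)) * ?\<kappa>) \<le> K * 2 powr (real l * ?\<kappa>)"
      using False \<kappa> K by (intro mult_left_mono powr_mono mult_right_mono) auto
    then have "ennreal (K * 2 powr (real (Suc (l - 2)) * ?\<kappa>)) * Lp_norm lebesgue p (?E (l - 2))
        \<le> ennreal (K * 2 powr (real l * ?\<kappa>)) * Lp_norm lebesgue p (?E (l - 2))"
      by (intro mult_right_mono ennreal_leI) auto
    from order_trans[OF G(3) this] show ?thesis using False by (simp add: e_def)
  qed
  ultimately show ?thesis unfolding K_def by blast
qed

text \<open>For y in Q(x, 2^-i) the cube Q(y, 2^-i) lies in the cube of twice the radius about x.
  For fixed P the mean of |f - P| about y is thus bounded by a quantity depending on x alone;
  averaging the remaining tail over y gives the second summand.\<close>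

lemma trace_best_approx_pointwise:
  assumes u: "1 \<le> u" "u \<le> p" and K: "0 < K" and f[measurable]: "f \<in> borel_measurable lebesgue"
    and e[measurable]: "\<And>l. e l \<in> borel_measurable M"
    and maj: "\<And>l x. 1 \<le> l \<Longrightarrow> best_approx_Rn k u f (2 powr - real l) x \<le> e (Suc l) x"
    and avg: "\<And>x. cube_avg x (1 / 2) (\<lambda>y. ennreal \<bar>f y\<bar>) \<le> e 1 x"
    and g: "AE y in M. \<forall>P \<in> poly_space (k - 1). \<forall>m. ennreal \<bar>g y - P y\<bar>
        \<le> ennreal K * (cube_avg y (2 powr - real m) (\<lambda>z. ennreal \<bar>f z - P z\<bar>)
            + (\<Sum>j. best_approx_Rn k u f (2 powr - real (m + j)) y))"
  shows "AE y in M. ennreal \<bar>g y\<bar> \<le> ennreal K * (\<Sum>j. e (1 + j) y)"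
    and "x \<in> space M \<Longrightarrow> best_approx M k u g (cube x (2 powr - real i) \<inter> space M)
      \<le> ennreal (4 * K * 2 ^ CARD('n)) * (e i x
        + epowr ((\<integral>\<^sup>+y\<in>cube x (2 powr - real i) \<inter> space M. epowr (\<Sum>j. e (i + j) y) p \<partial>M)
            / emeasure M (cube x (2 powr - real i) \<inter> space M)) (1 / p))"
proof -
  let ?E = "\<lambda>l. best_approx_Rn k u f (2 powr - real l)"
  let ?c = "2 ^ CARD('n) :: real"
  have tail: "(\<Sum>j. ?E (m + j) y) \<le> (\<Sum>j. e (Suc m + j) y)" if "1 \<le> m" for m y
    using maj[of "m + _"] that by (intro suminf_le) auto
  show small: "AE y in M. ennreal \<bar>g y\<bar> \<le> ennreal K * (\<Sum>j. e (1 + j) y)"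
    using g
  proof eventually_elim
    case (elim y)
    \<comment> \<open>With P = 0 and m = 1 the mean of |f| over radius 1 / 2 is covered by
      \<open>e 1\<close>, and the errors from scale 1 on by \<open>e 2\<close>, \<open>e 3\<close>
      and so on.\<close>
    from elim[rule_format, OF zero_in_poly_space, of 1]
    have "ennreal \<bar>g y\<bar> \<le> ennreal K * (cube_avg y (2 powr - real 1) (\<lambda>z. ennreal \<bar>f z\<bar>) + (\<Sum>j. ?E (1 + j) y))"
      by (simp only: diff_0_right)
    also have "2 powr - real 1 = (1 / 2 :: real)" by (subst two_powr_minus_nat) simp
    also have "ennreal K * (cube_avg y (1 / 2) (\<lambda>z. ennreal \<bar>f z\<bar>) + (\<Sum>j. ?E (1 + j) y))
        \<le> ennreal K * (e 1 y + (\<Sum>j. e (Suc 1 + j) y))"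
      by (intro mult_left_mono add_mono avg tail) auto
    also have "e 1 y + (\<Sum>j. e (Suc 1 + j) y) = (\<Sum>j. e (1 + j) y)"
      by (subst suminf_offset[of "\<lambda>j. e (1 + j) y" 1]) auto
    finally show ?case .
  qed
  show "best_approx M k u g (cube x (2 powr - real i) \<inter> space M)
      \<le> ennreal (4 * K * 2 ^ CARD('n)) * (e i x
        + epowr ((\<integral>\<^sup>+y\<in>cube x (2 powr - real i) \<inter> space M. epowr (\<Sum>j. e (i + j) y) p \<partial>M)
            / emeasure M (cube x (2 powr - real i) \<inter> space M)) (1 / p))" if x: "x \<in> space M"
  proof -
    let ?t = "2 powr - real i"
    let ?A = "cube x ?t \<inter> space M"
    define R where "R y = (\<Sum>j. e (i + j) y)" for y
    define V where "V = epowr ((\<integral>\<^sup>+y\<in>?A. epowr (R y) p \<partial>M) / emeasure M ?A) (1 / p)"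
    have R[measurable]: "R \<in> borel_measurable M" unfolding R_def by measurable
    have A: "?A \<in> sets M" by (intro borel_sets) simp
    have t: "0 < ?t" "?t \<le> 1" by (simp, rule two_powr_minus_le_one)
    have "0 < ennreal (c1 * ?t powr d)" using c1 by simp
    also have "\<dots> \<le> emeasure M ?A" using x t by (intro lower)
    finally have nz: "emeasure M ?A \<noteq> 0" by simp
    have "emeasure M ?A \<le> ennreal (c2 * ?t powr d)" using x t by (intro upper)
    then have nt: "emeasure M ?A \<noteq> top" by (auto simp: top_unique)
    note approx = best_approx_le_Lp_avg[OF u less_imp_le[OF K] A nz nt R, folded V_def]
    have c: "1 \<le> ?c" by simp
    have split: "ennreal (4 * K) * V \<le> ennreal (4 * K * ?c) * V"
      using K c by (intro mult_right_mono ennreal_leI) (auto simp: mult_le_cancel_left1)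
    have "best_approx M k u g ?A \<le> ennreal (4 * K * ?c) * (e i x + V)"
    proof (cases "i < 2")
      case True
      \<comment> \<open>For i = 0 and i = 1 there is no majorant of the error at scale i - 1. The
        zero polynomial is used instead; the tail starting at 1 is at most the tail starting at
        i.\<close>
      have "AE y in M. y \<in> ?A \<longrightarrow> ennreal \<bar>g y - 0\<bar> \<le> ennreal K * (0 + R y)"
        using small
      proof eventually_elim
        case (elim y)
        also have "ennreal K * (\<Sum>j. e (1 + j) y) \<le> ennreal K * R y"
          unfolding R_def using True by (intro mult_left_mono suminf_tail_antimono_ennreal) auto
        finally show ?case by simp
      qed
      from approx[OF zero_in_poly_space this]
      have "best_approx M k u g ?A \<le> ennreal (4 * K) * V" by (simp only: add_0_left)
      also note split
      also have "ennreal (4 * K * ?c) * V \<le> ennreal (4 * K * ?c) * (e i x + V)"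
        by (intro mult_left_mono) auto
      finally show ?thesis .
    next
      case False
      then obtain i' where i': "i = Suc i'" "1 \<le> i'" by (cases i) auto
      let ?s = "2 powr - real i'"
      have ts: "?t = ?s / 2" unfolding i' by (rule two_powr_minus_Suc)
      define c where "c P = epowr (cube_avg x ?s (\<lambda>z. epowr (ennreal \<bar>f z - P z\<bar>) u)) (1 / u)" for P
      have "best_approx M k u g ?A \<le> ennreal (4 * K * ?c) * c P + ennreal (4 * K) * V"
        if P: "P \<in> poly_space (k - 1)" for P
      proof -
        note [measurable] = poly_space_measurable(1)[OF P]
        have near: "cube_avg y ?t (\<lambda>z. ennreal \<bar>f z - P z\<bar>) \<le> ennreal ?c * c P" if y: "y \<in> cube x ?t" for y
        proof -
          have "cube_avg y ?t (\<lambda>z. ennreal \<bar>f z - P z\<bar>)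
              \<le> epowr (cube_avg y ?t (\<lambda>z. epowr (ennreal \<bar>f z - P z\<bar>) u)) (1 / u)"
            using t u by (intro cube_avg_le_Lp_avg) auto
          also have "\<dots> \<le> ennreal ((?s / ?t) ^ CARD('n)) * c P"
            unfolding c_def using t u ts y i' by (intro Lu_avg_subset cube_subset_cube) auto
          also have "?s / ?t = 2" unfolding ts by simp
          finally show ?thesis .
        qed
        have "AE y in M. y \<in> ?A \<longrightarrow> ennreal \<bar>g y - P y\<bar> \<le> ennreal K * (ennreal ?c * c P + R y)"
          using g
        proof eventually_elim
          case (elim y)
          show ?case
          proof
            assume y: "y \<in> ?A"
            have "ennreal \<bar>g y - P y\<bar> \<le> ennreal K * (cube_avg y ?t (\<lambda>z. ennreal \<bar>f z - P z\<bar>) + (\<Sum>j. ?E (i + j) y))"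
              using elim P by blast
            also have "\<dots> \<le> ennreal K * (ennreal ?c * c P + R y)"
            proof (intro mult_left_mono add_mono near)
              \<comment> \<open>The errors from scale i on are majorised from index i + 1 on, so
                they fit into the tail R with room for \<open>e i\<close>.\<close>
              have "(\<Sum>j. ?E (i + j) y) \<le> (\<Sum>j. e (Suc i + j) y)" using False by (intro tail) simp
              also have "\<dots> \<le> R y" unfolding R_def by (intro suminf_tail_antimono_ennreal) simp
              finally show "(\<Sum>j. ?E (i + j) y) \<le> R y" .
            qed (use y in auto)
            finally show "ennreal \<bar>g y - P y\<bar> \<le> ennreal K * (ennreal ?c * c P + R y)" .
          qed
        qed
        from approx[OF P this]
        have "best_approx M k u g ?A \<le> ennreal (4 * K) * (ennreal ?c * c P + V)" .
        also have "\<dots> = ennreal (4 * K * ?c) * c P + ennreal (4 * K) * V"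
          using K by (simp only: distrib_left mult.assoc[symmetric] ennreal_mult zero_le_power zero_le_numeral less_imp_le mult_nonneg_nonneg)
        finally show ?thesis .
      qed
      \<comment> \<open>Only here is P minimised, the average over y being already taken; the
        infimum is the error at the coarser scale i - 1.\<close>
      then have "best_approx M k u g ?A \<le> ennreal (4 * K * ?c) * (INF P \<in> poly_space (k - 1). c P) + ennreal (4 * K) * V"
        using K by (intro ennreal_le_affine_INF poly_space_nonempty) auto
      also have "(INF P \<in> poly_space (k - 1). c P) = ?E i' x"
        unfolding c_def best_approx_Rn_alt ..
      also have "ennreal (4 * K * ?c) * ?E i' x + ennreal (4 * K) * V \<le> ennreal (4 * K * ?c) * e i x + ennreal (4 * K * ?c) * V"
        using maj[OF i'(2), of x] unfolding i'(1)[symmetric] by (intro add_mono split mult_left_mono) auto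
      finally show ?thesis by (simp only: distrib_left)
    qed
    then show ?thesis unfolding V_def R_def .
  qed
qed

text \<open>The operator taking R^p to its local mean is bounded on L^1(M) uniformly in t: the lower
  mass bound controls the denominator, the upper one the overlap of the cubes, and the powers of t
  cancel to c2 / c1.\<close>

lemma Lp_norm_trace_best_approx:
  assumes p: "1 \<le> p" and K: "0 \<le> K" and t: "0 < t" "t \<le> 1"
    and e[measurable]: "e \<in> borel_measurable M" and R[measurable]: "R \<in> borel_measurable M"
    and eR: "\<And>x. e x \<le> R x"
    and B: "\<And>x. x \<in> space M \<Longrightarrow> B x \<le> ennreal K * (e x
        + epowr ((\<integral>\<^sup>+y\<in>cube x t \<inter> space M. epowr (R y) p \<partial>M) / emeasure M (cube x t \<inter> space M)) (1 / p))"
  shows "Lp_norm M p B \<le> ennreal (((2 * K) powr p * (1 + c2 / c1)) powr (1 / p)) * Lp_norm M p R"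
proof (rule Lp_norm_le)
  let ?I = "\<lambda>x. \<integral>\<^sup>+y\<in>cube x t. epowr (R y) p \<partial>M"
  \<comment> \<open>Replacing the mass of the cube by its lower bound frees the denominator from the
    centre, so that Fubini's theorem applies to the numerator.\<close>
  let ?a = "ennreal (1 / (c1 * t powr d))"
  have a: "0 < c1 * t powr d" using c1 t by simp
  have up: "emeasure M (cube y t \<inter> space M) \<le> ennreal (c2 * t powr d)" if "y \<in> space M" for y
    using upper[OF that] t by blast
  have m: "(\<lambda>y. epowr (R y) p) \<in> borel_measurable M" by measurable
  note fub = nn_integral_cube_Fubini[OF sigma_finite_measure_axioms borel_id m up]
  have [measurable]: "?I \<in> borel_measurable M" by (rule fub(1))
  have V: "(\<integral>\<^sup>+y\<in>cube x t \<inter> space M. epowr (R y) p \<partial>M) / emeasure M (cube x t \<inter> space M) \<le> ?a * ?I x"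
    if x: "x \<in> space M" for x
  proof -
    have "(\<integral>\<^sup>+y\<in>cube x t \<inter> space M. epowr (R y) p \<partial>M) = ?I x"
      by (intro nn_integral_cong) (auto simp: indicator_def)
    moreover have "inverse (emeasure M (cube x t \<inter> space M)) \<le> inverse (ennreal (c1 * t powr d))"
      by (intro inverse_antimono_ennreal lower x t)
    moreover have "inverse (ennreal (c1 * t powr d)) = ?a"
      using a by (simp only: inverse_ennreal inverse_eq_divide)
    ultimately show ?thesis unfolding divide_ennreal_def
      by (simp only: mult.commute[of ?a]) (intro mult_left_mono, auto)
  qed
  have "(\<integral>\<^sup>+x. epowr (B x) p \<partial>M) \<le> (\<integral>\<^sup>+x. ennreal ((2 * K) powr p) * (epowr (R x) p + ?a * ?I x) \<partial>M)"
  proof (rule nn_integral_mono)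
    fix x assume x: "x \<in> space M"
    let ?V = "(\<integral>\<^sup>+y\<in>cube x t \<inter> space M. epowr (R y) p \<partial>M) / emeasure M (cube x t \<inter> space M)"
    have "epowr (B x) p \<le> epowr (ennreal K * (e x + epowr ?V (1 / p))) p"
      using p by (intro epowr_mono B x) simp
    also have "\<dots> \<le> ennreal (K powr p) * (ennreal (2 powr p) * (epowr (e x) p + epowr (epowr ?V (1 / p)) p))"
      using p K by (simp only: epowr_mult epowr_ennreal) (intro mult_left_mono epowr_add_le, auto)
    also have "\<dots> = ennreal ((2 * K) powr p) * (epowr (e x) p + epowr (epowr ?V (1 / p)) p)"
      using K by (simp only: mult.assoc[symmetric] ennreal_mult[symmetric] powr_ge_zero powr_mult mult.commute[of "K powr p"])
    also have "epowr (epowr ?V (1 / p)) p = ?V" using p by (intro epowr_inverse) simp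
    also have "ennreal ((2 * K) powr p) * (epowr (e x) p + ?V) \<le> ennreal ((2 * K) powr p) * (epowr (R x) p + ?a * ?I x)"
      using p by (intro mult_left_mono add_mono V x epowr_mono eR) auto
    finally show "epowr (B x) p \<le> ennreal ((2 * K) powr p) * (epowr (R x) p + ?a * ?I x)" .
  qed
  also have "\<dots> = ennreal ((2 * K) powr p) * ((\<integral>\<^sup>+x. epowr (R x) p \<partial>M) + ?a * (\<integral>\<^sup>+x. ?I x \<partial>M))"
    by (subst nn_integral_cmult, measurable, subst nn_integral_add, measurable, subst nn_integral_cmult, measurable)
  also have "\<dots> \<le> ennreal ((2 * K) powr p) * ((\<integral>\<^sup>+x. epowr (R x) p \<partial>M) + ?a * (ennreal (c2 * t powr d) * (\<integral>\<^sup>+x. epowr (R x) p \<partial>M)))"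
    by (intro mult_left_mono add_left_mono fub(2)) auto
  also have "?a * (ennreal (c2 * t powr d) * (\<integral>\<^sup>+x. epowr (R x) p \<partial>M)) = ennreal (c2 / c1) * (\<integral>\<^sup>+x. epowr (R x) p \<partial>M)"
  proof -
    have "?a * ennreal (c2 * t powr d) = ennreal (1 / (c1 * t powr d) * (c2 * t powr d))"
      using a c2 by (intro ennreal_mult[symmetric]) auto
    also have "1 / (c1 * t powr d) * (c2 * t powr d) = c2 / c1" using t by simp
    finally show ?thesis by (simp only: mult.assoc[symmetric])
  qed
  also have "(\<integral>\<^sup>+x. epowr (R x) p \<partial>M) + ennreal (c2 / c1) * (\<integral>\<^sup>+x. epowr (R x) p \<partial>M)
      = ennreal (1 + c2 / c1) * (\<integral>\<^sup>+x. epowr (R x) p \<partial>M)"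
    using c1 c2 by (subst ennreal_plus) (auto simp: distrib_right)
  also have "ennreal ((2 * K) powr p) * (ennreal (1 + c2 / c1) * (\<integral>\<^sup>+x. epowr (R x) p \<partial>M))
      = ennreal ((2 * K) powr p * (1 + c2 / c1)) * (\<integral>\<^sup>+x. epowr (R x) p \<partial>M)"
    using c1 c2 by (subst ennreal_mult) (auto simp: mult.assoc)
  finally show "(\<integral>\<^sup>+x. epowr (B x) p \<partial>M) \<le> ennreal ((2 * K) powr p * (1 + c2 / c1)) * (\<integral>\<^sup>+x. epowr (R x) p \<partial>M)" .
qed (use p c1 c2 in auto)

end

subsection \<open>The trace estimate\<close>

lemma epowr_suminf_cmult_le:
  assumes q: "0 < q" and K: "0 \<le> K" and le: "\<And>i. x i \<le> ennreal K * y i"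
  shows "(\<Sum>i. epowr (w i * x i) q) \<le> ennreal (K powr q) * (\<Sum>i. epowr (w i * y i) q)"
proof -
  have "epowr (w i * x i) q \<le> ennreal (K powr q) * epowr (w i * y i) q" for i
  proof -
    have "epowr (w i * x i) q \<le> epowr (ennreal K * (w i * y i)) q"
      using q mult_left_mono[OF le, of "w i" i] by (intro epowr_mono) (auto simp: mult.left_commute)
    then show ?thesis using K by (simp only: epowr_mult[of "ennreal K"] epowr_ennreal)
  qed
  then have "(\<Sum>i. epowr (w i * x i) q) \<le> (\<Sum>i. ennreal (K powr q) * epowr (w i * y i) q)"
    by (intro suminf_le) auto
  then show ?thesis by (simp only: ennreal_suminf_cmult)
qed

text \<open>Replacing the weight at l by the one at l - 2 costs 2^(2 \<alpha>), which also bounds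
  the weights of the three initial terms; these account for the factor 3.\<close>

lemma epowr_weighted_shift_le:
  fixes \<epsilon> :: "nat \<Rightarrow> ennreal"
  assumes q: "0 < q" and \<alpha>: "0 \<le> \<alpha>"
  shows "(\<Sum>l. epowr (ennreal (2 powr (real l * \<alpha>)) * (if l < 3 then N else \<epsilon> (l - 2))) q)
    \<le> ennreal (3 * 2 powr (2 * \<alpha> * q)) * (epowr N q + (\<Sum>j. epowr (ennreal (2 powr (real j * \<alpha>)) * \<epsilon> j) q))"
proof -
  define c where "c = 2 powr (2 * \<alpha> * q)"
  let ?t = "\<lambda>l. epowr (ennreal (2 powr (real l * \<alpha>)) * (if l < 3 then N else \<epsilon> (l - 2))) q"
  define s where "s j = epowr (ennreal (2 powr (real j * \<alpha>)) * \<epsilon> j) q" for j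
  have "?t l \<le> ennreal c * epowr N q" if "l < 3" for l
  proof -
    have "(2 powr (real l * \<alpha>)) powr q \<le> c"
      unfolding c_def powr_powr using that \<alpha> q by (intro powr_mono mult_right_mono) auto
    then have "ennreal ((2 powr (real l * \<alpha>)) powr q) * epowr N q \<le> ennreal c * epowr N q"
      by (intro mult_right_mono ennreal_leI) auto
    then show ?thesis using that by (simp only: if_True epowr_mult epowr_ennreal powr_ge_zero)
  qed
  then have "(\<Sum>l<3. ?t l) \<le> (\<Sum>l<3::nat. ennreal c * epowr N q)"
    by (intro sum_mono) auto
  also have "\<dots> = ennreal (3 * c) * epowr N q"
    by (simp add: ennreal_mult c_def mult.assoc)
  finally have head: "(\<Sum>l<3. ?t l) \<le> ennreal (3 * c) * epowr N q" .
  have shift: "?t (j + 3) = ennreal c * s (j + 1)" for j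
  proof -
    have "2 powr (real (j + 3) * \<alpha>) = 2 powr (2 * \<alpha>) * 2 powr (real (j + 1) * \<alpha>)"
      by (simp add: powr_add[symmetric] algebra_simps)
    then have "ennreal (2 powr (real (j + 3) * \<alpha>)) = ennreal (2 powr (2 * \<alpha>)) * ennreal (2 powr (real (j + 1) * \<alpha>))"
      by (simp only: ennreal_mult powr_ge_zero)
    then have "?t (j + 3) = epowr (ennreal (2 powr (2 * \<alpha>)) * (ennreal (2 powr (real (j + 1) * \<alpha>)) * \<epsilon> (j + 1))) q"
      by (simp only: mult.assoc) simp
    also have "\<dots> = ennreal ((2 powr (2 * \<alpha>)) powr q) * s (j + 1)"
      unfolding s_def by (simp only: epowr_mult[of "ennreal (2 powr (2 * \<alpha>))"] epowr_ennreal powr_ge_zero)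
    finally show ?thesis by (simp only: c_def powr_powr)
  qed
  have "(\<Sum>j. ?t (j + 3)) = ennreal c * (\<Sum>j. s (j + 1))"
    by (simp only: shift ennreal_suminf_cmult)
  also have "\<dots> \<le> ennreal (3 * c) * (\<Sum>j. s j)"
    by (intro mult_mono suminf_shift_le_ennreal ennreal_leI) (auto simp: c_def)
  finally have "(\<Sum>j. ?t (j + 3)) \<le> ennreal (3 * c) * (\<Sum>j. s j)" .
  then have "(\<Sum>l<3. ?t l) + (\<Sum>j. ?t (j + 3)) \<le> ennreal (3 * c) * (epowr N q + (\<Sum>j. s j))"
    using head unfolding distrib_left by (rule add_mono[rotated])
  moreover have "(\<Sum>l. ?t l) = (\<Sum>l<3. ?t l) + (\<Sum>j. ?t (j + 3))"
    by (subst suminf_offset[of ?t 3]) auto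
  ultimately show ?thesis by (simp only: c_def s_def)
qed

lemma (in ahlfors_measure) trace_estimate:
  assumes k: "0 < k" and u: "1 \<le> u" "u \<le> p" and q: "1 \<le> q" and dn: "d \<le> real CARD('n)"
    and \<alpha>: "(real CARD('n) - d) / p < \<alpha>"
  shows "\<exists>C::real. 0 < C \<and> (\<forall>f :: real ^ 'n \<Rightarrow> real. f \<in> borel_measurable lebesgue \<longrightarrow>
    epowr (\<Sum>i::nat. epowr (ennreal (2 powr (real i * (\<alpha> - (real CARD('n) - d) / p)))
        * Lp_norm M p (\<lambda>x. best_approx M k u (precise_rep f) (cube x (2 powr - real i) \<inter> space M))) q) (1 / q)
      + Lp_norm M p (\<lambda>x. ennreal \<bar>precise_rep f x\<bar>)
    \<le> ennreal C *
      (epowr (\<Sum>j::nat. epowr (ennreal (2 powr (real j * \<alpha>))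
          * Lp_norm lebesgue p (best_approx_Rn k u f (2 powr - real j))) q) (1 / q)
        + Lp_norm lebesgue p (\<lambda>x. ennreal \<bar>f x\<bar>)))"
proof -
  let ?\<kappa> = "(real CARD('n) - d) / p"
  \<comment> \<open>What the weight keeps after the loss \<open>?\<kappa>\<close> in the grid
    comparison. Its positivity, needed for the tails, is the assumption on \<alpha>.\<close>
  define \<beta> where "\<beta> = \<alpha> - ?\<kappa>"
  have p: "1 \<le> p" using u by simp
  then have p0: "0 < p" and q0: "0 < q" using q by simp_all
  have \<beta>: "0 < \<beta>" using \<alpha> by (simp add: \<beta>_def)
  have "0 \<le> ?\<kappa>" using dn p by simp
  then have \<alpha>0: "0 \<le> \<alpha>" using \<alpha> by linarith
  obtain K0 where K0: "0 < K0" and trace: "\<And>(f :: real ^ 'n \<Rightarrow> real) x P m. f \<in> borel_measurable lebesgue \<Longrightarrow>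
      (\<And>x r. 0 < r \<Longrightarrow> cube_avg x r (\<lambda>y. ennreal \<bar>f y\<bar>) < top) \<Longrightarrow>
      (\<Sum>j. best_approx_Rn k u f (2 powr - real j) x) < top \<Longrightarrow> P \<in> poly_space (k - 1) \<Longrightarrow>
      ennreal \<bar>precise_rep f x - P x\<bar>
        \<le> ennreal K0 * (cube_avg x (2 powr - real m) (\<lambda>y. ennreal \<bar>f y - P y\<bar>)
            + (\<Sum>j. best_approx_Rn k u f (2 powr - real (m + j)) x))"
    using precise_rep_poly_bound[OF k u(1), where 'n = 'n] by blast
  obtain C1 where C1: "0 < C1" and Hardy: "\<And>e. (\<And>l. e l \<in> borel_measurable M) \<Longrightarrow>
    (\<Sum>i. epowr (ennreal (2 powr (real i * \<beta>)) * Lp_norm M p (\<lambda>x. \<Sum>j. e (i + j) x)) q)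
    \<le> ennreal C1 * (\<Sum>l. epowr (ennreal (2 powr (real l * \<beta>)) * Lp_norm M p (e l)) q)"
    using Hardy_tails[OF p q \<beta>, of M] by blast
  define K1 where "K1 = 2 ^ CARD('n) * c2 powr (1 / p)"
  have K1: "0 < K1" using c2 by (simp add: K1_def)
  \<comment> \<open>The Hardy constant, the q-th power of the grid constant and the cost of the
    index shift. All constants are fixed before f is introduced.\<close>
  define K2 where "K2 = C1 * (K1 powr q * (3 * 2 powr (2 * \<alpha> * q)))"
  have K2: "0 < K2" using C1 K1 by (simp add: K2_def)
  define K3 where "K3 = 4 * K0 * 2 ^ CARD('n)"
  have K3: "0 < K3" using K0 by (simp add: K3_def)
  define K4 where "K4 = ((2 * K3) powr p * (1 + c2 / c1)) powr (1 / p)"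
  have "0 < 1 + c2 / c1" using c1 c2 by (intro add_pos_pos) auto
  then have K4: "0 < K4" using K3 unfolding K4_def by simp
  define C3 where "C3 = K2 powr (1 / q) * 2"
  have C3: "0 < C3" using K2 by (simp add: C3_def)
  have main: "epowr (\<Sum>i. epowr (ennreal (2 powr (real i * \<beta>))
        * Lp_norm M p (\<lambda>x. best_approx M k u (precise_rep f) (cube x (2 powr - real i) \<inter> space M))) q) (1 / q)
      + Lp_norm M p (\<lambda>x. ennreal \<bar>precise_rep f x\<bar>)
    \<le> ennreal ((K4 + K0) * C3) *
      (epowr (\<Sum>j. epowr (ennreal (2 powr (real j * \<alpha>))
          * Lp_norm lebesgue p (best_approx_Rn k u f (2 powr - real j))) q) (1 / q)
        + Lp_norm lebesgue p (\<lambda>x. ennreal \<bar>f x\<bar>))"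
    if f[measurable]: "f \<in> borel_measurable lebesgue" for f :: "real ^ 'n \<Rightarrow> real"
  proof -
    let ?E = "\<lambda>l. best_approx_Rn k u f (2 powr - real l)"
    let ?B = "\<lambda>i x. best_approx M k u (precise_rep f) (cube x (2 powr - real i) \<inter> space M)"
    define N where "N = Lp_norm lebesgue p (\<lambda>x. ennreal \<bar>f x\<bar>)"
    define X where "X = (\<Sum>j. epowr (ennreal (2 powr (real j * \<alpha>)) * Lp_norm lebesgue p (?E j)) q)"
    define rhs where "rhs = epowr X (1 / q) + N"
    show ?thesis
    proof (cases "rhs = top")
      case True
      then have "ennreal ((K4 + K0) * C3) * rhs = top"
        using K4 K0 C3 by (simp add: ennreal_mult_top)
      then show ?thesis by (simp only: rhs_def X_def N_def top_greatest)
    next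
      \<comment> \<open>A finite right-hand side supplies both requirements of the pointwise bound:
        finite means of |f| over all cubes, and summable errors at almost every point of M.\<close>
      case False
      obtain e where e[measurable]: "\<And>l. e l \<in> borel_measurable M"
        and maj: "\<And>l x. 1 \<le> l \<Longrightarrow> ?E l x \<le> e (Suc l) x"
        and avg: "\<And>x. cube_avg x (1 / 2) (\<lambda>y. ennreal \<bar>f y\<bar>) \<le> e 1 x"
        and e_norm: "\<And>l. Lp_norm M p (e l) \<le> ennreal (K1 * 2 powr (real l * ?\<kappa>))
          * (if l < 3 then N else Lp_norm lebesgue p (?E (l - 2)))"
        using best_approx_majorants[OF u dn f, of k] unfolding K1_def N_def by blast
      define R where "R i x = (\<Sum>j. e (i + j) x)" for i x
      have R[measurable]: "R i \<in> borel_measurable M" for i unfolding R_def by measurable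
      define H where "H = (\<Sum>i. epowr (ennreal (2 powr (real i * \<beta>)) * Lp_norm M p (R i)) q)"
      have H_le: "H \<le> ennreal K2 * (epowr N q + X)"
      proof -
        let ?b = "\<lambda>l. if l < 3 then N else Lp_norm lebesgue p (?E (l - 2))"
        \<comment> \<open>The grid factor 2^(l \<kappa>) and the weight 2^(l \<beta>) multiply to
          the weight 2^(l \<alpha>) of the right-hand side.\<close>
        have step: "ennreal (2 powr (real l * \<beta>)) * Lp_norm M p (e l) \<le> ennreal K1 * (ennreal (2 powr (real l * \<alpha>)) * ?b l)" for l
        proof -
          have "ennreal (2 powr (real l * \<beta>)) * Lp_norm M p (e l)
              \<le> ennreal (2 powr (real l * \<beta>)) * (ennreal (K1 * 2 powr (real l * ?\<kappa>)) * ?b l)"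
            by (intro mult_left_mono e_norm) simp
          also have "\<dots> = ennreal (2 powr (real l * \<beta>) * (K1 * 2 powr (real l * ?\<kappa>))) * ?b l"
            using K1 by (subst ennreal_mult) (auto simp: mult.assoc)
          also have "2 powr (real l * \<beta>) * (K1 * 2 powr (real l * ?\<kappa>)) = K1 * 2 powr (real l * \<beta> + real l * ?\<kappa>)"
            by (simp only: powr_add mult.left_commute)
          also have "real l * \<beta> + real l * ?\<kappa> = real l * \<alpha>"
            unfolding \<beta>_def by (simp only: distrib_left[symmetric] diff_add_cancel)
          also have "ennreal (K1 * 2 powr (real l * \<alpha>)) * ?b l = ennreal K1 * (ennreal (2 powr (real l * \<alpha>)) * ?b l)"
            using K1 by (subst ennreal_mult) (auto simp: mult.assoc)
          finally show ?thesis .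
        qed
        have "H \<le> ennreal C1 * (\<Sum>l. epowr (ennreal (2 powr (real l * \<beta>)) * Lp_norm M p (e l)) q)"
          unfolding H_def R_def by (rule Hardy) (rule e)
        also have "\<dots> \<le> ennreal C1 * (ennreal (K1 powr q) * (\<Sum>l. epowr (ennreal (2 powr (real l * \<alpha>)) * ?b l) q))"
          using epowr_suminf_cmult_le[OF q0 less_imp_le[OF K1] step, of "\<lambda>_. 1"]
          by (intro mult_left_mono) (simp_all only: mult_1_left zero_le)
        also have "\<dots> \<le> ennreal C1 * (ennreal (K1 powr q) * (ennreal (3 * 2 powr (2 * \<alpha> * q)) * (epowr N q + X)))"
          unfolding X_def by (intro mult_left_mono epowr_weighted_shift_le q0 \<alpha>0) auto
        also have "\<dots> = ennreal K2 * (epowr N q + X)"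
          using C1 K1 unfolding K2_def
          by (simp only: mult.assoc[symmetric] ennreal_mult powr_ge_zero less_imp_le mult_nonneg_nonneg zero_le_numeral)
        finally show ?thesis .
      qed
      have Hq: "epowr H (1 / q) \<le> ennreal C3 * rhs"
      proof -
        have "epowr H (1 / q) \<le> epowr (ennreal K2 * (epowr N q + X)) (1 / q)"
          using H_le q0 by (intro epowr_mono) auto
        also have "\<dots> = ennreal (K2 powr (1 / q)) * epowr (epowr N q + X) (1 / q)"
          using K2 by (simp only: epowr_mult epowr_ennreal less_imp_le)
        also have "\<dots> \<le> ennreal (K2 powr (1 / q)) * (ennreal (2 powr (1 / q)) * (epowr (epowr N q) (1 / q) + epowr X (1 / q)))"
          using q0 by (intro mult_left_mono epowr_add_le) auto
        also have "\<dots> \<le> ennreal (K2 powr (1 / q)) * (ennreal 2 * (N + epowr X (1 / q)))"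
        proof -
          have "2 powr (1 / q) \<le> 2 powr (1::real)" using q by (intro powr_mono) auto
          moreover have "epowr (epowr N q) (1 / q) = N" using q0 by (intro epowr_inverse)
          ultimately show ?thesis by (intro mult_left_mono mult_mono ennreal_leI) auto
        qed
        also have "\<dots> = ennreal C3 * rhs"
          unfolding C3_def rhs_def
          by (simp only: ennreal_mult powr_ge_zero zero_le_numeral mult.assoc add.commute)
        finally show ?thesis .
      qed
      have R0: "Lp_norm M p (R 0) \<le> epowr H (1 / q)"
      proof -
        have "epowr (ennreal (2 powr (real 0 * \<beta>)) * Lp_norm M p (R 0)) q \<le> H"
          unfolding H_def by (rule ennreal_le_suminf)
        then show ?thesis using epowr_le_iff[OF q0] by simp
      qed
      \<comment> \<open>The full sum of majorants is the term i = 0 of H, with weight 1. Its norm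
        being finite, it is finite almost everywhere, and there the means of f converge.\<close>
      have "Lp_norm M p (R 0) \<le> ennreal C3 * rhs" using R0 Hq by (rule order_trans)
      then have "Lp_norm M p (R 0) \<noteq> top" using False by (auto simp: top_unique ennreal_mult_eq_top_iff)
      then have "(\<integral>\<^sup>+x. epowr (R 0 x) p \<partial>M) \<noteq> top" using Lp_norm_powr[OF p0, of M "R 0"] by (metis epowr_eq_top_iff)
      then have "AE x in M. epowr (R 0 x) p \<noteq> \<infinity>" by (intro nn_integral_PInf_AE) auto
      then have R_fin: "AE x in M. R 0 x < top" by eventually_elim (simp add: less_top)
      have "N \<noteq> top" using False by (auto simp: rhs_def)
      then have f_fin: "(\<integral>\<^sup>+x. epowr (ennreal \<bar>f x\<bar>) p \<partial>lebesgue) < top"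
        using Lp_norm_powr[OF p0, of lebesgue "\<lambda>x. ennreal \<bar>f x\<bar>"] unfolding N_def by (metis epowr_eq_top_iff less_top)
      have avg_fin: "epowr (cube_avg x r (\<lambda>y. epowr (ennreal \<bar>f y\<bar>) p)) (1 / p) < top" if r: "0 < r" for x r
      proof -
        have "(\<integral>\<^sup>+y\<in>cube x r. epowr (ennreal \<bar>f y\<bar>) p \<partial>lebesgue) \<le> (\<integral>\<^sup>+x. epowr (ennreal \<bar>f x\<bar>) p \<partial>lebesgue)"
          by (intro nn_integral_mono) (auto simp: indicator_def)
        then have "(\<integral>\<^sup>+y\<in>cube x r. epowr (ennreal \<bar>f y\<bar>) p \<partial>lebesgue) \<noteq> top"
          using f_fin by (auto simp: top_unique)
        then have "cube_avg x r (\<lambda>y. epowr (ennreal \<bar>f y\<bar>) p) \<noteq> top"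
          unfolding cube_avg_def using emeasure_cube_nontrivial[OF r, of x] by (simp only: ennreal_divide_eq_top_iff) simp
        then show ?thesis by (simp add: less_top[symmetric])
      qed
      have loc: "cube_avg x r (\<lambda>y. ennreal \<bar>f y\<bar>) < top" if "0 < r" for x r
      proof -
        have "(\<lambda>y. ennreal \<bar>f y\<bar>) \<in> borel_measurable lebesgue" by measurable
        from order_le_less_trans[OF cube_avg_le_Lp_avg[OF p that this] avg_fin[OF that]]
        show ?thesis .
      qed
      have trace_AE: "AE y in M. \<forall>P \<in> poly_space (k - 1). \<forall>m. ennreal \<bar>precise_rep f y - P y\<bar>
          \<le> ennreal K0 * (cube_avg y (2 powr - real m) (\<lambda>z. ennreal \<bar>f z - P z\<bar>) + (\<Sum>j. ?E (m + j) y))"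
        using R_fin
      proof eventually_elim
        case (elim y)
        \<comment> \<open>Scale 0 has no majorant among the e's. Its error is bounded separately by
          the L^p mean of f over radius 1, which is finite at every point.\<close>
        have "(\<Sum>j. ?E j y) = ?E 0 y + (\<Sum>j. ?E (j + 1) y)"
          by (subst suminf_offset[of _ 1]) auto
        also have "(\<Sum>j. ?E (j + 1) y) \<le> (\<Sum>j. e (2 + j) y)"
          using maj[of "_ + 1"] by (intro suminf_le) auto
        also have "\<dots> \<le> R 0 y" unfolding R_def by (intro suminf_tail_antimono_ennreal) simp
        finally have le: "(\<Sum>j. ?E j y) \<le> ?E 0 y + R 0 y" by simp
        have "?E 0 y \<le> epowr (cube_avg y 1 (\<lambda>z. epowr (ennreal \<bar>f z\<bar>) p)) (1 / p)"
          using best_approx_Rn_le_Lp_avg[OF u, of 1 f k y] f by simp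
        also have "\<dots> < top" by (rule avg_fin) simp
        finally have "?E 0 y + R 0 y < top" using elim by simp
        with le have "(\<Sum>j. ?E j y) < top" by (rule order_le_less_trans)
        then show ?case using trace[OF f loc] by blast
      qed
      have B_norm: "Lp_norm M p (?B i) \<le> ennreal K4 * Lp_norm M p (R i)" for i
        unfolding K4_def
      proof (rule Lp_norm_trace_best_approx)
        show "e i x \<le> R i x" for x
          unfolding R_def using ennreal_le_suminf[of "\<lambda>j. e (i + j) x" 0] by simp
        show "?B i x \<le> ennreal K3 * (e i x + epowr ((\<integral>\<^sup>+y\<in>cube x (2 powr - real i) \<inter> space M. epowr (R i y) p \<partial>M)
            / emeasure M (cube x (2 powr - real i) \<inter> space M)) (1 / p))" if "x \<in> space M" for x
          unfolding K3_def R_def by (rule trace_best_approx_pointwise(2)[OF u K0 f e maj avg trace_AE that])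
      qed (use p K3 two_powr_minus_le_one in auto)
      have "(\<Sum>i. epowr (ennreal (2 powr (real i * \<beta>)) * Lp_norm M p (?B i)) q) \<le> ennreal (K4 powr q) * H"
        unfolding H_def by (rule epowr_suminf_cmult_le[OF q0 less_imp_le[OF K4] B_norm])
      then have "epowr (\<Sum>i. epowr (ennreal (2 powr (real i * \<beta>)) * Lp_norm M p (?B i)) q) (1 / q)
          \<le> epowr (ennreal (K4 powr q) * H) (1 / q)"
        using q0 by (intro epowr_mono) auto
      also have "\<dots> = ennreal K4 * epowr H (1 / q)"
        using K4 q0 by (simp only: epowr_mult epowr_ennreal powr_ge_zero powr_powr) simp
      finally have part1: "epowr (\<Sum>i. epowr (ennreal (2 powr (real i * \<beta>)) * Lp_norm M p (?B i)) q) (1 / q)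
          \<le> ennreal K4 * epowr H (1 / q)" .
      have "AE y in M. ennreal \<bar>precise_rep f y\<bar> \<le> ennreal K0 * (\<Sum>j. e (1 + j) y)"
        by (rule trace_best_approx_pointwise(1)[OF u K0 f e maj avg trace_AE])
      then have "AE y in M. ennreal \<bar>precise_rep f y\<bar> \<le> ennreal K0 * R 0 y"
      proof eventually_elim
        case (elim y)
        also have "ennreal K0 * (\<Sum>j. e (1 + j) y) \<le> ennreal K0 * R 0 y"
          unfolding R_def by (intro mult_left_mono suminf_tail_antimono_ennreal) auto
        finally show ?case .
      qed
      then have "Lp_norm M p (\<lambda>y. ennreal \<bar>precise_rep f y\<bar>) \<le> Lp_norm M p (\<lambda>y. ennreal K0 * R 0 y)"
        using p0 by (intro Lp_norm_mono_AE) auto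
      also have "\<dots> = ennreal K0 * Lp_norm M p (R 0)" by (rule Lp_norm_cmult[OF R p0])
      also have "\<dots> \<le> ennreal K0 * epowr H (1 / q)" by (intro mult_left_mono R0) simp
      finally have part2: "Lp_norm M p (\<lambda>y. ennreal \<bar>precise_rep f y\<bar>) \<le> ennreal K0 * epowr H (1 / q)" .
      have "epowr (\<Sum>i. epowr (ennreal (2 powr (real i * \<beta>)) * Lp_norm M p (?B i)) q) (1 / q)
          + Lp_norm M p (\<lambda>y. ennreal \<bar>precise_rep f y\<bar>)
          \<le> ennreal K4 * epowr H (1 / q) + ennreal K0 * epowr H (1 / q)"
        by (intro add_mono part1 part2)
      also have "\<dots> = ennreal (K4 + K0) * epowr H (1 / q)"
        using K4 K0 by (simp only: ennreal_plus less_imp_le distrib_right)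
      also have "\<dots> \<le> ennreal (K4 + K0) * (ennreal C3 * rhs)" by (intro mult_left_mono Hq) simp
      also have "\<dots> = ennreal ((K4 + K0) * C3) * rhs"
        using K4 K0 C3 by (simp only: ennreal_mult less_imp_le add_nonneg_nonneg mult.assoc)
      finally show ?thesis unfolding rhs_def X_def N_def .
    qed
  qed
  have "0 < (K4 + K0) * C3" using K4 K0 C3 by simp
  then show ?thesis using main unfolding \<beta>_def by blast
qed

theorem theorem4p1:
  fixes S :: "(real ^ 'n) set" and d p q \<alpha> u :: real and k :: int
  assumes "d_set d S"
    and "real CARD('n) - 1 < d" and "d < real CARD('n)"
    and "1 \<le> p" and "1 \<le> q"
    and "(real CARD('n) - d) / p < \<alpha>"
    and "1 \<le> u" and "u \<le> p"
    and "\<alpha> < of_int k"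
  shows "\<exists>C::real. 0 < C \<and> (\<forall>f :: real ^ 'n \<Rightarrow> real. f \<in> besov \<alpha> p q \<longrightarrow>
    epowr (\<Sum>i::nat. epowr (ennreal (2 powr (real i * (\<alpha> - (real CARD('n) - d) / p)))
        * Lp_norm (hausdorff_on d S) p (best_approx_on d S k u (trace_on S f) (2 powr - real i))) q) (1 / q)
      + Lp_norm (hausdorff_on d S) p (\<lambda>x. ennreal \<bar>trace_on S f x\<bar>)
    \<le> ennreal C *
      (epowr (\<Sum>j::nat. epowr (ennreal (2 powr (real j * \<alpha>))
          * Lp_norm lebesgue p (best_approx_Rn k u f (2 powr - real j))) q) (1 / q)
        + Lp_norm lebesgue p (\<lambda>x. ennreal \<bar>f x\<bar>)))"
proof -
  have "real CARD('n) \<ge> 1" by (simp add: Suc_leI)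
  then have d0: "0 \<le> d" using assms(2) by linarith
  \<comment> \<open>Since d < n, \<alpha> is positive and therefore k \<ge> 1; the extrapolation
    behind the polynomial bounds then has at least one node.\<close>
  have "0 \<le> (real CARD('n) - d) / p" using assms(3,4) by simp
  then have "0 < real_of_int k" using assms(6,9) by linarith
  then have k: "0 < k" by simp
  obtain c1 c2 where ahl: "ahlfors_measure (hausdorff_on d S) d c1 c2"
    using d_set_ahlfors_measure[OF assms(1) d0] by blast
  have space: "space (hausdorff_on d S) = S" by (simp add: space_restrict_space)
  \<comment> \<open>Outside S the function \<open>trace_on S f\<close> is \<open>undefined\<close>,
    but the integrals with respect to the measure on S see only points of S.\<close>
  have trace: "trace_on S f x = precise_rep f x" if "x \<in> S" for f x
    using that by (simp add: trace_on_def)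
  have norm: "Lp_norm (hausdorff_on d S) p (\<lambda>x. ennreal \<bar>trace_on S f x\<bar>)
      = Lp_norm (hausdorff_on d S) p (\<lambda>x. ennreal \<bar>precise_rep f x\<bar>)" for f
    unfolding Lp_norm_def by (intro arg_cong2[where f = epowr] nn_integral_cong) (auto simp: space trace)
  have approx: "best_approx_on d S k u (trace_on S f) t
      = (\<lambda>x. best_approx (hausdorff_on d S) k u (precise_rep f) (cube x t \<inter> space (hausdorff_on d S)))" for f t
    unfolding best_approx_on_def best_approx_def space
    by (intro ext INF_cong refl arg_cong2[where f = epowr] arg_cong2[where f = "(/)"] nn_integral_cong)
      (auto simp: space trace)
  show ?thesis
    unfolding norm approx
    using ahlfors_measure.trace_estimate[OF ahl k assms(7,8,5) less_imp_le[OF assms(3)] assms(6)]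
    by (auto simp: besov_def)
qed

end
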